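(* Let $\mathcal D$ be a dyadic lattice in $\mathbb R^N$ and let $r\ge0$ be an integer. Let $T$ be either a big Haar shift of complexity $r$, or a paraproduct $\Pi_b^r$ of order $r$ with $\|\Pi_b^r\|_{L^2\to L^2}\le2^{-Nr/2}$ (so that it is a generalized big Haar shift), and let $T$ be $r$-separated. Given $\varepsilon\in(0,1)$ there exists a constant $C=C(\varepsilon,N,d)$ such that for every compactly supported $f\in L^1(\mathbb R^N;\mathbb R^d)$ there exists an $\varepsilon$-sparse family $\mathcal S\subset\mathcal D$ such that $$Tf(x)\in C\,\mathbf L_{\mathcal S}f(x)\qquad\text{for a.e. }x\in\mathbb R^N.$$
   Context: A dyadic lattice is any translation of the standard dyadic lattice; $\mathcal D_j$ denotes the cubes of $\mathcal D$ of generation $j\in\mathbb Z$ (side length $2^{-j}$); $\mathrm{ch}^kQ$ denotes the $k$-th generation dyadic descendants of $Q$. $\langle f\rangle_Q=|Q|^{-1}\int_Qf\,dx$. A generalized big Haar shift of complexity $r\ge0$ is an operator bounded in $L^2(\mathbb R^N)$ of the form $\sum_{Q\in\mathcal D}T_Q$, $T_Qf(x)=\int K_Q(x,y)f(y)\,dy$, where each kernel $K_Q$ is supported on $Q\times Q$, is constant on all $R\times S$ with $R,S\in\mathrm{ch}^{r+1}Q$, and satisfies $\|K_Q\|_\infty\le|Q|^{-1}$. It is a big Haar shift if in addition $T_Q\mathbf 1_Q=0$ and $T_Q^*\mathbf 1_Q=0$ for all $Q$. For a locally integrable $b$, $\Pi_b^rf=\sum_{Q\in\mathcal D}\langle f\rangle_Q\sum_{R\in\mathrm{ch}^rQ}\Delta_Rb$,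 where $\Delta_Rb=\sum_{S\in\mathrm{ch}^1R}\langle b\rangle_S\mathbf 1_S-\langle b\rangle_R\mathbf 1_R$; here $T_Qf=\langle f\rangle_Q\sum_{R\in\mathrm{ch}^rQ}\Delta_Rb$. A generalized big Haar shift is $r$-separated if there exists $k\in\{0,1,\dots,r\}$ such that $T_Q\ne0$ only if $Q\in\mathcal D^k:=\bigcup_{j\in\mathbb Z}\mathcal D_{k+(r+1)j}$. Such $T$ is of weak type $1$-$1$, hence defined on $L^1$; on $\mathbb R^d$-valued functions it acts componentwise (as $T\otimes\mathbf I_d$). A collection $\mathcal S\subset\mathcal D$ is $\varepsilon$-sparse if $\sum_{R\in\mathrm{ch}_{\mathcal S}Q}|R|\le\varepsilon|Q|$ for every $Q\in\mathcal S$, where $\mathrm{ch}_{\mathcal S}Q$ (the $\mathcal S$-children of $Q$) is the set of maximal cubes of $\mathcal S$ strictly contained in $Q$. For $f\in L^1(Q;\mathbb R^d)$, $\langle\!\langle f\rangle\!\rangle_Q:=\{\langle\varphi f\rangle_Q:\ \varphi:Q\to\mathbb R\text{ measurable},\ \|\varphi\|_\infty\le1\}$. The convex body valued sparse operator is $\mathbf L_{\mathcal S}f(x)=\sum_{Q\in\mathcal S}\langle\!\langle f\rangle\!\rangle_Q\mathbf 1_Q(x)$ (Minkowski sum), i.e. the set of all sums of absolutely convergent series $\sum_{Q\in\mathcal S,\,x\in Q}v_Q$ with $v_Q\in\langle\!\langle f\rangle\!\rangle_Q$. *)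

theory Defs
  imports "HOL-Analysis.Analysis"
begin

section \<open>Dyadic lattices\<close>

text \<open>A dyadic lattice is given by its translation vector \<open>t\<close>. Cubes are half-open, so that the
  cubes of one generation partition the space.\<close>

definition dyadic_cube :: "real^'n \<Rightarrow> int \<Rightarrow> int^'n \<Rightarrow> (real^'n) set" where
  "dyadic_cube t j m =
     {x. \<forall>i. of_int (m $ i) * 2 powi (- j) \<le> x $ i - t $ i \<and>
             x $ i - t $ i < (of_int (m $ i) + 1) * 2 powi (- j)}"

definition dyadic_gen :: "real^'n \<Rightarrow> int \<Rightarrow> (real^'n) set set" where
  "dyadic_gen t j = range (dyadic_cube t j)"

definition dyadic_lattice :: "real^'n \<Rightarrow> (real^'n) set set" where
  "dyadic_lattice t = (\<Union>j. dyadic_gen t j)"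

definition dyadic_desc :: "real^'n \<Rightarrow> nat \<Rightarrow> (real^'n) set \<Rightarrow> (real^'n) set set" where
  "dyadic_desc t k Q = {R. \<exists>j. Q \<in> dyadic_gen t j \<and> R \<in> dyadic_gen t (j + int k) \<and> R \<subseteq> Q}"

definition average ::
  "(real^'n \<Rightarrow> 'b::{banach, second_countable_topology}) \<Rightarrow> (real^'n) set \<Rightarrow> 'b" where
  "average f Q = (LINT x:Q|lebesgue. f x) /\<^sub>R measure lebesgue Q"

section \<open>Operators on functions on \<open>\<real>\<^sup>N\<close>\<close>

text \<open>Elements of \<open>L\<^sup>2\<close> are represented by functions, so an operator on \<open>L\<^sup>2\<close> is a map on functions
  whose values matter only up to null sets.\<close>

type_synonym 'n operator = "(real^'n \<Rightarrow> real) \<Rightarrow> real^'n \<Rightarrow> real"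

definition square_integrable :: "(real^'n \<Rightarrow> real) \<Rightarrow> bool" where
  "square_integrable f \<longleftrightarrow>
     f \<in> borel_measurable lebesgue \<and> integrable lebesgue (\<lambda>x. (f x)\<^sup>2)"

definition L2_norm_fun :: "(real^'n \<Rightarrow> real) \<Rightarrow> real" where
  "L2_norm_fun f = sqrt (LINT x|lebesgue. (f x)\<^sup>2)"

text \<open>\<open>T\<close> maps \<open>L\<^sup>2\<close> to \<open>L\<^sup>2\<close> with norm at most \<open>c\<close>.\<close>

definition L2_bounded_by :: "real \<Rightarrow> 'n::finite operator \<Rightarrow> bool" where
  "L2_bounded_by c T \<longleftrightarrow>
     (\<forall>f. square_integrable f \<longrightarrow>
        square_integrable (T f) \<and> L2_norm_fun (T f) \<le> c * L2_norm_fun f)"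

text \<open>\<open>T = (\<Sum>Q\<in>\<D>. \<T> Q)\<close>: the series \<open>(\<Sum>Q\<in>\<D>. \<T> Q f)\<close> converges unconditionally in \<open>L\<^sup>2\<close> to \<open>T f\<close>
  for every \<open>f\<close> in \<open>L\<^sup>2\<close>.\<close>

definition L2_operator_sum ::
  "(real^'n) set set \<Rightarrow> ((real^'n) set \<Rightarrow> 'n::finite operator) \<Rightarrow> 'n operator \<Rightarrow> bool" where
  "L2_operator_sum \<D> \<T> T \<longleftrightarrow>
     (\<forall>f. square_integrable f \<longrightarrow>
        (\<forall>Q\<in>\<D>. square_integrable (\<T> Q f)) \<and> square_integrable (T f) \<and>
        ((\<lambda>F. L2_norm_fun (\<lambda>x. (\<Sum>Q\<in>F. \<T> Q f x) - T f x)) \<longlongrightarrow> 0)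
          (finite_subsets_at_top \<D>))"

definition L2_zero_operator :: "'n::finite operator \<Rightarrow> bool" where
  "L2_zero_operator T \<longleftrightarrow> (\<forall>f. square_integrable f \<longrightarrow> (AE x in lebesgue. T f x = 0))"

definition tends_in_measure :: "(nat \<Rightarrow> real^'n \<Rightarrow> real) \<Rightarrow> (real^'n \<Rightarrow> real) \<Rightarrow> bool" where
  "tends_in_measure G g \<longleftrightarrow>
     (\<forall>\<delta>>0. (\<lambda>n. emeasure lebesgue {x. \<delta> < \<bar>G n x - g x\<bar>}) \<longlonglongrightarrow> 0)"

text \<open>An operator of weak type 1-1 is defined on \<open>L\<^sup>1\<close> by continuous extension from \<open>L\<^sup>1 \<inter> L\<^sup>2\<close>, as a map
  into the measurable functions with convergence in measure. The function chosen here is then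
  unique up to null sets.\<close>

definition L1_extension :: "'n::finite operator \<Rightarrow> 'n operator" where
  "L1_extension T f =
     (SOME g. g \<in> borel_measurable lebesgue \<and>
        (\<forall>F. (\<forall>n. integrable lebesgue (F n) \<and> square_integrable (F n)) \<and>
             (\<lambda>n. LINT x|lebesgue. \<bar>F n x - f x\<bar>) \<longlonglongrightarrow> 0
           \<longrightarrow> tends_in_measure (\<lambda>n. T (F n)) g))"

definition L1_extension_vec ::
  "'n::finite operator \<Rightarrow> (real^'n \<Rightarrow> real^'d) \<Rightarrow> real^'n \<Rightarrow> real^'d" where
  "L1_extension_vec T f x = (\<chi> i. L1_extension T (\<lambda>y. f y $ i) x)"

section \<open>Big Haar shifts and paraproducts\<close>

definition integral_operator :: "(real^'n \<Rightarrow> real^'n \<Rightarrow> real) \<Rightarrow> 'n::finite operator" where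
  "integral_operator K f x = (LINT y|lebesgue. K x y * f y)"

definition haar_kernel ::
  "real^'n \<Rightarrow> nat \<Rightarrow> (real^'n) set \<Rightarrow> (real^'n \<Rightarrow> real^'n \<Rightarrow> real) \<Rightarrow> bool" where
  "haar_kernel t r Q K \<longleftrightarrow>
     (\<forall>x y. K x y \<noteq> 0 \<longrightarrow> x \<in> Q \<and> y \<in> Q) \<and>
     (\<forall>R\<in>dyadic_desc t (r + 1) Q. \<forall>S\<in>dyadic_desc t (r + 1) Q.
        \<exists>c. \<forall>x\<in>R. \<forall>y\<in>S. K x y = c) \<and>
     (\<forall>x y. \<bar>K x y\<bar> \<le> 1 / measure lebesgue Q)"

text \<open>The shifts are recorded together with the family \<open>\<T>\<close> of their blocks \<open>T\<^sub>Q\<close>, on which the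
  separation condition depends.\<close>

definition generalized_big_haar_shift ::
  "real^'n \<Rightarrow> nat \<Rightarrow> ((real^'n) set \<Rightarrow> real^'n \<Rightarrow> real^'n \<Rightarrow> real) \<Rightarrow>
   ((real^'n) set \<Rightarrow> 'n::finite operator) \<Rightarrow> 'n operator \<Rightarrow> bool" where
  "generalized_big_haar_shift t r K \<T> T \<longleftrightarrow>
     (\<forall>Q\<in>dyadic_lattice t. haar_kernel t r Q (K Q) \<and> \<T> Q = integral_operator (K Q)) \<and>
     L2_operator_sum (dyadic_lattice t) \<T> T \<and>
     (\<exists>c. L2_bounded_by c T)"

definition big_haar_shift ::
  "real^'n \<Rightarrow> nat \<Rightarrow> ((real^'n) set \<Rightarrow> 'n::finite operator) \<Rightarrow> 'n operator \<Rightarrow> bool" where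
  "big_haar_shift t r \<T> T \<longleftrightarrow>
     (\<exists>K. generalized_big_haar_shift t r K \<T> T \<and>
        (\<forall>Q\<in>dyadic_lattice t.
           (AE x in lebesgue. \<T> Q (indicator Q) x = 0) \<and>
           (AE x in lebesgue. integral_operator (\<lambda>x y. K Q y x) (indicator Q) x = 0)))"

definition locally_integrable :: "(real^'n \<Rightarrow> real) \<Rightarrow> bool" where
  "locally_integrable b \<longleftrightarrow> (\<forall>A. compact A \<longrightarrow> set_integrable lebesgue A b)"

definition martingale_diff ::
  "real^'n \<Rightarrow> (real^'n \<Rightarrow> real) \<Rightarrow> (real^'n) set \<Rightarrow> real^'n \<Rightarrow> real" where
  "martingale_diff t b R x =
     (\<Sum>S\<in>dyadic_desc t 1 R. average b S * indicator S x) - average b R * indicator R x"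

definition paraproduct_block ::
  "real^'n \<Rightarrow> nat \<Rightarrow> (real^'n \<Rightarrow> real) \<Rightarrow> (real^'n) set \<Rightarrow> 'n::finite operator" where
  "paraproduct_block t r b Q f x =
     average f Q * (\<Sum>R\<in>dyadic_desc t r Q. martingale_diff t b R x)"

definition paraproduct ::
  "real^'n \<Rightarrow> nat \<Rightarrow> (real^'n \<Rightarrow> real) \<Rightarrow>
   ((real^'n) set \<Rightarrow> 'n::finite operator) \<Rightarrow> 'n operator \<Rightarrow> bool" where
  "paraproduct t r b \<T> T \<longleftrightarrow>
     locally_integrable b \<and>
     (\<forall>Q\<in>dyadic_lattice t. \<T> Q = paraproduct_block t r b Q) \<and>
     L2_operator_sum (dyadic_lattice t) \<T> T"

definition r_separated ::
  "real^'n \<Rightarrow> nat \<Rightarrow> ((real^'n) set \<Rightarrow> 'n::finite operator) \<Rightarrow> bool" where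
  "r_separated t r \<T> \<longleftrightarrow>
     (\<exists>k\<in>{0..r}. \<forall>Q\<in>dyadic_lattice t. \<not> L2_zero_operator (\<T> Q) \<longrightarrow>
        Q \<in> (\<Union>j::int. dyadic_gen t (int k + (int r + 1) * j)))"

section \<open>Sparse families and the convex body valued sparse operator\<close>

definition sparse_children :: "(real^'n) set set \<Rightarrow> (real^'n) set \<Rightarrow> (real^'n) set set" where
  "sparse_children \<S> Q =
     {R\<in>\<S>. R \<subset> Q \<and> \<not> (\<exists>R'\<in>\<S>. R \<subset> R' \<and> R' \<subset> Q)}"

definition sparse_family :: "real \<Rightarrow> (real^'n) set set \<Rightarrow> bool" where
  "sparse_family \<epsilon> \<S> \<longleftrightarrow>
     (\<forall>Q\<in>\<S>. measure lebesgue summable_on sparse_children \<S> Q \<and>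
        (\<Sum>\<^sub>\<infinity>R\<in>sparse_children \<S> Q. measure lebesgue R) \<le> \<epsilon> * measure lebesgue Q)"

definition convex_body_average ::
  "(real^'n \<Rightarrow> real^'d) \<Rightarrow> (real^'n) set \<Rightarrow> (real^'d) set" where
  "convex_body_average f Q =
     {average (\<lambda>x. \<phi> x *\<^sub>R f x) Q | \<phi>.
        \<phi> \<in> borel_measurable (lebesgue_on Q) \<and> (AE x in lebesgue_on Q. \<bar>\<phi> x\<bar> \<le> 1)}"

definition sparse_operator ::
  "(real^'n) set set \<Rightarrow> (real^'n \<Rightarrow> real^'d) \<Rightarrow> real^'n \<Rightarrow> (real^'d) set" where
  "sparse_operator \<S> f x =
     {\<Sum>\<^sub>\<infinity>Q\<in>{Q\<in>\<S>. x \<in> Q}. v Q | v.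
        (\<forall>Q\<in>\<S>. x \<in> Q \<longrightarrow> v Q \<in> convex_body_average f Q) \<and>
        (\<lambda>Q. norm (v Q)) summable_on {Q\<in>\<S>. x \<in> Q}}"

definition ae_compactly_supported :: "(real^'n \<Rightarrow> real^'d) \<Rightarrow> bool" where
  "ae_compactly_supported f \<longleftrightarrow>
     (\<exists>A. compact A \<and> (AE x in lebesgue. x \<notin> A \<longrightarrow> f x = 0))"

end

theory Submission
  imports Defs
begin

text \<open>Let \<open>N\<close> be the dimension. For one of the two kinds of operator, group the cubes of the generations
\<open>k + (r + 1) j\<close> into levels \<open>j\<close>. A block \<open>T\<^sub>Q\<close> with \<open>Q\<close> of level \<open>j\<close> has a kernel of size \<open>O(1/|Q|)\<close> that is
constant on products of cubes of level \<open>j + 1\<close>, and its values have mean zero. Hence the sum of the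
blocks of levels \<open>m \<le> j < n\<close> applied to a function \<open>g\<close> in \<open>L\<^sup>2\<close> is \<open>E\<^sub>n (T g) - E\<^sub>m (T g)\<close>, where \<open>E\<^sub>n\<close> averages
over the cubes of level \<open>n\<close>. Also \<open>T\<close> has norm at most 1 on \<open>L\<^sup>2\<close>: for a paraproduct this is given, and for
a Haar shift it follows because the blocks are mutually orthogonal and a block sees only the martingale
difference of \<open>g\<close> on its cube. The locale \<open>dyadic_shift\<close> collects these properties, with the constant
\<open>A = 2\<^sup>N + 1\<close> in the kernel bound; everything up to \<open>sparse_domination\<close> uses nothing else.

Constants must not depend on \<open>r\<close>, and separation of the levels is what makes this possible. In the
Calderon-Zygmund decomposition \<open>f = g + b\<close> along stopping cubes of all generations, a stopping cube \<open>R\<close>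
contributes outside itself only through the kernels of larger cubes \<open>Q\<close>. Such a kernel is constant on \<open>R\<close>
in the variable of integration, so the mean zero of \<open>b\<close> on \<open>R\<close> kills it, unless \<open>R\<close> lies strictly
between the levels of \<open>Q\<close> and of its children; this happens for at most one level. The bad part is thus handled by one \<open>L\<^sup>1\<close> estimate without any sum over
the \<open>r\<close> intermediate generations. The good part is controlled by the dyadic maximal function of \<open>(T g)\<^sup>2\<close>.
This gives the weak type estimate \<open>weak_type\<close> for all partial sums at once, hence almost everywhere
convergence of the partial sums, hence the identification of \<open>L1_extension\<close> with their limit.

For \<open>f\<close> with values in \<open>\<real>\<^sup>d\<close> and a cube \<open>Q\<close>, choose vectors \<open>e\<^sub>i\<close> in the convex body \<open>K\<close> of \<open>f\<close> on \<open>Q\<close> and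
functionals \<open>l\<^sub>i\<close>, bounded on \<open>K\<close> by a constant depending on \<open>d\<close>, that give the coordinates in the span of
\<open>K\<close> (\<open>almost_auerbach_basis\<close>). A vector in the span all of whose coordinates are at most \<open>c\<close> lies in
\<open>d c K\<close>, and each \<open>l\<^sub>i \<circ> f\<close> is a scalar function whose average on \<open>Q\<close> is bounded. Stop at the first level
where a partial sum for some \<open>l\<^sub>i \<circ> f\<close>, started at \<open>Q\<close>, or the average of some \<open>|l\<^sub>i \<circ> f|\<close> exceeds a large
threshold. By the weak type estimates the stopping cubes fill at most the fraction \<open>\<epsilon>\<close> of \<open>Q\<close>. Before
the stopping time the partial sums lie in a multiple of \<open>K\<close>; the step that causes the stop is one more
block over a cube that was not stopped, so it adds a bounded amount only. Iterating from the \<open>2\<^sup>N\<close> cubes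
that touch the centre of the lattice and contain the support of \<open>f\<close> gives the part of the family inside
these cubes. Outside, only the larger cubes act on \<open>f\<close>; their blocks form a geometric series in a single
convex body, so it suffices to add every \<open>M\<close>-th ancestor, with \<open>2\<^sup>-\<^sup>M \<le> \<epsilon>\<close>.\<close>

section \<open>Dyadic cubes as level sets of an index\<close>

definition dyadic_index :: "real^'n \<Rightarrow> int \<Rightarrow> real^'n \<Rightarrow> int^'n" where
  "dyadic_index t j x = (\<chi> i. \<lfloor>(x $ i - t $ i) * 2 powi j\<rfloor>)"

definition cube_at :: "real^'n \<Rightarrow> int \<Rightarrow> real^'n \<Rightarrow> (real^'n) set" where
  "cube_at t j x = {y. dyadic_index t j y = dyadic_index t j x}"

lemma mem_cube_at: "y \<in> cube_at t j x \<longleftrightarrow> dyadic_index t j y = dyadic_index t j x"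
  by (simp add: cube_at_def)

lemma self_in_cube_at [simp]: "x \<in> cube_at t j x"
  by (simp add: cube_at_def)

lemma cube_at_eq: "y \<in> cube_at t j x \<Longrightarrow> cube_at t j y = cube_at t j x"
  by (simp add: cube_at_def)

lemma dyadic_cube_index: "dyadic_cube t j m = {y. dyadic_index t j y = m}"
proof -
  have "(of_int a * 2 powi (- j) \<le> u \<and> u < (of_int a + 1) * 2 powi (- j)) \<longleftrightarrow> \<lfloor>u * 2 powi j\<rfloor> = a"
    for a and u :: real
    by (simp add: floor_eq_iff power_int_minus field_simps)
  then show ?thesis
    by (simp add: dyadic_cube_def dyadic_index_def vec_eq_iff)
qed

lemma dyadic_index_surj: "\<exists>x. dyadic_index t j x = m"
proof
  show "dyadic_index t j (\<chi> i. t $ i + of_int (m $ i) * 2 powi (- j)) = m"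
    by (simp add: dyadic_index_def vec_eq_iff power_int_minus field_simps)
qed

lemma dyadic_gen_eq: "dyadic_gen t j = range (cube_at t j)"
proof -
  have "\<exists>x. dyadic_cube t j m = cube_at t j x" for m
    using dyadic_index_surj[of t j m] by (auto simp: dyadic_cube_index cube_at_def)
  moreover have "\<exists>m. cube_at t j x = dyadic_cube t j m" for x
    by (auto simp: dyadic_cube_index cube_at_def)
  ultimately show ?thesis
    unfolding dyadic_gen_def by (metis (mono_tags, lifting) image_cong rangeE rangeI subsetI subset_antisym)
qed

lemma dyadic_index_div:
  "dyadic_index t (j - int s) x $ i = dyadic_index t j x $ i div 2 ^ s"
proof -
  have "(x $ i - t $ i) * 2 powi (j - int s) = ((x $ i - t $ i) * 2 powi j) / real_of_int (2 ^ s)"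
    by (simp add: power_int_diff)
  then show ?thesis
    unfolding dyadic_index_def by (simp add: floor_divide_real_eq_div del: of_int_power)
qed

lemma dyadic_index_coarser:
  assumes "j' \<le> j" "dyadic_index t j x = dyadic_index t j y"
  shows "dyadic_index t j' x = dyadic_index t j' y"
proof -
  obtain s where s: "j' = j - int s"
    using assms(1) by (metis diff_diff_cancel diff_ge_0_iff_ge int_nat_eq minus_diff_eq diff_minus_eq_add add_diff_cancel_left' diff_add_cancel nonneg_int_cases)
  show ?thesis
    using assms(2) by (simp add: s vec_eq_iff dyadic_index_div)
qed

lemma cube_at_antimono: "j' \<le> j \<Longrightarrow> cube_at t j x \<subseteq> cube_at t j' x"
  by (auto simp: mem_cube_at intro: dyadic_index_coarser)

lemma measurable_dyadic_index_borel: "dyadic_index t j \<in> borel \<rightarrow>\<^sub>M count_space (UNIV :: (int^'n) set)"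
proof -
  have "dyadic_index t j -` {m} \<in> sets borel" for m :: "int^'n"
  proof -
    have "dyadic_index t j -` {m} = {x. \<forall>i. \<lfloor>(x $ i - t $ i) * 2 powi j\<rfloor> = m $ i}"
      by (auto simp: dyadic_index_def vec_eq_iff)
    also have "\<dots> = (\<Inter>i. {x. of_int (m $ i) \<le> (x $ i - t $ i) * 2 powi j} \<inter> {x. (x $ i - t $ i) * 2 powi j < of_int (m $ i) + 1})"
      by (auto simp: floor_eq_iff)
    also have "\<dots> \<in> sets borel"
      by (intro sets.countable_INT' sets.Int) (auto intro!: closed_Collect_le open_Collect_less continuous_intros)
    finally show ?thesis .
  qed
  then show ?thesis
    by (subst measurable_count_space_eq2_countable) (auto simp: countableI_type)
qed

lemma measurable_dyadic_index [measurable]: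
  "dyadic_index t j \<in> lebesgue \<rightarrow>\<^sub>M count_space (UNIV :: (int^'n) set)"
  using measurable_dyadic_index_borel[of t j]
  by (simp add: measurable_completion)

lemma sets_dyadic_index: "{x. P (dyadic_index t j x)} \<in> sets lebesgue"
  using measurable_sets[OF measurable_dyadic_index[of t j], of "{m. P m}"] by (simp add: vimage_def)

lemma sets_cube_at [measurable, simp]: "cube_at t j x \<in> sets lebesgue"
  unfolding cube_at_def by (rule sets_dyadic_index)

lemma borel_measurable_dyadic_index:
  fixes h :: "int^'n \<Rightarrow> 'b::topological_space"
  shows "(\<lambda>x. h (dyadic_index t j x)) \<in> borel_measurable lebesgue"
  by (rule measurable_compose[OF measurable_dyadic_index]) simp

text \<open>Such a function factors through the index, which takes countably many values, so it is measurable
whatever its values are. This covers kernels, blocks and averages alike.\<close>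

lemma cube_const_measurable:
  fixes h :: "real^'n \<Rightarrow> 'b::topological_space"
  assumes const: "\<And>x y. y \<in> cube_at t j x \<Longrightarrow> h y = h x"
  shows "h \<in> borel_measurable lebesgue"
proof -
  have "h = (\<lambda>y. (\<lambda>m. h (SOME z. dyadic_index t j z = m)) (dyadic_index t j y))"
  proof
    fix y
    have "dyadic_index t j (SOME z. dyadic_index t j z = dyadic_index t j y) = dyadic_index t j y"
      by (rule someI[where x=y]) simp
    then show "h y = (\<lambda>m. h (SOME z. dyadic_index t j z = m)) (dyadic_index t j y)"
      by (intro const[symmetric]) (simp add: mem_cube_at)
  qed
  then show ?thesis
    using borel_measurable_dyadic_index[of "\<lambda>m. h (SOME z. dyadic_index t j z = m)" t j] by simp
qed

text \<open>Half-open cubes lie between the open and the closed box with the same corners, whose measures are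
known and agree.\<close>

lemma cube_at_sandwich:
  fixes t :: "real^'n"
  defines "a \<equiv> \<lambda>j x. (\<chi> i. t $ i + of_int (dyadic_index t j x $ i) * 2 powi (- j)) :: real^'n"
    and "b \<equiv> \<lambda>j x. (\<chi> i. t $ i + (of_int (dyadic_index t j x $ i) + 1) * 2 powi (- j)) :: real^'n"
  shows "box (a j x) (b j x) \<subseteq> cube_at t j x" "cube_at t j x \<subseteq> cbox (a j x) (b j x)"
    "emeasure lborel (box (a j x) (b j x)) = ennreal ((2 powi (- j)) ^ CARD('n))"
    "emeasure lborel (cbox (a j x) (b j x)) = ennreal ((2 powi (- j)) ^ CARD('n))"
proof -
  have c: "cube_at t j x = dyadic_cube t j (dyadic_index t j x)"
    by (auto simp: dyadic_cube_index cube_at_def)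
  show "box (a j x) (b j x) \<subseteq> cube_at t j x" "cube_at t j x \<subseteq> cbox (a j x) (b j x)"
    unfolding c dyadic_cube_def a_def b_def
    by (auto simp: mem_box_cart algebra_simps less_imp_le)
  have *: "(\<Prod>k\<in>Basis. (b j x - a j x) \<bullet> k) = (2 powi (- j)) ^ CARD('n)"
  proof -
    have "(\<Prod>k\<in>Basis. (b j x - a j x) \<bullet> k) = (\<Prod>k\<in>(Basis :: (real^'n) set). 2 powi (- j))"
      by (rule prod.cong) (auto simp: a_def b_def Basis_vec_def inner_axis algebra_simps)
    then show ?thesis by simp
  qed
  have le: "a j x \<bullet> k \<le> b j x \<bullet> k" if "k \<in> Basis" for k
    using that by (auto simp: a_def b_def Basis_vec_def inner_axis algebra_simps)
  show "emeasure lborel (box (a j x) (b j x)) = ennreal ((2 powi (- j)) ^ CARD('n))"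
    by (subst emeasure_lborel_box) (auto simp: le *)
  show "emeasure lborel (cbox (a j x) (b j x)) = ennreal ((2 powi (- j)) ^ CARD('n))"
    by (subst emeasure_lborel_cbox) (auto simp: le *)
qed

lemma emeasure_cube_at:
  fixes t :: "real^'n"
  shows "emeasure lebesgue (cube_at t j x) = ennreal ((2 powi (- j)) ^ CARD('n))"
proof (rule antisym)
  show "emeasure lebesgue (cube_at t j x) \<le> ennreal ((2 powi (- j)) ^ CARD('n))"
    using emeasure_mono[OF cube_at_sandwich(2)[of t j x], of lebesgue] by (simp add: cube_at_sandwich(4))
  show "ennreal ((2 powi (- j)) ^ CARD('n)) \<le> emeasure lebesgue (cube_at t j x)"
    using emeasure_mono[OF cube_at_sandwich(1)[of t j x], of lebesgue] by (simp add: cube_at_sandwich(3))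
qed

lemma measure_cube_at:
  fixes t :: "real^'n"
  shows "measure lebesgue (cube_at t j x) = (2 powi (- j)) ^ CARD('n)"
  by (simp add: measure_def emeasure_cube_at)

lemma measure_cube_at_pos: "measure lebesgue (cube_at t j x) > 0"
  by (simp add: measure_cube_at)

lemma fmeasurable_cube_at [simp]: "cube_at t j x \<in> lmeasurable"
  by (rule fmeasurableI) (simp_all add: emeasure_cube_at)

lemma cube_at_inj_gen:
  fixes t :: "real^'n"
  assumes "cube_at t j x = cube_at t j' y"
  shows "j = j'"
proof (rule ccontr)
  assume "j \<noteq> j'"
  have "(2 powi (- j)) ^ CARD('n) = ((2::real) powi (- j')) ^ CARD('n)"
    using assms by (metis measure_cube_at)
  then have "(2::real) powi (- j) = 2 powi (- j')"
    by (rule power_eq_imp_eq_base) auto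
  then show False using \<open>j \<noteq> j'\<close>
      power_int_strict_increasing[of "- j" "- j'" "2::real"] power_int_strict_increasing[of "- j'" "- j" "2::real"]
    by linarith
qed

section \<open>Averages over stopping cubes\<close>

text \<open>The value at \<open>x\<close> is the generation of the cube that is chosen at \<open>x\<close>. The condition says that
every point of this cube chooses the same cube, so that the chosen cubes partition the space.\<close>

definition stopping_gen :: "real^'n \<Rightarrow> (real^'n \<Rightarrow> int) \<Rightarrow> bool" where
  "stopping_gen t \<sigma> \<longleftrightarrow> (\<forall>x y. y \<in> cube_at t (\<sigma> x) x \<longrightarrow> \<sigma> y = \<sigma> x)"

lemma stopping_gen_const [simp]: "stopping_gen t (\<lambda>_. j)"
  by (simp add: stopping_gen_def)

text \<open>The conditional expectation with respect to the chosen cubes; a constant \<open>\<sigma>\<close> gives the averaging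
operator of one generation.\<close>

definition cond_avg ::
  "real^'n \<Rightarrow> (real^'n \<Rightarrow> int) \<Rightarrow> (real^'n \<Rightarrow> 'b::{banach, second_countable_topology}) \<Rightarrow> real^'n \<Rightarrow> 'b" where
  "cond_avg t \<sigma> f x = average f (cube_at t (\<sigma> x) x)"

lemma measurable_stopping_gen:
  assumes "stopping_gen t \<sigma>"
  shows "\<sigma> \<in> lebesgue \<rightarrow>\<^sub>M count_space UNIV"
proof -
  have "\<sigma> -` {j} \<in> sets lebesgue" for j
  proof -
    have "\<sigma> -` {j} = {x. \<exists>y. dyadic_index t j y = dyadic_index t j x \<and> \<sigma> y = j}"
    proof (intro set_eqI iffI)
      fix x assume "x \<in> {x. \<exists>y. dyadic_index t j y = dyadic_index t j x \<and> \<sigma> y = j}"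
      then obtain y where "dyadic_index t j y = dyadic_index t j x" "\<sigma> y = j" by auto
      then have "x \<in> cube_at t (\<sigma> y) y" by (simp add: mem_cube_at)
      then show "x \<in> \<sigma> -` {j}" using assms \<open>\<sigma> y = j\<close> unfolding stopping_gen_def by auto
    qed auto
    then show ?thesis by (simp add: sets_dyadic_index[where P="\<lambda>m. \<exists>y. dyadic_index t j y = m \<and> \<sigma> y = j"])
  qed
  then show ?thesis
    by (subst measurable_count_space_eq2_countable) (auto simp: countableI_type)
qed

lemma average_cube_measurable [measurable]:
  "(\<lambda>x. average f (cube_at t j x)) \<in> borel_measurable lebesgue"
  unfolding cube_at_def by (rule borel_measurable_dyadic_index[where h="\<lambda>m. average f {y. dyadic_index t j y = m}"])

lemma cond_avg_measurable:
  assumes "stopping_gen t \<sigma>"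
  shows "cond_avg t \<sigma> f \<in> borel_measurable lebesgue"
  unfolding cond_avg_def
  by (rule measurable_compose_countable[OF average_cube_measurable measurable_stopping_gen[OF assms]])

text \<open>The chosen cubes are the fibres of the map that sends \<open>x\<close> to the generation and the index of its
cube. As this map has countably many values, the integral is the sum of the integrals over the fibres.\<close>

lemma nn_integral_stopping_partition:
  fixes F G :: "real^'n \<Rightarrow> ennreal"
  assumes st: "stopping_gen t \<sigma>"
    and [measurable]: "F \<in> borel_measurable lebesgue" "G \<in> borel_measurable lebesgue"
    and eq: "\<And>x. (\<integral>\<^sup>+y\<in>cube_at t (\<sigma> x) x. F y \<partial>lebesgue) = (\<integral>\<^sup>+y\<in>cube_at t (\<sigma> x) x. G y \<partial>lebesgue)"
  shows "(\<integral>\<^sup>+x. F x \<partial>lebesgue) = (\<integral>\<^sup>+x. G x \<partial>lebesgue)"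
proof -
  define key where "key x = (\<sigma> x, dyadic_index t (\<sigma> x) x)" for x
  have fibre: "{y. key y = key x} = cube_at t (\<sigma> x) x" for x
  proof (intro set_eqI iffI)
    fix y assume "y \<in> {y. key y = key x}"
    then have "key y = key x" by simp
    then have c: "\<sigma> y = \<sigma> x \<and> dyadic_index t (\<sigma> y) y = dyadic_index t (\<sigma> x) x"
      unfolding key_def prod.inject .
    show "y \<in> cube_at t (\<sigma> x) x"
      using conjunct2[OF c] unfolding mem_cube_at conjunct1[OF c] .
  next
    fix y assume y: "y \<in> cube_at t (\<sigma> x) x"
    then have "\<sigma> y = \<sigma> x" using st unfolding stopping_gen_def by blast
    then show "y \<in> {y. key y = key x}" using y by (simp add: key_def mem_cube_at)
  qed
  have fib_meas: "{x. key x = p} \<in> sets lebesgue" for p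
  proof (cases "\<exists>x. key x = p")
    case True
    then obtain x where "key x = p" by auto
    then have "{x. key x = p} = cube_at t (\<sigma> x) x" using fibre[of x] by simp
    then show ?thesis by (simp only: sets_cube_at)
  next
    case False
    then have "{x. key x = p} = {}" by auto
    then show ?thesis by simp
  qed
  have split: "(\<integral>\<^sup>+x. H x \<partial>lebesgue) = (\<integral>\<^sup>+p. (\<integral>\<^sup>+x. H x * indicator {x. key x = p} x \<partial>lebesgue) \<partial>count_space UNIV)"
    if [measurable]: "H \<in> borel_measurable lebesgue" for H :: "real^'n \<Rightarrow> ennreal"
  proof -
    have "(\<integral>\<^sup>+p. (\<integral>\<^sup>+x. H x * indicator {x. key x = p} x \<partial>lebesgue) \<partial>count_space UNIV)
       = (\<integral>\<^sup>+x. (\<integral>\<^sup>+p. H x * indicator {x. key x = p} x \<partial>count_space UNIV) \<partial>lebesgue)"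
      by (rule nn_integral_count_space_nn_integral[symmetric, OF countableI_type])
        (intro borel_measurable_times_ennreal that borel_measurable_indicator fib_meas)
    also have "\<dots> = (\<integral>\<^sup>+x. (\<integral>\<^sup>+p. H x * indicator {key x} p \<partial>count_space UNIV) \<partial>lebesgue)"
      by (rule nn_integral_cong, rule nn_integral_cong) (simp add: indicator_def eq_commute)
    also have "\<dots> = (\<integral>\<^sup>+x. H x \<partial>lebesgue)"
      by (simp add: nn_integral_cmult_indicator)
    finally show ?thesis by (rule sym)
  qed
  have "(\<integral>\<^sup>+x. F x * indicator {x. key x = p} x \<partial>lebesgue) = (\<integral>\<^sup>+x. G x * indicator {x. key x = p} x \<partial>lebesgue)" for p
  proof (cases "\<exists>x. key x = p")
    case True
    then obtain x where "key x = p" by auto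
    then have "{x. key x = p} = cube_at t (\<sigma> x) x" using fibre[of x] by simp
    then show ?thesis using eq[of x] by (simp only:)
  next
    case False
    then have "{x. key x = p} = {}" by auto
    then show ?thesis by simp
  qed
  then have "(\<integral>\<^sup>+p. (\<integral>\<^sup>+x. F x * indicator {x. key x = p} x \<partial>lebesgue) \<partial>count_space UNIV)
      = (\<integral>\<^sup>+p. (\<integral>\<^sup>+x. G x * indicator {x. key x = p} x \<partial>lebesgue) \<partial>count_space UNIV)"
    by (rule nn_integral_cong)
  with split[OF assms(2)] split[OF assms(3)] show ?thesis by (simp only:)
qed

lemma set_integrable_cube [simp]:
  fixes f :: "real^'n \<Rightarrow> 'b::{banach, second_countable_topology}"
  assumes "integrable lebesgue f"
  shows "set_integrable lebesgue (cube_at t j x) f"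
  using integrable_mult_indicator[OF sets_cube_at assms] by (simp add: set_integrable_def)

lemma cond_avg_eq:
  assumes "stopping_gen t \<sigma>" "y \<in> cube_at t (\<sigma> x) x"
  shows "cond_avg t \<sigma> f y = cond_avg t \<sigma> f x"
  using assms cube_at_eq[OF assms(2)] unfolding stopping_gen_def cond_avg_def by auto

lemma average_nonneg: "(\<And>x. 0 \<le> f x) \<Longrightarrow> 0 \<le> average f Q" for f :: "real^'n \<Rightarrow> real"
  unfolding average_def set_lebesgue_integral_def by (auto intro!: scaleR_nonneg_nonneg integral_nonneg)

lemma average_add:
  fixes f g :: "real^'n \<Rightarrow> 'b::{banach, second_countable_topology}"
  assumes "set_integrable lebesgue Q f" "set_integrable lebesgue Q g"
  shows "average (\<lambda>x. f x + g x) Q = average f Q + average g Q"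
  using assms unfolding average_def by (simp add: set_integral_add scaleR_add_right)

lemma average_diff:
  fixes f g :: "real^'n \<Rightarrow> 'b::{banach, second_countable_topology}"
  assumes "set_integrable lebesgue Q f" "set_integrable lebesgue Q g"
  shows "average (\<lambda>x. f x - g x) Q = average f Q - average g Q"
  using assms unfolding average_def by (simp add: set_integral_diff scaleR_diff_right)

lemma average_cmult: "average (\<lambda>x. c * f x) Q = c * average f Q" for f :: "real^'n \<Rightarrow> real"
  unfolding average_def by simp

lemma average_cong: "(\<And>x. x \<in> Q \<Longrightarrow> f x = g x) \<Longrightarrow> average f Q = average g Q"
  unfolding average_def set_lebesgue_integral_def
  by (auto intro!: arg_cong[where f="\<lambda>z. z /\<^sub>R _"] Bochner_Integration.integral_cong simp: indicator_def)

lemma average_const: "average (\<lambda>_. c) (cube_at t j x) = c" for c :: "'b::{banach, second_countable_topology}"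
  using measure_cube_at_pos[of t j x] fmeasurable_cube_at[of t j x]
  unfolding average_def by (simp add: set_integral_const fmeasurable_def)

lemma average_mono:
  fixes f g :: "real^'n \<Rightarrow> real"
  assumes "set_integrable lebesgue Q f" "set_integrable lebesgue Q g" "\<And>x. x \<in> Q \<Longrightarrow> f x \<le> g x"
  shows "average f Q \<le> average g Q"
  unfolding average_def using set_integral_mono[OF assms]
  by (auto intro: mult_left_mono)

lemma norm_average_le:
  fixes f :: "real^'n \<Rightarrow> 'b::{banach, second_countable_topology}"
  shows "norm (average f Q) \<le> average (\<lambda>x. norm (f x)) Q"
proof -
  have "norm (LINT x:Q|lebesgue. f x) \<le> (LINT x:Q|lebesgue. norm (f x))"
    unfolding set_lebesgue_integral_def
    using integral_norm_bound[of lebesgue "\<lambda>x. indicat_real Q x *\<^sub>R f x"] by simp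
  then show ?thesis
    unfolding average_def by (simp add: mult_left_mono)
qed

lemma nn_integral_cond_avg:
  fixes f :: "real^'n \<Rightarrow> real"
  assumes st: "stopping_gen t \<sigma>" and f: "integrable lebesgue f" and nonneg: "\<And>x. 0 \<le> f x"
  shows "(\<integral>\<^sup>+x. ennreal (cond_avg t \<sigma> f x) \<partial>lebesgue) = (\<integral>\<^sup>+x. ennreal (f x) \<partial>lebesgue)"
proof (rule nn_integral_stopping_partition[OF st])
  show "(\<lambda>x. ennreal (cond_avg t \<sigma> f x)) \<in> borel_measurable lebesgue"
    using cond_avg_measurable[OF st, of f] by measurable
  show "(\<lambda>x. ennreal (f x)) \<in> borel_measurable lebesgue"
    using f by measurable
  fix x
  let ?Q = "cube_at t (\<sigma> x) x"
  have "(\<integral>\<^sup>+y\<in>?Q. ennreal (cond_avg t \<sigma> f y) \<partial>lebesgue) = (\<integral>\<^sup>+y. ennreal (cond_avg t \<sigma> f x) * indicator ?Q y \<partial>lebesgue)"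
  proof (rule nn_integral_cong)
    fix y
    show "ennreal (cond_avg t \<sigma> f y) * indicator ?Q y = ennreal (cond_avg t \<sigma> f x) * indicator ?Q y"
      using cond_avg_eq[OF st, of y x f] by (cases "y \<in> ?Q") (auto simp: indicator_def)
  qed
  also have "\<dots> = ennreal (cond_avg t \<sigma> f x) * ennreal (measure lebesgue ?Q)"
    by (simp add: nn_integral_cmult_indicator emeasure_cube_at measure_cube_at)
  also have "\<dots> = ennreal (LINT y:?Q|lebesgue. f y)"
  proof -
    have "cond_avg t \<sigma> f x * measure lebesgue ?Q = (LINT y:?Q|lebesgue. f y)"
      using measure_cube_at_pos[of t "\<sigma> x" x] by (simp add: cond_avg_def average_def field_simps)
    then show ?thesis by (simp flip: ennreal_mult'')
  qed
  also have "\<dots> = (\<integral>\<^sup>+y. ennreal (indicator ?Q y * f y) \<partial>lebesgue)"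
    using set_integrable_cube[OF f, of t "\<sigma> x" x] nonneg
    unfolding set_lebesgue_integral_def set_integrable_def
    by (subst nn_integral_eq_integral) auto
  also have "\<dots> = (\<integral>\<^sup>+y\<in>?Q. ennreal (f y) \<partial>lebesgue)"
    by (intro nn_integral_cong) (auto simp: indicator_def)
  finally show "(\<integral>\<^sup>+y\<in>?Q. ennreal (cond_avg t \<sigma> f y) \<partial>lebesgue) = (\<integral>\<^sup>+y\<in>?Q. ennreal (f y) \<partial>lebesgue)" .
qed

lemma cond_avg_integral_nonneg:
  fixes f :: "real^'n \<Rightarrow> real"
  assumes st: "stopping_gen t \<sigma>" and f: "integrable lebesgue f" and nonneg: "\<And>x. 0 \<le> f x"
  shows "integrable lebesgue (cond_avg t \<sigma> f)" "(LINT x|lebesgue. cond_avg t \<sigma> f x) = (LINT x|lebesgue. f x)"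
proof -
  have nn: "0 \<le> cond_avg t \<sigma> f x" for x
    unfolding cond_avg_def by (rule average_nonneg[OF nonneg])
  have m: "cond_avg t \<sigma> f \<in> borel_measurable lebesgue"
    by (rule cond_avg_measurable[OF st])
  have e: "(\<integral>\<^sup>+x. ennreal (cond_avg t \<sigma> f x) \<partial>lebesgue) = ennreal (LINT x|lebesgue. f x)"
    using nn_integral_cond_avg[OF st f nonneg] nn_integral_eq_integral[OF f] nonneg by simp
  show i: "integrable lebesgue (cond_avg t \<sigma> f)"
    by (rule integrableI_nonneg) (use m nn e in auto)
  show "(LINT x|lebesgue. cond_avg t \<sigma> f x) = (LINT x|lebesgue. f x)"
    using nn_integral_eq_integral[OF i] e nn nonneg by (simp add: integral_nonneg)
qed

lemma cond_avg_integral: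
  fixes f :: "real^'n \<Rightarrow> real"
  assumes st: "stopping_gen t \<sigma>" and f: "integrable lebesgue f"
  shows "integrable lebesgue (cond_avg t \<sigma> f)" "(LINT x|lebesgue. cond_avg t \<sigma> f x) = (LINT x|lebesgue. f x)"
proof -
  have i1: "integrable lebesgue (\<lambda>x. \<bar>f x\<bar>)" and i2: "integrable lebesgue (\<lambda>x. \<bar>f x\<bar> - f x)"
    using f by auto
  have eq: "cond_avg t \<sigma> f = (\<lambda>x. cond_avg t \<sigma> (\<lambda>x. \<bar>f x\<bar>) x - cond_avg t \<sigma> (\<lambda>x. \<bar>f x\<bar> - f x) x)"
    unfolding cond_avg_def using i1 i2 by (subst average_diff[symmetric]) auto
  note a = cond_avg_integral_nonneg[OF st i1] and b = cond_avg_integral_nonneg[OF st i2]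
  show "integrable lebesgue (cond_avg t \<sigma> f)"
    unfolding eq by (intro Bochner_Integration.integrable_diff a b) auto
  show "(LINT x|lebesgue. cond_avg t \<sigma> f x) = (LINT x|lebesgue. f x)"
    unfolding eq using a b f by simp
qed

lemma cond_avg_abs_le: "\<bar>cond_avg t \<sigma> f x\<bar> \<le> cond_avg t \<sigma> (\<lambda>x. \<bar>f x\<bar>) x" for f :: "real^'n \<Rightarrow> real"
  using norm_average_le[of f] unfolding cond_avg_def by simp

lemma integral_abs_cond_avg_le:
  fixes f :: "real^'n \<Rightarrow> real"
  assumes st: "stopping_gen t \<sigma>" and f: "integrable lebesgue f"
  shows "(LINT x|lebesgue. \<bar>cond_avg t \<sigma> f x\<bar>) \<le> (LINT x|lebesgue. \<bar>f x\<bar>)"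
proof -
  have "(LINT x|lebesgue. \<bar>cond_avg t \<sigma> f x\<bar>) \<le> (LINT x|lebesgue. cond_avg t \<sigma> (\<lambda>x. \<bar>f x\<bar>) x)"
    using cond_avg_integral[OF st f] cond_avg_integral[OF st, of "\<lambda>x. \<bar>f x\<bar>"] f
    by (intro integral_mono) (auto intro: cond_avg_abs_le)
  then show ?thesis
    using cond_avg_integral[OF st, of "\<lambda>x. \<bar>f x\<bar>"] f by simp
qed

text \<open>A function that is constant on the chosen cubes can be taken out of the average; this is the only form
in which the cancellation of \<open>f - cond_avg t \<sigma> f\<close> is used.\<close>

lemma integral_mult_cond_avg:
  fixes f h :: "real^'n \<Rightarrow> real"
  assumes st: "stopping_gen t \<sigma>" and f: "integrable lebesgue f" and hf: "integrable lebesgue (\<lambda>x. h x * f x)"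
    and h: "\<And>x y. y \<in> cube_at t (\<sigma> x) x \<Longrightarrow> h y = h x"
  shows "integrable lebesgue (\<lambda>x. h x * cond_avg t \<sigma> f x)"
    "(LINT x|lebesgue. h x * cond_avg t \<sigma> f x) = (LINT x|lebesgue. h x * f x)"
proof -
  have "cond_avg t \<sigma> (\<lambda>x. h x * f x) x = h x * cond_avg t \<sigma> f x" for x
    unfolding cond_avg_def
    by (subst average_cmult[symmetric], rule average_cong) (use h in presburger)
  then have eq: "(\<lambda>x. h x * cond_avg t \<sigma> f x) = cond_avg t \<sigma> (\<lambda>x. h x * f x)" by auto
  show "integrable lebesgue (\<lambda>x. h x * cond_avg t \<sigma> f x)"
    "(LINT x|lebesgue. h x * cond_avg t \<sigma> f x) = (LINT x|lebesgue. h x * f x)"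
    unfolding eq using cond_avg_integral[OF st hf] by auto
qed

lemma set_integral_abs_le:
  fixes f :: "real^'n \<Rightarrow> real"
  assumes f: "integrable lebesgue f" and Q: "Q \<in> sets lebesgue"
  shows "(LINT x:Q|lebesgue. \<bar>f x\<bar>) \<le> (LINT x|lebesgue. \<bar>f x\<bar>)"
  unfolding set_lebesgue_integral_def using f integrable_mult_indicator[OF Q, of "\<lambda>x. \<bar>f x\<bar>"]
  by (intro integral_mono) (auto simp: indicator_def)

lemma average_abs_le_norm1:
  fixes f :: "real^'n \<Rightarrow> real"
  assumes f: "integrable lebesgue f"
  shows "average (\<lambda>x. \<bar>f x\<bar>) (cube_at t j x) \<le> (LINT x|lebesgue. \<bar>f x\<bar>) * (2 powi j) ^ CARD('n)"
proof -
  have "average (\<lambda>x. \<bar>f x\<bar>) (cube_at t j x) = (LINT x:cube_at t j x|lebesgue. \<bar>f x\<bar>) * (2 powi j) ^ CARD('n)"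
    by (simp add: average_def measure_cube_at power_int_minus power_inverse)
  then show ?thesis
    using set_integral_abs_le[OF f, of "cube_at t j x"] by (simp add: mult_right_mono)
qed

lemma average_abs_small:
  fixes f :: "real^'n \<Rightarrow> real"
  assumes f: "integrable lebesgue f" and "0 < \<delta>"
  shows "\<exists>j0. \<forall>j\<le>j0. \<forall>x. average (\<lambda>x. \<bar>f x\<bar>) (cube_at t j x) < \<delta>"
proof -
  let ?A = "LINT x|lebesgue. \<bar>f x\<bar>"
  have A0: "?A \<ge> 0" by simp
  obtain n where n: "?A / \<delta> < 2 ^ n"
    using real_arch_pow[of 2 "?A / \<delta>"] by auto
  have "average (\<lambda>x. \<bar>f x\<bar>) (cube_at t j x) < \<delta>" if "j \<le> - int n" for j x
  proof -
    have le1: "(2::real) powi j \<le> 2 powi (- int n)"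
      using that by (intro power_int_increasing) auto
    have lt1: "(2::real) powi j \<le> 1" using that power_int_increasing[of j 0 "2::real"] by simp
    have "((2::real) powi j) ^ CARD('n) \<le> (2 powi j) ^ 1"
      using lt1 by (intro power_decreasing) (auto simp: Suc_le_eq)
    then have "((2::real) powi j) ^ CARD('n) \<le> 2 powi (- int n)" using le1 by simp
    then have "?A * (2 powi j) ^ CARD('n) \<le> ?A * 2 powi (- int n)"
      using A0 by (rule mult_left_mono)
    also have "\<dots> < \<delta>"
      using n \<open>0 < \<delta>\<close> by (simp add: power_int_minus field_simps)
    finally show ?thesis using average_abs_le_norm1[OF f, of t j x] by linarith
  qed
  then show ?thesis by blast
qed

lemma average_parent:
  fixes f :: "real^'n \<Rightarrow> real"
  assumes f: "integrable lebesgue f" and nonneg: "\<And>x. 0 \<le> f x"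
  shows "average f (cube_at t j x) \<le> 2 ^ CARD('n) * average f (cube_at t (j - 1) x)"
proof -
  have "(LINT y:cube_at t j x|lebesgue. f y) \<le> (LINT y:cube_at t (j - 1) x|lebesgue. f y)"
    using nonneg set_integrable_cube[OF f, of t j x] set_integrable_cube[OF f, of t "j - 1" x] cube_at_antimono[of "j-1" j t x]
    unfolding set_lebesgue_integral_def set_integrable_def
    by (intro integral_mono) (auto simp: indicator_def)
  then have "average f (cube_at t j x) \<le> (LINT y:cube_at t (j - 1) x|lebesgue. f y) / measure lebesgue (cube_at t j x)"
    by (simp add: average_def divide_inverse mult.commute mult_left_mono)
  moreover have "measure lebesgue (cube_at t (j - 1) x) = 2 ^ CARD('n) * measure lebesgue (cube_at t j x)"
  proof -
    have "(2::real) powi (- (j - 1)) = 2 * 2 powi (- j)"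
      using power_int_add[of "2::real" 1 "- j"] by simp
    then show ?thesis by (simp only: measure_cube_at power_mult_distrib)
  qed
  moreover have "measure lebesgue (cube_at t j x) > 0" by (rule measure_cube_at_pos)
  ultimately show ?thesis
    by (simp add: average_def field_simps)
qed

section \<open>Calderon-Zygmund stopping cubes and the dyadic maximal function\<close>

text \<open>The largest cube of generation at most \<open>J\<close> on which the average of \<open>h\<close> exceeds \<open>\<alpha>\<close>; points without such
a cube get the finest admissible generation \<open>J\<close>. With this default the chosen cubes still partition the
space, and since the parent of a chosen cube is never exceptional, the averages over the chosen cubes are
bounded by \<open>2\<^sup>N \<alpha>\<close> at every point.\<close>

definition cz_gen :: "real^'n \<Rightarrow> (real^'n \<Rightarrow> real) \<Rightarrow> real \<Rightarrow> int \<Rightarrow> real^'n \<Rightarrow> int" where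
  "cz_gen t h \<alpha> J x =
     (if \<exists>j\<le>J. \<alpha> < average h (cube_at t j x)
      then (THE j. \<alpha> < average h (cube_at t j x) \<and> (\<forall>i<j. average h (cube_at t i x) \<le> \<alpha>)) else J)"

lemma int_least_bounded:
  fixes P :: "int \<Rightarrow> bool"
  assumes "P j" "\<And>i. i \<le> l \<Longrightarrow> \<not> P i"
  shows "\<exists>j'\<le>j. P j' \<and> (\<forall>i<j'. \<not> P i)"
proof -
  define n where "n = (LEAST n. P (l + int n))"
  have lj: "l < j" using assms by (meson not_le)
  then have "P (l + int (nat (j - l)))" using assms(1) by simp
  then have 1: "P (l + int n)" and 2: "n \<le> nat (j - l)" unfolding n_def by (rule LeastI, rule Least_le)
  have "\<not> P i" if "i < l + int n" for i
  proof (cases "i \<le> l")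
    case False
    then have "i = l + int (nat (i - l))" "nat (i - l) < n" using that by auto
    then show ?thesis using not_less_Least[of "nat (i - l)" "\<lambda>n. P (l + int n)"] unfolding n_def by auto
  qed (use assms in auto)
  then show ?thesis using 1 2 lj by (intro exI[of _ "l + int n"]) auto
qed

context
  fixes t :: "real^'n" and f :: "real^'n \<Rightarrow> real" and \<alpha> :: real and J :: int
  assumes f: "integrable lebesgue f" and lam: "0 < \<alpha>"
begin

abbreviation (input) "mean_abs j x \<equiv> average (\<lambda>x. \<bar>f x\<bar>) (cube_at t j x)"
abbreviation (input) "cz_stop \<equiv> cz_gen t (\<lambda>x. \<bar>f x\<bar>) \<alpha> J"

lemma cz_gen_stopped:
  assumes "\<exists>j\<le>J. \<alpha> < mean_abs j x"
  shows "cz_stop x \<le> J" "\<alpha> < mean_abs (cz_stop x) x" "\<And>i. i < cz_stop x \<Longrightarrow> mean_abs i x \<le> \<alpha>"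
proof -
  obtain l where l: "\<And>i. i \<le> l \<Longrightarrow> mean_abs i x < \<alpha>" using average_abs_small[OF f lam] by metis
  obtain j0 where j0: "j0 \<le> J" "\<alpha> < mean_abs j0 x" using assms by auto
  obtain j where j: "j \<le> j0" "\<alpha> < mean_abs j x" "\<forall>i<j. mean_abs i x \<le> \<alpha>"
    using int_least_bounded[of "\<lambda>j. \<alpha> < mean_abs j x", OF j0(2), of l] l by (auto simp: not_less less_imp_le)
  have "(THE j. \<alpha> < mean_abs j x \<and> (\<forall>i<j. mean_abs i x \<le> \<alpha>)) = j"
  proof (rule the_equality)
    fix i assume i: "\<alpha> < mean_abs i x \<and> (\<forall>k<i. mean_abs k x \<le> \<alpha>)"
    show "i = j"
    proof (rule linorder_cases[of i j])
      assume "i < j" then show ?thesis using i j(3) by force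
    next
      assume "j < i" then show ?thesis using i j(2) by force
    qed
  qed (use j in blast)
  then have "cz_stop x = j"
    unfolding cz_gen_def using assms by (simp only: if_True)
  then show "cz_stop x \<le> J" "\<alpha> < mean_abs (cz_stop x) x" "\<And>i. i < cz_stop x \<Longrightarrow> mean_abs i x \<le> \<alpha>"
    using j j0 by auto
qed

lemma cz_gen_unstopped:
  assumes "\<not> (\<exists>j\<le>J. \<alpha> < mean_abs j x)"
  shows "cz_stop x = J"
  unfolding cz_gen_def using assms by (simp only: if_False)

lemma cz_gen_below: "i < cz_stop x \<Longrightarrow> mean_abs i x \<le> \<alpha>"
proof (cases "\<exists>j\<le>J. \<alpha> < mean_abs j x")
  case False
  then have "cz_stop x = J" by (rule cz_gen_unstopped)
  then show "i < cz_stop x \<Longrightarrow> mean_abs i x \<le> \<alpha>" using False less_imp_le not_le by (metis (no_types, lifting))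
qed (use cz_gen_stopped(3)[of x i] in blast)

lemma stopping_gen_cz: "stopping_gen t cz_stop"
  unfolding stopping_gen_def
proof (intro allI impI)
  fix x y assume y: "y \<in> cube_at t (cz_stop x) x"
  have eq: "mean_abs i y = mean_abs i x" if "i \<le> cz_stop x" for i
    using y cube_at_antimono[OF that, of t x] cube_at_eq[of y t i x] by auto
  show "cz_stop y = cz_stop x"
  proof (cases "\<exists>j\<le>J. \<alpha> < mean_abs j x")
    case True
    note s = cz_gen_stopped[OF True]
    have "\<alpha> < mean_abs (cz_stop x) y" unfolding eq[OF order_refl] by (rule s(2))
    then have ey: "\<exists>j\<le>J. \<alpha> < mean_abs j y" using s(1) by (intro exI[of _ "cz_stop x"] conjI)
    note sy = cz_gen_stopped[OF ey]
    have "cz_stop x \<le> cz_stop y"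
    proof (rule leI, rule notI)
      assume l: "cz_stop y < cz_stop x"
      show False using sy(2) s(3)[OF l] unfolding eq[OF less_imp_le[OF l]] by linarith
    qed
    moreover have "cz_stop y \<le> cz_stop x"
    proof (rule leI, rule notI)
      assume l: "cz_stop x < cz_stop y"
      show False using s(2) sy(3)[OF l] unfolding eq[OF order_refl] by linarith
    qed
    ultimately show ?thesis by (rule antisym[rotated])
  next
    case False
    then have J: "cz_stop x = J" by (rule cz_gen_unstopped)
    have "\<not> (\<exists>j\<le>J. \<alpha> < mean_abs j y)"
    proof
      assume "\<exists>j\<le>J. \<alpha> < mean_abs j y"
      then obtain j where "j \<le> J" "\<alpha> < mean_abs j y" by blast
      then have "\<alpha> < mean_abs j x" using eq[of j] J by (simp only:)
      then show False using False \<open>j \<le> J\<close> by blast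
    qed
    then have "cz_stop y = J" by (rule cz_gen_unstopped)
    then show ?thesis by (simp only: J)
  qed
qed

text \<open>The conditional expectation of \<open>|f|\<close> over the stopping cubes exceeds \<open>\<alpha>\<close> on this set and has the same
integral as \<open>|f|\<close>, so Markov's inequality applies.\<close>

lemma emeasure_cz_stopped:
  "emeasure lebesgue {x. \<exists>j\<le>J. \<alpha> < mean_abs j x} \<le> ennreal ((LINT x|lebesgue. \<bar>f x\<bar>) / \<alpha>)"
proof -
  have i: "integrable lebesgue (\<lambda>x. \<bar>f x\<bar>)" using f by simp
  have nn: "0 \<le> cond_avg t cz_stop (\<lambda>x. \<bar>f x\<bar>) x" for x
    unfolding cond_avg_def by (rule average_nonneg) simp
  note c = cond_avg_integral[OF stopping_gen_cz i]
  have "emeasure lebesgue {x. \<exists>j\<le>J. \<alpha> < mean_abs j x} \<le> emeasure lebesgue {x\<in>space lebesgue. \<alpha> \<le> cond_avg t cz_stop (\<lambda>x. \<bar>f x\<bar>) x}"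
  proof (rule emeasure_mono)
    show "{x. \<exists>j\<le>J. \<alpha> < mean_abs j x} \<subseteq> {x\<in>space lebesgue. \<alpha> \<le> cond_avg t cz_stop (\<lambda>x. \<bar>f x\<bar>) x}"
      unfolding cond_avg_def by (intro subsetI CollectI conjI less_imp_le) (simp, erule CollectE, erule cz_gen_stopped(2))
  qed (use c(1) in measurable)
  also have "\<dots> \<le> ennreal ((LINT x|lebesgue. cond_avg t cz_stop (\<lambda>x. \<bar>f x\<bar>) x) / \<alpha>)"
    using integral_Markov_inequality[OF c(1) AE_I2[OF nn] lam]
    by (simp only: times_divide_eq_left mult_1)
  finally show ?thesis unfolding c(2) .
qed

end

lemma sets_dyadic_exceed: "{x. \<exists>j. P j \<and> \<alpha> < average h (cube_at t j x)} \<in> sets lebesgue" for h :: "real^'n \<Rightarrow> real"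
proof -
  have "{x. \<exists>j. P j \<and> \<alpha> < average h (cube_at t j x)} = (\<Union>j\<in>{j. P j}. {x\<in>space lebesgue. \<alpha> < average h (cube_at t j x)})"
    by auto
  also have "\<dots> \<in> sets lebesgue"
  proof (rule sets.countable_UN'[OF countableI_type], safe)
    show "{x\<in>space lebesgue. \<alpha> < average h (cube_at t j x)} \<in> sets lebesgue" for j
      using average_cube_measurable[of h t j] by measurable
  qed
  finally show ?thesis .
qed

text \<open>Let the generation \<open>J\<close> of the finest cubes tend to infinity in \<open>emeasure_cz_stopped\<close>.\<close>

lemma dyadic_maximal_weak:
  fixes f :: "real^'n \<Rightarrow> real"
  assumes f: "integrable lebesgue f" and lam: "0 < \<alpha>"
  shows "emeasure lebesgue {x. \<exists>j. \<alpha> < average (\<lambda>x. \<bar>f x\<bar>) (cube_at t j x)} \<le> ennreal ((LINT x|lebesgue. \<bar>f x\<bar>) / \<alpha>)"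
proof -
  define A where "A n = {x. \<exists>j\<le>int n. \<alpha> < average (\<lambda>x. \<bar>f x\<bar>) (cube_at t j x)}" for n
  have "incseq A" unfolding A_def
  proof (rule incseq_SucI, rule subsetI)
    fix n x assume "x \<in> {x. \<exists>j\<le>int n. \<alpha> < average (\<lambda>x. \<bar>f x\<bar>) (cube_at t j x)}"
    then obtain j where "j \<le> int n" "\<alpha> < average (\<lambda>x. \<bar>f x\<bar>) (cube_at t j x)" by blast
    then show "x \<in> {x. \<exists>j\<le>int (Suc n). \<alpha> < average (\<lambda>x. \<bar>f x\<bar>) (cube_at t j x)}"
      by (intro CollectI exI[of _ j]) simp
  qed
  moreover have "range A \<subseteq> sets lebesgue" unfolding A_def by (rule image_subsetI, rule sets_dyadic_exceed)
  ultimately have "(\<lambda>n. emeasure lebesgue (A n)) \<longlonglongrightarrow> emeasure lebesgue (\<Union>n. A n)"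
    by (intro Lim_emeasure_incseq)
  moreover have "\<forall>\<^sub>F n in sequentially. emeasure lebesgue (A n) \<le> ennreal ((LINT x|lebesgue. \<bar>f x\<bar>) / \<alpha>)"
    unfolding A_def by (intro always_eventually allI emeasure_cz_stopped[OF f lam])
  ultimately have "emeasure lebesgue (\<Union>n. A n) \<le> ennreal ((LINT x|lebesgue. \<bar>f x\<bar>) / \<alpha>)"
    by (rule tendsto_upperbound) simp
  moreover have "(\<Union>n. A n) = {x. \<exists>j. \<alpha> < average (\<lambda>x. \<bar>f x\<bar>) (cube_at t j x)}"
  proof (intro set_eqI iffI)
    fix x assume "x \<in> {x. \<exists>j. \<alpha> < average (\<lambda>x. \<bar>f x\<bar>) (cube_at t j x)}"
    then obtain j where j: "\<alpha> < average (\<lambda>x. \<bar>f x\<bar>) (cube_at t j x)" by blast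
    then have "x \<in> A (nat j)" unfolding A_def by (intro CollectI exI[of _ j]) simp
    then show "x \<in> (\<Union>n. A n)" by blast
  qed (auto simp: A_def)
  ultimately show ?thesis by simp
qed

section \<open>Dyadic Lebesgue differentiation\<close>

text \<open>The exceptional sets below are defined by limits; only their covers are shown to be measurable.\<close>

lemma null_setsI_small_cover:
  assumes "\<And>e. 0 < e \<Longrightarrow> \<exists>B\<in>sets lebesgue. A \<subseteq> B \<and> emeasure lebesgue B \<le> ennreal e"
  shows "A \<in> null_sets (lebesgue :: 'a::euclidean_space measure)"
proof -
  obtain B where B: "\<And>n. B n \<in> sets lebesgue" "\<And>n. A \<subseteq> B n" "\<And>n. emeasure lebesgue (B n) \<le> ennreal (1 / Suc n)"
    using assms[of "1 / Suc _"] by (metis of_nat_0_less_iff zero_less_Suc zero_less_divide_1_iff)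
  have "emeasure lebesgue (\<Inter>n. B n) \<le> ennreal (1 / Suc n)" for n
    using emeasure_mono[of "\<Inter>n. B n" "B n" lebesgue] B order_trans by blast
  moreover have "(\<lambda>n. ennreal (1 / Suc n)) \<longlonglongrightarrow> ennreal 0"
    by (intro tendsto_ennrealI LIMSEQ_Suc lim_const_over_n)
  ultimately have "emeasure lebesgue (\<Inter>n. B n) \<le> ennreal 0"
    by (intro LIMSEQ_le_const[of "\<lambda>n. ennreal (1 / Suc n)"]) auto
  then have "(\<Inter>n. B n) \<in> null_sets lebesgue"
    using B by (auto intro!: null_setsI sets.countable_INT)
  moreover have "A \<subseteq> (\<Inter>n. B n)" using B by auto
  ultimately show ?thesis
    using completion.complete2[of A "\<Inter>n. B n"] by (metis null_sets_completionI null_sets_completion_subset)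
qed

text \<open>For the indicator of a set, squeeze the set between a closed and an open set and take a Urysohn
function.\<close>

lemma continuous_dense_L1:
  fixes f :: "'a::euclidean_space \<Rightarrow> real"
  assumes "integrable lebesgue f" "0 < \<delta>"
  shows "\<exists>s. continuous_on UNIV s \<and> integrable lebesgue s \<and> (LINT x|lebesgue. \<bar>f x - s x\<bar>) < \<delta>"
  using assms
proof (induction arbitrary: \<delta> rule: integrable_induct)
  case (base A c)
  \<comment> \<open>the factor 3 leaves room for the two error sets, and adding 1 covers the case that \<open>c\<close> is 0\<close>
  define e where "e = \<delta> / (3 * (\<bar>c\<bar> + 1))"
  have e: "e > 0" using base unfolding e_def by simp
  obtain T where T: "open T" "A \<subseteq> T" "T - A \<in> lmeasurable" "emeasure lebesgue (T - A) < ennreal e"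
    using sets_lebesgue_outer_open[OF base(1) e] by metis
  obtain S where S: "closed S" "S \<subseteq> A" "A - S \<in> lmeasurable" "emeasure lebesgue (A - S) < ennreal e"
    using sets_lebesgue_inner_closed[OF base(1) e] by metis
  obtain u :: "'a \<Rightarrow> real" where u: "continuous_on UNIV u" "\<And>x. u x \<in> closed_segment 1 0"
      "\<And>x. x \<in> S \<Longrightarrow> u x = 1" "\<And>x. x \<in> - T \<Longrightarrow> u x = 0"
    using Urysohn[of S "- T" 1 0] S T by (auto simp: closed_Compl)
  have u01: "0 \<le> u x" "u x \<le> 1" for x using u(2)[of x] by (auto simp: closed_segment_eq_real_ivl)
  have A: "A \<in> lmeasurable" using base by (auto simp: fmeasurable_def)
  have iA: "integrable lebesgue (\<lambda>x. indicat_real A x)" using A by (simp add: lmeasurable_iff_integrable)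
  have iTA: "integrable lebesgue (\<lambda>x. indicat_real (T - A) x)" using T(3) by (simp add: lmeasurable_iff_integrable)
  have iAS: "integrable lebesgue (\<lambda>x. indicat_real (A - S) x)" using S(3) by (simp add: lmeasurable_iff_integrable)
  have um: "u \<in> borel_measurable lebesgue"
    using u(1) by (intro measurable_completion) (simp add: borel_measurable_continuous_onI)
  have iu: "integrable lebesgue u"
  proof (rule Bochner_Integration.integrable_bound)
    show "integrable lebesgue (\<lambda>x. indicat_real A x + indicat_real (T - A) x)"
      using iA iTA by (rule Bochner_Integration.integrable_add)
    show "AE x in lebesgue. norm (u x) \<le> norm (indicat_real A x + indicat_real (T - A) x)"
      using u01 u(4) T(2) by (intro AE_I2) (auto simp: indicator_def)
  qed (rule um)
  have "(LINT x|lebesgue. \<bar>indicator A x *\<^sub>R c - c * u x\<bar>) \<le> (LINT x|lebesgue. \<bar>c\<bar> * (indicat_real (T - A) x + indicat_real (A - S) x))"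
  proof (rule integral_mono)
    show "integrable lebesgue (\<lambda>x. \<bar>indicator A x *\<^sub>R c - c * u x\<bar>)"
      using iA iu by auto
    show "integrable lebesgue (\<lambda>x. \<bar>c\<bar> * (indicat_real (T - A) x + indicat_real (A - S) x))"
      using iTA iAS by auto
    fix x
    have "\<bar>indicator A x *\<^sub>R c - c * u x\<bar> = \<bar>c\<bar> * \<bar>indicator A x - u x\<bar>"
      by (simp add: abs_mult[symmetric] algebra_simps)
    also have "\<dots> \<le> \<bar>c\<bar> * (indicat_real (T - A) x + indicat_real (A - S) x)"
      using u01[of x] u(3,4)[of x] T(2) S(2) by (intro mult_left_mono) (auto simp: indicator_def)
    finally show "\<bar>indicator A x *\<^sub>R c - c * u x\<bar> \<le> \<bar>c\<bar> * (indicat_real (T - A) x + indicat_real (A - S) x)" .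
  qed
  also have "\<dots> = \<bar>c\<bar> * (measure lebesgue (T - A) + measure lebesgue (A - S))"
    using iTA iAS by simp
  also have "\<dots> \<le> \<bar>c\<bar> * (e + e)"
    using T(4) S(4) e by (intro mult_left_mono add_mono) (auto simp: measure_def enn2real_leI less_imp_le)
  also have "\<dots> < \<delta>"
  proof -
    have "\<bar>c\<bar> * (e + e) \<le> (\<bar>c\<bar> + 1) * (2 * e)" using e by (simp add: algebra_simps)
    also have "\<dots> = 2 / 3 * \<delta>" unfolding e_def by (simp add: field_simps)
    finally show ?thesis using base by linarith
  qed
  finally show ?case
    using u(1) iu by (intro exI[of _ "\<lambda>x. c * u x"]) (auto intro!: continuous_intros)
next
  case (add f g)
  obtain s1 where s1: "continuous_on UNIV s1" "integrable lebesgue s1" "(LINT x|lebesgue. \<bar>f x - s1 x\<bar>) < \<delta> / 2"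
    using add.IH(1)[of "\<delta>/2"] add.prems by auto
  obtain s2 where s2: "continuous_on UNIV s2" "integrable lebesgue s2" "(LINT x|lebesgue. \<bar>g x - s2 x\<bar>) < \<delta> / 2"
    using add.IH(2)[of "\<delta>/2"] add.prems by auto
  have "(LINT x|lebesgue. \<bar>f x + g x - (s1 x + s2 x)\<bar>) \<le> (LINT x|lebesgue. \<bar>f x - s1 x\<bar> + \<bar>g x - s2 x\<bar>)"
    using add.hyps s1 s2 by (intro integral_mono) auto
  also have "\<dots> = (LINT x|lebesgue. \<bar>f x - s1 x\<bar>) + (LINT x|lebesgue. \<bar>g x - s2 x\<bar>)"
    using add.hyps s1 s2 by (intro Bochner_Integration.integral_add) auto
  finally show ?case
    using s1 s2 by (intro exI[of _ "\<lambda>x. s1 x + s2 x"]) (auto intro!: continuous_intros)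
next
  case (lim f s)
  have sm: "\<And>i. s i \<in> borel_measurable lebesgue" "f \<in> borel_measurable lebesgue" using lim.hyps by auto
  have "(\<lambda>i. LINT x|lebesgue. \<bar>f x - s i x\<bar>) \<longlonglongrightarrow> (LINT x|(lebesgue :: 'a measure). 0)"
  proof (rule integral_dominated_convergence)
    show "integrable lebesgue (\<lambda>x. 3 * \<bar>f x\<bar>)" using lim.hyps by auto
    show "(\<lambda>x. \<bar>f x - s i x\<bar>) \<in> borel_measurable lebesgue" for i using sm by measurable
    show "AE x in lebesgue. (\<lambda>i. \<bar>f x - s i x\<bar>) \<longlonglongrightarrow> 0"
    proof (intro AE_I2)
      fix x :: 'a
      have "(\<lambda>i. s i x) \<longlonglongrightarrow> f x" using lim.hyps(2)[of x] by simp
      then have "(\<lambda>i. \<bar>f x - s i x\<bar>) \<longlonglongrightarrow> \<bar>f x - f x\<bar>" by (intro tendsto_intros)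
      then show "(\<lambda>i. \<bar>f x - s i x\<bar>) \<longlonglongrightarrow> 0" by simp
    qed
    show "AE x in lebesgue. norm \<bar>f x - s i x\<bar> \<le> 3 * \<bar>f x\<bar>" for i
    proof (intro AE_I2)
      fix x :: 'a
      show "norm \<bar>f x - s i x\<bar> \<le> 3 * \<bar>f x\<bar>" using lim.hyps(3)[of x i] by auto
    qed
  qed simp
  then have "\<forall>\<^sub>F i in sequentially. (LINT x|lebesgue. \<bar>f x - s i x\<bar>) < \<delta> / 2"
    using lim.prems by (intro order_tendstoD) auto
  then obtain i where i: "(LINT x|lebesgue. \<bar>f x - s i x\<bar>) < \<delta> / 2"
    by (auto simp: eventually_sequentially)
  obtain u where u: "continuous_on UNIV u" "integrable lebesgue u" "(LINT x|lebesgue. \<bar>s i x - u x\<bar>) < \<delta> / 2"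
    using lim.IH[of "\<delta>/2" i] lim.prems by auto
  have "(LINT x|lebesgue. \<bar>f x - u x\<bar>) \<le> (LINT x|lebesgue. \<bar>f x - s i x\<bar> + \<bar>s i x - u x\<bar>)"
    using lim.hyps u by (intro integral_mono) auto
  also have "\<dots> = (LINT x|lebesgue. \<bar>f x - s i x\<bar>) + (LINT x|lebesgue. \<bar>s i x - u x\<bar>)"
    using lim.hyps u by (intro Bochner_Integration.integral_add) auto
  finally show ?case using u i by (intro exI[of _ u]) auto
qed

lemma cube_at_small:
  fixes t :: "real^'n"
  assumes "y \<in> cube_at t j x"
  shows "norm (y - x) \<le> real CARD('n) * 2 powi (- j)"
proof -
  have "\<bar>(y - x) $ i\<bar> \<le> 2 powi (- j)" for i
  proof -
    have "y \<in> dyadic_cube t j (dyadic_index t j x)" "x \<in> dyadic_cube t j (dyadic_index t j x)"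
      using assms by (auto simp: dyadic_cube_index mem_cube_at)
    then show ?thesis unfolding dyadic_cube_def by (auto simp: abs_le_iff algebra_simps) (smt (verit))+
  qed
  then have "(\<Sum>i\<in>UNIV. \<bar>(y - x) $ i\<bar>) \<le> (\<Sum>i\<in>(UNIV::'n set). 2 powi (- j))"
    by (intro sum_mono) auto
  then show ?thesis using norm_le_l1_cart[of "y - x"] by simp
qed

lemma average_continuous_tendsto:
  fixes s :: "real^'n \<Rightarrow> real"
  assumes s: "continuous_on UNIV s" "integrable lebesgue s"
  shows "((\<lambda>j. average s (cube_at t j x)) \<longlongrightarrow> s x) at_top"
proof (rule tendstoI)
  fix e :: real assume e: "e > 0"
  obtain d where d: "d > 0" "\<And>y. dist y x < d \<Longrightarrow> dist (s y) (s x) < e / 2"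
    using s(1) e unfolding continuous_on_iff by (metis UNIV_I half_gt_zero)
  obtain n where n: "real CARD('n) / d < 2 ^ n" using real_arch_pow[of 2 "real CARD('n) / d"] by auto
  have "dist (average s (cube_at t j x)) (s x) < e" if "j \<ge> int n" for j
  proof -
    have "real CARD('n) * 2 powi (- j) \<le> real CARD('n) * 2 powi (- int n)"
      using that by (intro mult_left_mono power_int_increasing) auto
    also have "\<dots> < d" using n d(1) by (simp add: power_int_minus field_simps)
    finally have le: "\<bar>s y - s x\<bar> \<le> e / 2" if "y \<in> cube_at t j x" for y
      using d(2)[of y] cube_at_small[OF that] by (auto simp: dist_norm)
    have b: "s x - e/2 \<le> s y" "s y \<le> s x + e/2" if "y \<in> cube_at t j x" for y
      using le[OF that] unfolding abs_le_iff by linarith+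
    have c: "set_integrable lebesgue (cube_at t j x) (\<lambda>_. c)" for c :: real
      using fmeasurable_cube_at[of t j x] by (simp add: set_integrable_def lmeasurable_iff_integrable)
    have "s x - e/2 \<le> average s (cube_at t j x)" "average s (cube_at t j x) \<le> s x + e/2"
      using average_mono[OF c set_integrable_cube[OF s(2)] b(1)] average_mono[OF set_integrable_cube[OF s(2)] c b(2)]
      by (auto simp: average_const)
    then show ?thesis using e by (auto simp: dist_real_def abs_less_iff)
  qed
  then show "\<forall>\<^sub>F j in at_top. dist (average s (cube_at t j x)) (s x) < e"
    by (auto simp: eventually_at_top_linorder)
qed

text \<open>The averages of a continuous function converge everywhere. Approximate \<open>f\<close> in \<open>L\<^sup>1\<close> by such a function;
the error is controlled by the dyadic maximal function.\<close>

theorem dyadic_differentiation_integrable: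
  fixes f :: "real^'n \<Rightarrow> real"
  assumes f: "integrable lebesgue f"
  shows "AE x in lebesgue. ((\<lambda>j. average f (cube_at t j x)) \<longlongrightarrow> f x) at_top"
proof -
  define Z where "Z \<delta> = {x. \<not> (\<forall>\<^sub>F j in at_top. \<bar>average f (cube_at t j x) - f x\<bar> < 3 * \<delta>)}" for \<delta>
  have Znull: "Z \<delta> \<in> null_sets lebesgue" if \<delta>: "\<delta> > 0" for \<delta>
  proof (rule null_setsI_small_cover)
    fix e :: real assume e: "e > 0"
    obtain s where s: "continuous_on UNIV s" "integrable lebesgue s" "(LINT x|lebesgue. \<bar>f x - s x\<bar>) < \<delta> * e / 2"
      using continuous_dense_L1[OF f, of "\<delta> * e / 2"] \<delta> e by auto
    let ?h = "\<lambda>x. f x - s x"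
    have h: "integrable lebesgue ?h" using f s by auto
    define B1 where "B1 = {x. \<exists>j. \<delta> < average (\<lambda>x. \<bar>?h x\<bar>) (cube_at t j x)}"
    define B2 where "B2 = {x\<in>space lebesgue. \<delta> \<le> \<bar>?h x\<bar>}"
    have "B1 \<in> sets lebesgue"
      using sets_dyadic_exceed[of "\<lambda>_. True"] unfolding B1_def by simp
    moreover have "B2 \<in> sets lebesgue"
      using borel_measurable_integrable[OF h] unfolding B2_def by measurable
    ultimately have m: "B1 \<in> sets lebesgue" "B2 \<in> sets lebesgue" .
    have "emeasure lebesgue B1 \<le> ennreal ((LINT x|lebesgue. \<bar>?h x\<bar>) / \<delta>)"
      unfolding B1_def by (rule dyadic_maximal_weak[OF h \<delta>])
    moreover have "emeasure lebesgue B2 \<le> ennreal ((LINT x|lebesgue. \<bar>?h x\<bar>) / \<delta>)"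
      unfolding B2_def using integral_Markov_inequality[of lebesgue "\<lambda>x. \<bar>?h x\<bar>" \<delta>] h \<delta> by simp
    moreover have "(LINT x|lebesgue. \<bar>?h x\<bar>) / \<delta> \<le> e / 2" using s(3) \<delta> by (simp add: field_simps)
    ultimately have "emeasure lebesgue B1 \<le> ennreal (e/2)" "emeasure lebesgue B2 \<le> ennreal (e/2)"
      by (meson ennreal_leI order_trans)+
    then have "emeasure lebesgue (B1 \<union> B2) \<le> ennreal (e/2) + ennreal (e/2)"
      using emeasure_subadditive[OF m] add_mono order_trans by blast
    also have "\<dots> = ennreal e" using e by (simp flip: ennreal_plus)
    finally have "emeasure lebesgue (B1 \<union> B2) \<le> ennreal e" .
    moreover have "Z \<delta> \<subseteq> B1 \<union> B2"
    proof
      fix x assume x: "x \<in> Z \<delta>"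
      show "x \<in> B1 \<union> B2"
      proof (rule ccontr)
        assume nx: "x \<notin> B1 \<union> B2"
        have "\<forall>\<^sub>F j in at_top. \<bar>average s (cube_at t j x) - s x\<bar> < \<delta>"
          using tendstoD[OF average_continuous_tendsto[OF s(1,2), of t x] \<delta>] by (simp add: dist_real_def)
        then have "\<forall>\<^sub>F j in at_top. \<bar>average f (cube_at t j x) - f x\<bar> < 3 * \<delta>"
        proof eventually_elim
          case (elim j)
          have "average f (cube_at t j x) - average s (cube_at t j x) = average ?h (cube_at t j x)"
            using f s by (subst average_diff) auto
          moreover have "\<bar>average ?h (cube_at t j x)\<bar> \<le> average (\<lambda>x. \<bar>?h x\<bar>) (cube_at t j x)"
            using norm_average_le[of ?h] by simp
          moreover have "average (\<lambda>x. \<bar>?h x\<bar>) (cube_at t j x) \<le> \<delta>" "\<bar>?h x\<bar> < \<delta>"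
            using nx unfolding B1_def B2_def by (auto simp: not_less not_le)
          ultimately show ?case using elim by linarith
        qed
        then show False using x unfolding Z_def by simp
      qed
    qed
    ultimately show "\<exists>B\<in>sets lebesgue. Z \<delta> \<subseteq> B \<and> emeasure lebesgue B \<le> ennreal e"
      using m by (intro bexI[of _ "B1 \<union> B2"]) auto
  qed
  have "AE x in lebesgue. \<forall>n. x \<notin> Z (1 / Suc n)"
    using Znull by (subst AE_all_countable) (auto intro: AE_not_in)
  then show ?thesis
  proof eventually_elim
    case (elim x)
    show ?case
    proof (rule tendstoI)
      fix e :: real assume "e > 0"
      then obtain n where "inverse (real (Suc n)) < e / 3" using reals_Archimedean[of "e/3"] by auto
      then have "3 * (1 / Suc n) < e" by (simp add: field_simps)
      moreover have "\<forall>\<^sub>F j in at_top. \<bar>average f (cube_at t j x) - f x\<bar> < 3 * (1 / Suc n)"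
        using elim unfolding Z_def by blast
      ultimately show "\<forall>\<^sub>F j in at_top. dist (average f (cube_at t j x)) (f x) < e"
        by (auto simp: dist_real_def elim: eventually_mono)
    qed
  qed
qed

lemma AE_cubes_cover:
  assumes "\<And>z. AE x in lebesgue. x \<in> cube_at t j z \<longrightarrow> P x"
  shows "AE x in lebesgue. P x"
proof -
  have "\<forall>m. \<exists>z. dyadic_index t j z = m" using dyadic_index_surj by blast
  then obtain z where z: "\<And>m. dyadic_index t j (z m) = m" by metis
  have "AE x in lebesgue. \<forall>m. x \<in> cube_at t j (z m) \<longrightarrow> P x"
    using assms by (subst AE_all_countable) auto
  then show ?thesis
  proof eventually_elim
    case (elim x)
    then show ?case by (metis mem_cube_at z)
  qed
qed

theorem dyadic_differentiation:
  fixes f :: "real^'n \<Rightarrow> real"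
  assumes f: "\<And>z. set_integrable lebesgue (cube_at t 0 z) f"
  shows "AE x in lebesgue. ((\<lambda>j. average f (cube_at t j x)) \<longlongrightarrow> f x) at_top"
proof (rule AE_cubes_cover[of t 0])
  fix z
  let ?g = "\<lambda>x. indicat_real (cube_at t 0 z) x *\<^sub>R f x"
  have "AE x in lebesgue. ((\<lambda>j. average ?g (cube_at t j x)) \<longlongrightarrow> ?g x) at_top"
    using f[of z] unfolding set_integrable_def by (rule dyadic_differentiation_integrable)
  then show "AE x in lebesgue. x \<in> cube_at t 0 z \<longrightarrow> ((\<lambda>j. average f (cube_at t j x)) \<longlongrightarrow> f x) at_top"
  proof eventually_elim
    case (elim x)
    show ?case
    proof
      assume x: "x \<in> cube_at t 0 z"
      have "\<forall>\<^sub>F j in at_top. average ?g (cube_at t j x) = average f (cube_at t j x)"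
        using eventually_ge_at_top[of 0]
      proof eventually_elim
        case (elim j)
        have "cube_at t j x \<subseteq> cube_at t 0 z"
          using cube_at_antimono[OF elim, of t x] cube_at_eq[OF x] by simp
        then show ?case by (intro average_cong) (auto simp: indicator_def)
      qed
      then show "((\<lambda>j. average f (cube_at t j x)) \<longlongrightarrow> f x) at_top"
        using elim x by (auto intro: Lim_transform_eventually)
    qed
  qed
qed

lemma square_integrable_set_integrable:
  assumes g: "square_integrable g" and Q: "Q \<in> lmeasurable"
  shows "set_integrable lebesgue Q g"
  unfolding set_integrable_def
proof (rule Bochner_Integration.integrable_bound)
  show "integrable lebesgue (\<lambda>x. indicat_real Q x + (g x)\<^sup>2)"
    using g Q by (auto simp: square_integrable_def lmeasurable_iff_integrable)
  show "(\<lambda>x. indicat_real Q x *\<^sub>R g x) \<in> borel_measurable lebesgue"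
    using g Q by (auto simp: square_integrable_def fmeasurable_def)
  have "\<bar>g x\<bar> \<le> 1 + (g x)\<^sup>2" for x
    using sum_squares_bound[of "1" "\<bar>g x\<bar>"] by simp
  then show "AE x in lebesgue. norm (indicat_real Q x *\<^sub>R g x) \<le> norm (indicat_real Q x + (g x)\<^sup>2)"
    by (intro AE_I2) (auto simp: indicator_def)
qed

text \<open>Expand the nonnegative average of \<open>(g - c)\<^sup>2\<close>, where \<open>c\<close> is the average of \<open>g\<close>.\<close>

lemma average_square_le:
  fixes g :: "real^'n \<Rightarrow> real"
  assumes g: "square_integrable g"
  shows "(average g (cube_at t j x))\<^sup>2 \<le> average (\<lambda>x. (g x)\<^sup>2) (cube_at t j x)"
proof -
  let ?Q = "cube_at t j x"
  let ?c = "average g ?Q"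
  have g1: "set_integrable lebesgue ?Q g" by (rule square_integrable_set_integrable[OF g]) simp
  have g2: "set_integrable lebesgue ?Q (\<lambda>x. (g x)\<^sup>2)" using g by (simp add: square_integrable_def)
  have c: "set_integrable lebesgue ?Q (\<lambda>_. c)" for c :: real
    using fmeasurable_cube_at[of t j x] by (simp add: set_integrable_def lmeasurable_iff_integrable)
  have g3: "set_integrable lebesgue ?Q (\<lambda>x. 2 * ?c * g x)" using g1 by (simp add: set_integrable_mult_right)
  have "0 \<le> average (\<lambda>x. (g x - ?c)\<^sup>2) ?Q" by (rule average_nonneg) simp
  also have "(\<lambda>x. (g x - ?c)\<^sup>2) = (\<lambda>x. ((g x)\<^sup>2 - 2 * ?c * g x) + ?c\<^sup>2)"
    by (auto simp: power2_eq_square algebra_simps)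
  also have "average \<dots> ?Q = average (\<lambda>x. (g x)\<^sup>2) ?Q - 2 * ?c * ?c + ?c\<^sup>2"
    using g1 g2 g3 c by (simp add: average_add average_diff average_cmult average_const set_integral_diff(1))
  finally show ?thesis by (simp add: power2_eq_square)
qed

section \<open>Weak type estimate for maximal truncations\<close>

text \<open>The three terms come from the stopped set, the bad part and the good part of the decomposition.\<close>

definition weak_const :: "real \<Rightarrow> nat \<Rightarrow> real" where
  "weak_const A N = 1 + 4 * A + 16 * 2 ^ N"

text \<open>\<open>gam j\<close> is the generation of the cubes of level \<open>j\<close>, and \<open>kap j x y\<close> is the kernel of the block of the
level \<open>j\<close> cube at \<open>x\<close>. The last assumption is the form in which mean zero of the blocks and the convergence
of their sum to \<open>T\<close> are used: a single block is the increment of the averages of \<open>T g\<close>.\<close>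

locale dyadic_shift =
  fixes t :: "real^'n" and gam :: "int \<Rightarrow> int"
    and kap :: "int \<Rightarrow> real^'n \<Rightarrow> real^'n \<Rightarrow> real" and A :: real and T :: "'n operator"
  assumes gam_less: "\<And>i j. i < j \<Longrightarrow> gam i < gam j"
    and A_ge_1: "1 \<le> A"
    and kap_support: "\<And>j x y. kap j x y \<noteq> 0 \<Longrightarrow> y \<in> cube_at t (gam j) x"
    and kap_const: "\<And>j x y x' y'. x' \<in> cube_at t (gam (j + 1)) x \<Longrightarrow> y' \<in> cube_at t (gam (j + 1)) y \<Longrightarrow>
        kap j x' y' = kap j x y"
    and kap_bound: "\<And>j x y. \<bar>kap j x y\<bar> \<le> A / measure lebesgue (cube_at t (gam j) x)"
    and T_square: "\<And>g. square_integrable g \<Longrightarrow> square_integrable (T g)"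
    and T_norm: "\<And>g. square_integrable g \<Longrightarrow> (LINT x|lebesgue. (T g x)\<^sup>2) \<le> (LINT x|lebesgue. (g x)\<^sup>2)"
    and T_mart: "\<And>g j x. square_integrable g \<Longrightarrow>
        average (T g) (cube_at t (gam (j + 1)) x) - average (T g) (cube_at t (gam j) x)
          = (LINT y|lebesgue. kap j x y * g y)"
begin

lemma gam_le: "i \<le> j \<Longrightarrow> gam i \<le> gam j"
  using gam_less[of i j] by (cases "i = j") auto

definition block :: "int \<Rightarrow> (real^'n \<Rightarrow> 'b::{banach, second_countable_topology}) \<Rightarrow> real^'n \<Rightarrow> 'b" where
  "block j f x = (LINT y|lebesgue. kap j x y *\<^sub>R f y)"

definition part :: "int \<Rightarrow> int \<Rightarrow> (real^'n \<Rightarrow> 'b::{banach, second_countable_topology}) \<Rightarrow> real^'n \<Rightarrow> 'b" where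
  "part m n f x = (\<Sum>j\<in>{m..<n}. block j f x)"

lemma kap_measurable: "kap j x \<in> borel_measurable lebesgue"
  by (rule cube_const_measurable[where t=t and j="gam (j + 1)"]) (rule kap_const[OF self_in_cube_at])

lemma block_integrable:
  fixes f :: "real^'n \<Rightarrow> 'b::{banach, second_countable_topology}"
  assumes f: "integrable lebesgue f"
  shows "integrable lebesgue (\<lambda>y. kap j x y *\<^sub>R f y)"
proof (rule Bochner_Integration.integrable_bound)
  show "integrable lebesgue (\<lambda>y. A / measure lebesgue (cube_at t (gam j) x) * norm (f y))"
    using f by simp
  show "(\<lambda>y. kap j x y *\<^sub>R f y) \<in> borel_measurable lebesgue"
    using kap_measurable f by (intro borel_measurable_scaleR) auto
  have "\<bar>kap j x y\<bar> * norm (f y) \<le> A / measure lebesgue (cube_at t (gam j) x) * norm (f y)" for y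
    using kap_bound by (intro mult_right_mono) auto
  then show "AE y in lebesgue. norm (kap j x y *\<^sub>R f y) \<le> norm (A / measure lebesgue (cube_at t (gam j) x) * norm (f y))"
    using A_ge_1 by (intro AE_I2) (simp add: abs_mult)
qed

lemma block_const:
  assumes "x' \<in> cube_at t (gam (j + 1)) x"
  shows "block j f x' = block j f x"
proof -
  have "kap j x' y = kap j x y" for y using assms by (rule kap_const) simp
  then show ?thesis unfolding block_def by simp
qed

lemma block_measurable: "block j f \<in> borel_measurable lebesgue"
  by (rule cube_const_measurable[where t=t and j="gam (j + 1)"]) (rule block_const)

lemma part_measurable: "part m n f \<in> borel_measurable lebesgue" for f :: "real^'n \<Rightarrow> real"
  unfolding part_def using block_measurable by (intro borel_measurable_sum) blast

lemma block_diff: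
  fixes f g :: "real^'n \<Rightarrow> 'b::{banach, second_countable_topology}"
  assumes "integrable lebesgue f" "integrable lebesgue g"
  shows "block j (\<lambda>x. f x - g x) x = block j f x - block j g x"
  using block_integrable[OF assms(1)] block_integrable[OF assms(2)]
  unfolding block_def by (simp add: scaleR_diff_right)

lemma part_diff:
  fixes f g :: "real^'n \<Rightarrow> 'b::{banach, second_countable_topology}"
  assumes "integrable lebesgue f" "integrable lebesgue g"
  shows "part m n (\<lambda>x. f x - g x) x = part m n f x - part m n g x"
  unfolding part_def by (simp add: block_diff[OF assms] sum_subtractf)

lemma block_abs_le:
  fixes f :: "real^'n \<Rightarrow> real"
  assumes f: "integrable lebesgue f"
  shows "\<bar>block j f x\<bar> \<le> A * average (\<lambda>y. \<bar>f y\<bar>) (cube_at t (gam j) x)"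
proof -
  let ?Q = "cube_at t (gam j) x"
  have "\<bar>block j f x\<bar> \<le> (LINT y|lebesgue. \<bar>kap j x y *\<^sub>R f y\<bar>)"
    unfolding block_def by (rule integral_abs_bound)
  also have "\<dots> \<le> (LINT y|lebesgue. A / measure lebesgue ?Q * (indicat_real ?Q y *\<^sub>R \<bar>f y\<bar>))"
  proof (rule integral_mono)
    show "integrable lebesgue (\<lambda>y. \<bar>kap j x y *\<^sub>R f y\<bar>)"
      using block_integrable[OF f] by simp
    show "integrable lebesgue (\<lambda>y. A / measure lebesgue ?Q * (indicat_real ?Q y *\<^sub>R \<bar>f y\<bar>))"
      using f integrable_mult_indicator[OF sets_cube_at, of "\<lambda>y. \<bar>f y\<bar>" t "gam j" x]
      by (intro integrable_mult_right) auto
    fix y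
    show "\<bar>kap j x y *\<^sub>R f y\<bar> \<le> A / measure lebesgue ?Q * (indicat_real ?Q y *\<^sub>R \<bar>f y\<bar>)"
    proof (cases "kap j x y = 0")
      case True
      then show ?thesis using A_ge_1 by simp
    next
      case False
      then have "y \<in> ?Q" by (rule kap_support)
      then show ?thesis using mult_right_mono[OF kap_bound[of j x y], of "\<bar>f y\<bar>"] by (simp add: abs_mult)
    qed
  qed
  also have "\<dots> = A * average (\<lambda>y. \<bar>f y\<bar>) ?Q"
    by (simp add: average_def set_lebesgue_integral_def divide_inverse)
  finally show ?thesis .
qed

lemma part_telescope:
  assumes "square_integrable g" "m \<le> n"
  shows "part m n g x = average (T g) (cube_at t (gam n) x) - average (T g) (cube_at t (gam m) x)"
  using assms(2)
proof (induction n rule: int_ge_induct)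
  case base
  then show ?case by (simp add: part_def)
next
  case (step i)
  have "{m..<i+1} = insert i {m..<i}" using step.hyps by auto
  then have "part m (i + 1) g x = block i g x + part m i g x" by (simp add: part_def)
  then show ?case using step.IH T_mart[OF assms(1), of i x] by (simp add: block_def)
qed

lemma sets_part_exceed: "{x. \<exists>m n. P m n \<and> \<alpha> < \<bar>part m n f x\<bar>} \<in> sets lebesgue" for f :: "real^'n \<Rightarrow> real"
proof -
  have "{x. \<exists>m n. P m n \<and> \<alpha> < \<bar>part m n f x\<bar>} = (\<Union>(m,n)\<in>{(m,n). P m n}. {x\<in>space lebesgue. \<alpha> < \<bar>part m n f x\<bar>})"
    by auto
  also have "\<dots> \<in> sets lebesgue"
  proof (rule sets.countable_UN'[OF countableI_type], safe)
    show "{x\<in>space lebesgue. \<alpha> < \<bar>part m n f x\<bar>} \<in> sets lebesgue" for m n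
      using part_measurable[of m n f] by measurable
  qed
  finally show ?thesis .
qed

text \<open>Split the integral over \<open>y\<close> by the generation of the stopping cube at \<open>y\<close>. Where it is at least
\<open>gam (j + 1)\<close>, the kernel is constant on the stopping cube and the mean zero of \<open>b\<close> applies. Where it is at
most \<open>gam j\<close>, a nonzero kernel would put \<open>x\<close> into the same stopping cube, against the assumption on \<open>x\<close>.
Only the set \<open>V\<close> of the generations strictly between two levels remains, and the sets \<open>V\<close> of different
levels are disjoint.\<close>

lemma bad_part_block_le:
  fixes f :: "real^'n \<Rightarrow> real"
  assumes f: "integrable lebesgue f" and st: "stopping_gen t \<sigma>" and x: "gam j < \<sigma> x"
  defines "b \<equiv> \<lambda>y. f y - cond_avg t \<sigma> f y"
  defines "V \<equiv> {y. gam j < \<sigma> y \<and> \<sigma> y < gam (j + 1)}"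
  shows "\<bar>block j b x\<bar> \<le> A * average (\<lambda>y. \<bar>indicator V y * b y\<bar>) (cube_at t (gam j) x)"
proof -
  define Z where "Z = {y. gam (j + 1) \<le> \<sigma> y}"
  have [measurable]: "\<sigma> \<in> lebesgue \<rightarrow>\<^sub>M count_space UNIV" by (rule measurable_stopping_gen[OF st])
  have "V = {y\<in>space lebesgue. gam j < \<sigma> y \<and> \<sigma> y < gam (j + 1)}" unfolding V_def by simp
  also have "\<dots> \<in> sets lebesgue" by measurable
  finally have V: "V \<in> sets lebesgue" .
  have "Z = {y\<in>space lebesgue. gam (j + 1) \<le> \<sigma> y}" unfolding Z_def by simp
  also have "\<dots> \<in> sets lebesgue" by measurable
  finally have Z: "Z \<in> sets lebesgue" .
  note g = cond_avg_integral[OF st f]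
  have b: "integrable lebesgue b" unfolding b_def using f g(1) by simp
  have vb: "integrable lebesgue (\<lambda>y. indicator V y * b y)"
    using integrable_mult_indicator[OF V b] by simp
  define h where "h y = indicator Z y * kap j x y" for y
  have hf: "integrable lebesgue (\<lambda>y. h y * f y)"
    using integrable_mult_indicator[OF Z block_integrable[OF f, of j x]] unfolding h_def by (simp add: mult.assoc)
  have hconst: "h z = h y" if z: "z \<in> cube_at t (\<sigma> y) y" for y z
  proof (cases "y \<in> Z")
    case True
    have "\<sigma> z = \<sigma> y" using st z unfolding stopping_gen_def by blast
    moreover have "z \<in> cube_at t (gam (j + 1)) y"
      using True z cube_at_antimono[of "gam (j + 1)" "\<sigma> y" t y] unfolding Z_def by blast
    then have "kap j x z = kap j x y" by (intro kap_const) simp_all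
    ultimately show ?thesis unfolding h_def Z_def indicator_def by simp
  next
    case False
    have "\<sigma> z = \<sigma> y" using st z unfolding stopping_gen_def by blast
    then show ?thesis using False unfolding h_def Z_def indicator_def by simp
  qed
  note hg = integral_mult_cond_avg[OF st f hf hconst]
  have "(LINT y|lebesgue. h y * b y) = (LINT y|lebesgue. h y * f y - h y * cond_avg t \<sigma> f y)"
    unfolding b_def by (simp add: right_diff_distrib)
  also have "\<dots> = 0" using hf hg by simp
  finally have h0: "(LINT y|lebesgue. h y * b y) = 0" .
  have hb: "integrable lebesgue (\<lambda>y. h y * b y)"
    unfolding b_def using hf hg(1) by (simp add: right_diff_distrib)
  have "kap j x y * b y = h y * b y + kap j x y * (indicator V y * b y)" for y
  proof (cases "\<sigma> y \<le> gam j")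
    case True
    have "kap j x y = 0"
    proof (rule ccontr)
      assume "kap j x y \<noteq> 0"
      then have "y \<in> cube_at t (gam j) x" by (rule kap_support)
      then have "x \<in> cube_at t (gam j) y" by (simp add: mem_cube_at)
      then have "x \<in> cube_at t (\<sigma> y) y" using cube_at_antimono[OF True, of t y] by blast
      then have "\<sigma> x = \<sigma> y" using st unfolding stopping_gen_def by blast
      then show False using x True by simp
    qed
    then show ?thesis by (simp add: h_def)
  next
    case False
    then have "y \<in> V \<and> y \<notin> Z \<or> y \<in> Z \<and> y \<notin> V" unfolding V_def Z_def by auto
    then show ?thesis by (auto simp: h_def)
  qed
  then have "block j b x = (LINT y|lebesgue. h y * b y + kap j x y * (indicator V y * b y))"
    unfolding block_def by simp
  also have "\<dots> = block j (\<lambda>y. indicator V y * b y) x"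
    using hb block_integrable[OF vb, of j x] h0 unfolding block_def by simp
  finally show ?thesis using block_abs_le[OF vb, of j x] by simp
qed

text \<open>Calderon-Zygmund decomposition at height \<open>\<alpha>\<close> with stopping cubes of generation at most \<open>gam n0\<close>, which
suffices because the partial sums in the window see no finer scale. No constant depends on the window or on
the distance between consecutive levels.\<close>

lemma weak_type_window:
  fixes f :: "real^'n \<Rightarrow> real"
  assumes f: "integrable lebesgue f" and lam: "0 < \<alpha>"
  shows "emeasure lebesgue {x. \<exists>m n. (m0 \<le> m \<and> m \<le> n \<and> n \<le> n0) \<and> \<alpha> < \<bar>part m n f x\<bar>}
    \<le> ennreal (weak_const A CARD('n) * (LINT x|lebesgue. \<bar>f x\<bar>) / \<alpha>)"
proof -
  let ?F = "LINT x|lebesgue. \<bar>f x\<bar>"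
  let ?N = "(2::real) ^ CARD('n)"
  have F0: "0 \<le> ?F" by simp
  define J where "J = gam n0"
  define \<sigma> where "\<sigma> = cz_gen t (\<lambda>x. \<bar>f x\<bar>) \<alpha> J"
  have st: "stopping_gen t \<sigma>" unfolding \<sigma>_def by (rule stopping_gen_cz[OF f lam])
  define g where "g = cond_avg t \<sigma> f"
  define b where "b y = f y - g y" for y
  note gi = cond_avg_integral[OF st f, folded g_def]
  have bi: "integrable lebesgue b" unfolding b_def using f gi by simp
  have g1: "(LINT x|lebesgue. \<bar>g x\<bar>) \<le> ?F"
    unfolding g_def by (rule integral_abs_cond_avg_le[OF st f])
  have b1: "(LINT x|lebesgue. \<bar>b x\<bar>) \<le> 2 * ?F"
  proof -
    have "(LINT x|lebesgue. \<bar>b x\<bar>) \<le> (LINT x|lebesgue. \<bar>f x\<bar> + \<bar>g x\<bar>)"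
      unfolding b_def using f gi by (intro integral_mono) auto
    also have "\<dots> = ?F + (LINT x|lebesgue. \<bar>g x\<bar>)" using f gi by (intro Bochner_Integration.integral_add) auto
    finally show ?thesis using g1 by simp
  qed
  have gb: "\<bar>g x\<bar> \<le> ?N * \<alpha>" for x
  proof -
    have "\<bar>g x\<bar> \<le> average (\<lambda>x. \<bar>f x\<bar>) (cube_at t (\<sigma> x) x)"
      using cond_avg_abs_le[of t \<sigma> f x] unfolding g_def cond_avg_def .
    also have "\<dots> \<le> ?N * average (\<lambda>x. \<bar>f x\<bar>) (cube_at t (\<sigma> x - 1) x)"
      using f by (intro average_parent) auto
    also have "\<dots> \<le> ?N * \<alpha>"
      using cz_gen_below[OF f lam, of "\<sigma> x - 1" t J x] unfolding \<sigma>_def by (intro mult_left_mono) auto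
    finally show ?thesis .
  qed
  have gsq: "(g x)\<^sup>2 \<le> ?N * \<alpha> * \<bar>g x\<bar>" for x
    using mult_right_mono[OF gb[of x], of "\<bar>g x\<bar>"] by (simp add: power2_eq_square flip: abs_mult)
  have g2i: "integrable lebesgue (\<lambda>x. (g x)\<^sup>2)"
  proof (rule Bochner_Integration.integrable_bound)
    show "integrable lebesgue (\<lambda>x. ?N * \<alpha> * \<bar>g x\<bar>)" using gi by simp
    show "(\<lambda>x. (g x)\<^sup>2) \<in> borel_measurable lebesgue"
      using borel_measurable_integrable[OF gi(1)] by (rule borel_measurable_power)
    show "AE x in lebesgue. norm ((g x)\<^sup>2) \<le> norm (?N * \<alpha> * \<bar>g x\<bar>)"
      using gsq lam by (intro AE_I2) (simp add: abs_mult)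
  qed
  have gs: "square_integrable g"
    unfolding square_integrable_def using g2i borel_measurable_integrable[OF gi(1)] by simp
  have g2: "(LINT x|lebesgue. (g x)\<^sup>2) \<le> ?N * \<alpha> * ?F"
  proof -
    have "(LINT x|lebesgue. (g x)\<^sup>2) \<le> (LINT x|lebesgue. ?N * \<alpha> * \<bar>g x\<bar>)"
      using g2i gi gsq by (intro integral_mono) auto
    also have "\<dots> = ?N * \<alpha> * (LINT x|lebesgue. \<bar>g x\<bar>)" by simp
    also have "\<dots> \<le> ?N * \<alpha> * ?F" using g1 lam by (intro mult_left_mono) auto
    finally show ?thesis .
  qed
  define Om where "Om = {x. \<exists>j\<le>J. \<alpha> < average (\<lambda>x. \<bar>f x\<bar>) (cube_at t j x)}"
  have Om: "emeasure lebesgue Om \<le> ennreal (?F / \<alpha>)" "Om \<in> sets lebesgue"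
    unfolding Om_def by (rule emeasure_cz_stopped[OF f lam], rule sets_dyadic_exceed)
  \<comment> \<open>a stopping cube strictly between two levels lies between exactly one pair, so these sets are disjoint\<close>
  define V where "V j = {y. gam j < \<sigma> y \<and> \<sigma> y < gam (j + 1)}" for j
  have [measurable]: "\<sigma> \<in> lebesgue \<rightarrow>\<^sub>M count_space UNIV" by (rule measurable_stopping_gen[OF st])
  have Vm: "V j \<in> sets lebesgue" for j
  proof -
    have "V j = {y\<in>space lebesgue. gam j < \<sigma> y \<and> \<sigma> y < gam (j + 1)}" unfolding V_def by simp
    also have "\<dots> \<in> sets lebesgue" by measurable
    finally show ?thesis .
  qed
  have Vb: "integrable lebesgue (\<lambda>y. \<bar>indicator (V j) y * b y\<bar>)" for j
    using integrable_mult_indicator[OF Vm bi, of j] by simp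
  have Vdisj: "(\<Sum>j\<in>{m0..<n0}. \<bar>indicator (V j) y * b y\<bar>) \<le> \<bar>b y\<bar>" for y
  proof (cases "\<exists>j\<in>{m0..<n0}. y \<in> V j")
    case True
    then obtain j where j: "j \<in> {m0..<n0}" "y \<in> V j" by auto
    have "y \<notin> V i" if "i \<noteq> j" for i
      using that j(2) gam_le[of "i + 1" j] gam_le[of "j + 1" i] unfolding V_def by (cases "i < j") auto
    then have "(\<Sum>i\<in>{m0..<n0}. \<bar>indicator (V i) y * b y\<bar>) = (\<Sum>i\<in>{j}. \<bar>indicator (V i) y * b y\<bar>)"
      using j by (intro sum.mono_neutral_right) auto
    then show ?thesis using j by simp
  next
    case False
    then have "(\<Sum>j\<in>{m0..<n0}. \<bar>indicator (V j) y * b y\<bar>) = 0" by (intro sum.neutral) auto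
    then show ?thesis by simp
  qed
  define B where "B x = (\<Sum>j\<in>{m0..<n0}. A * cond_avg t (\<lambda>_. gam j) (\<lambda>y. \<bar>indicator (V j) y * b y\<bar>) x)" for x
  have Bi: "integrable lebesgue B"
    unfolding B_def using cond_avg_integral(1)[OF stopping_gen_const Vb]
    by (intro Bochner_Integration.integrable_sum integrable_mult_right) auto
  have B0: "0 \<le> B x" for x
    unfolding B_def cond_avg_def using A_ge_1 by (intro sum_nonneg mult_nonneg_nonneg average_nonneg) auto
  have "(LINT x|lebesgue. B x) = (\<Sum>j\<in>{m0..<n0}. A * (LINT y|lebesgue. \<bar>indicator (V j) y * b y\<bar>))"
    unfolding B_def using cond_avg_integral[OF stopping_gen_const Vb]
    by (subst Bochner_Integration.integral_sum) auto
  also have "\<dots> = A * (LINT y|lebesgue. (\<Sum>j\<in>{m0..<n0}. \<bar>indicator (V j) y * b y\<bar>))"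
    using Vb by (subst Bochner_Integration.integral_sum) (auto simp: sum_distrib_left)
  also have "\<dots> \<le> A * (LINT y|lebesgue. \<bar>b y\<bar>)"
    using Vb bi Vdisj A_ge_1 by (intro mult_left_mono integral_mono Bochner_Integration.integrable_sum) auto
  also have "\<dots> \<le> A * (2 * ?F)" using b1 A_ge_1 by (intro mult_left_mono) auto
  finally have B1: "(LINT x|lebesgue. B x) \<le> A * (2 * ?F)" .
  define Bs where "Bs = {x\<in>space lebesgue. \<alpha> / 2 \<le> B x}"
  have Bs: "Bs \<in> sets lebesgue" unfolding Bs_def using borel_measurable_integrable[OF Bi] by measurable
  have "emeasure lebesgue Bs \<le> ennreal (1 / (\<alpha> / 2) * (LINT x|lebesgue. B x))"
    unfolding Bs_def using integral_Markov_inequality[OF Bi AE_I2[OF B0], of "\<alpha> / 2"] lam by simp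
  also have "\<dots> \<le> ennreal (4 * A * ?F / \<alpha>)"
    using B1 lam by (intro ennreal_leI) (simp add: field_simps)
  finally have Bs1: "emeasure lebesgue Bs \<le> ennreal (4 * A * ?F / \<alpha>)" .
  define h where "h x = (T g x)\<^sup>2" for x
  have h: "integrable lebesgue h" using T_square[OF gs] unfolding h_def square_integrable_def by simp
  \<comment> \<open>outside this set all averages of \<open>T g\<close> are at most \<open>\<alpha> / 4\<close>, so their differences are at most \<open>\<alpha> / 2\<close>\<close>
  define G where "G = {x. \<exists>j. \<alpha>\<^sup>2 / 16 < average (\<lambda>x. \<bar>h x\<bar>) (cube_at t j x)}"
  have Gm: "G \<in> sets lebesgue" 
    unfolding G_def using sets_dyadic_exceed[of "\<lambda>_. True" "\<alpha>\<^sup>2 / 16" "\<lambda>x. \<bar>h x\<bar>" t] by (simp only: simp_thms)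
  have "emeasure lebesgue G \<le> ennreal ((LINT x|lebesgue. \<bar>h x\<bar>) / (\<alpha>\<^sup>2 / 16))"
    unfolding G_def using lam by (intro dyadic_maximal_weak[OF h]) simp
  also have "\<dots> \<le> ennreal (16 * ?N * ?F / \<alpha>)"
  proof (rule ennreal_leI)
    have "(LINT x|lebesgue. \<bar>h x\<bar>) \<le> ?N * \<alpha> * ?F" using T_norm[OF gs] g2 unfolding h_def by simp
    then have "(LINT x|lebesgue. \<bar>h x\<bar>) / (\<alpha>\<^sup>2 / 16) \<le> (?N * \<alpha> * ?F) / (\<alpha>\<^sup>2 / 16)"
      by (rule divide_right_mono) simp
    also have "\<dots> = 16 * ?N * ?F / \<alpha>" using lam by (simp add: power2_eq_square)
    finally show "(LINT x|lebesgue. \<bar>h x\<bar>) / (\<alpha>\<^sup>2 / 16) \<le> 16 * ?N * ?F / \<alpha>" .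
  qed
  finally have G1: "emeasure lebesgue G \<le> ennreal (16 * ?N * ?F / \<alpha>)" .
  have sub: "{x. \<exists>m n. (m0 \<le> m \<and> m \<le> n \<and> n \<le> n0) \<and> \<alpha> < \<bar>part m n f x\<bar>} \<subseteq> Om \<union> Bs \<union> G"
  proof (rule subsetI, rule ccontr)
    fix x assume "x \<in> {x. \<exists>m n. (m0 \<le> m \<and> m \<le> n \<and> n \<le> n0) \<and> \<alpha> < \<bar>part m n f x\<bar>}" and nx: "x \<notin> Om \<union> Bs \<union> G"
    then obtain m n where mn: "m0 \<le> m" "m \<le> n" "n \<le> n0" "\<alpha> < \<bar>part m n f x\<bar>" by blast
    have "\<sigma> x = J"
      unfolding \<sigma>_def by (rule cz_gen_unstopped[OF f lam]) (use nx in \<open>auto simp: Om_def\<close>)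
    then have sx: "gam j < \<sigma> x" if "j < n0" for j using gam_less[OF that] unfolding J_def by simp
    have bj: "\<bar>block j b x\<bar> \<le> A * cond_avg t (\<lambda>_. gam j) (\<lambda>y. \<bar>indicator (V j) y * b y\<bar>) x" if "j < n0" for j
      using bad_part_block_le[OF f st sx[OF that]] unfolding cond_avg_def b_def g_def V_def by simp
    have "\<bar>part m n b x\<bar> \<le> (\<Sum>j\<in>{m..<n}. \<bar>block j b x\<bar>)"
      unfolding part_def by (rule sum_abs)
    also have "\<dots> \<le> (\<Sum>j\<in>{m..<n}. A * cond_avg t (\<lambda>_. gam j) (\<lambda>y. \<bar>indicator (V j) y * b y\<bar>) x)"
      using bj mn by (intro sum_mono) auto
    also have "\<dots> \<le> B x"
      unfolding B_def cond_avg_def using mn A_ge_1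
      by (intro sum_mono2 mult_nonneg_nonneg average_nonneg) auto
    also have "\<dots> < \<alpha> / 2" using nx unfolding Bs_def by auto
    finally have pb: "\<bar>part m n b x\<bar> < \<alpha> / 2" .
    have av: "\<bar>average (T g) (cube_at t j x)\<bar> \<le> \<alpha> / 4" for j
    proof -
      have "(average (T g) (cube_at t j x))\<^sup>2 \<le> average (\<lambda>x. \<bar>h x\<bar>) (cube_at t j x)"
        using average_square_le[OF T_square[OF gs], of t j x] unfolding h_def by simp
      also have "\<dots> \<le> \<alpha>\<^sup>2 / 16" using nx unfolding G_def by (auto simp: not_less)
      also have "\<dots> = (\<alpha> / 4)\<^sup>2" by (simp add: power2_eq_square)
      finally have "\<bar>average (T g) (cube_at t j x)\<bar> \<le> \<bar>\<alpha> / 4\<bar>" by (simp only: abs_le_square_iff)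
      then show ?thesis using lam by simp
    qed
    have pg: "\<bar>part m n g x\<bar> \<le> \<alpha> / 2"
      using part_telescope[OF gs mn(2), of x] av[of "gam n"] av[of "gam m"] by linarith
    have "part m n b x = part m n f x - part m n g x"
      unfolding b_def by (rule part_diff[OF f gi(1)])
    then show False using mn(4) pb pg by linarith
  qed
  have "emeasure lebesgue {x. \<exists>m n. (m0 \<le> m \<and> m \<le> n \<and> n \<le> n0) \<and> \<alpha> < \<bar>part m n f x\<bar>} \<le> emeasure lebesgue (Om \<union> Bs \<union> G)"
    using sub Om Bs Gm by (intro emeasure_mono) auto
  also have "\<dots> \<le> emeasure lebesgue (Om \<union> Bs) + emeasure lebesgue G"
    using Om Bs Gm by (intro emeasure_subadditive) auto
  also have "\<dots> \<le> (emeasure lebesgue Om + emeasure lebesgue Bs) + emeasure lebesgue G"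
    using Om Bs Gm by (intro add_right_mono emeasure_subadditive) auto
  also have "\<dots> \<le> (ennreal (?F / \<alpha>) + ennreal (4 * A * ?F / \<alpha>)) + ennreal (16 * ?N * ?F / \<alpha>)"
    using Om Bs1 G1 by (intro add_mono) auto
  also have "\<dots> = ennreal (?F / \<alpha> + 4 * A * ?F / \<alpha> + 16 * ?N * ?F / \<alpha>)"
    using F0 lam A_ge_1 by (simp add: ennreal_plus)
  also have "?F / \<alpha> + 4 * A * ?F / \<alpha> + 16 * ?N * ?F / \<alpha> = weak_const A CARD('n) * ?F / \<alpha>"
    by (simp add: weak_const_def add_divide_distrib algebra_simps)
  finally show ?thesis .
qed

theorem weak_type:
  fixes f :: "real^'n \<Rightarrow> real"
  assumes f: "integrable lebesgue f" and lam: "0 < \<alpha>"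
  shows "emeasure lebesgue {x. \<exists>m n. m \<le> n \<and> \<alpha> < \<bar>part m n f x\<bar>}
    \<le> ennreal (weak_const A CARD('n) * (LINT x|lebesgue. \<bar>f x\<bar>) / \<alpha>)"
proof -
  define W where "W k = {x. \<exists>m n. (- int k \<le> m \<and> m \<le> n \<and> n \<le> int k) \<and> \<alpha> < \<bar>part m n f x\<bar>}" for k :: nat
  have "incseq W"
  proof (rule incseq_SucI, rule subsetI)
    fix k x assume "x \<in> W k"
    then obtain m n where "- int k \<le> m" "m \<le> n" "n \<le> int k" "\<alpha> < \<bar>part m n f x\<bar>" unfolding W_def by blast
    then show "x \<in> W (Suc k)" unfolding W_def by (intro CollectI exI[of _ m] exI[of _ n]) auto
  qed
  moreover have "range W \<subseteq> sets lebesgue" unfolding W_def by (rule image_subsetI, rule sets_part_exceed)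
  ultimately have "(\<lambda>k. emeasure lebesgue (W k)) \<longlonglongrightarrow> emeasure lebesgue (\<Union>k. W k)"
    by (rule Lim_emeasure_incseq[rotated])
  moreover have "\<forall>\<^sub>F k in sequentially. emeasure lebesgue (W k) \<le> ennreal (weak_const A CARD('n) * (LINT x|lebesgue. \<bar>f x\<bar>) / \<alpha>)"
    unfolding W_def by (intro always_eventually allI weak_type_window[OF f lam])
  ultimately have "emeasure lebesgue (\<Union>k. W k) \<le> ennreal (weak_const A CARD('n) * (LINT x|lebesgue. \<bar>f x\<bar>) / \<alpha>)"
    by (rule tendsto_upperbound) simp
  moreover have "{x. \<exists>m n. m \<le> n \<and> \<alpha> < \<bar>part m n f x\<bar>} = (\<Union>k. W k)"
  proof (intro set_eqI iffI)
    fix x assume "x \<in> {x. \<exists>m n. m \<le> n \<and> \<alpha> < \<bar>part m n f x\<bar>}"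
    then obtain m n where "m \<le> n" "\<alpha> < \<bar>part m n f x\<bar>" by blast
    then have "x \<in> W (nat (\<bar>m\<bar> + \<bar>n\<bar>))" unfolding W_def by (intro CollectI exI[of _ m] exI[of _ n]) auto
    then show "x \<in> (\<Union>k. W k)" by blast
  qed (auto simp: W_def)
  ultimately show ?thesis by simp
qed

end

section \<open>Almost everywhere convergence and the extension to integrable functions\<close>

lemma square_integrable_dense_L1:
  fixes f :: "real^'n \<Rightarrow> real"
  assumes f: "integrable lebesgue f"
  shows "\<exists>F. (\<forall>n. integrable lebesgue (F n) \<and> square_integrable (F n)) \<and>
    (\<lambda>n::nat. LINT x|lebesgue. \<bar>F n x - f x\<bar>) \<longlonglongrightarrow> 0"
proof -
  define S where "S n = {x\<in>space lebesgue. \<bar>f x\<bar> \<le> real n}" for n :: nat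
  define F where "F n x = indicat_real (S n) x * f x" for n x
  have fm: "f \<in> borel_measurable lebesgue" using f by simp
  have S: "S n \<in> sets lebesgue" for n unfolding S_def using fm by measurable
  have Fi: "integrable lebesgue (F n)" for n
    using integrable_mult_indicator[OF S f, of n] unfolding F_def by simp
  have Fs: "square_integrable (F n)" for n
    unfolding square_integrable_def
  proof
    show m: "F n \<in> borel_measurable lebesgue" using Fi by simp
    show "integrable lebesgue (\<lambda>x. (F n x)\<^sup>2)"
    proof (rule Bochner_Integration.integrable_bound)
      show "integrable lebesgue (\<lambda>x. real n * \<bar>f x\<bar>)" using f by simp
      show "(\<lambda>x. (F n x)\<^sup>2) \<in> borel_measurable lebesgue" using m by (rule borel_measurable_power)
      have "(F n x)\<^sup>2 \<le> real n * \<bar>f x\<bar>" for x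
      proof (cases "x \<in> S n")
        case True
        then have "\<bar>f x\<bar> * \<bar>f x\<bar> \<le> real n * \<bar>f x\<bar>" unfolding S_def by (intro mult_right_mono) auto
        then show ?thesis using True by (simp add: F_def power2_eq_square)
      qed (simp add: F_def)
      then show "AE x in lebesgue. norm ((F n x)\<^sup>2) \<le> norm (real n * \<bar>f x\<bar>)"
        by (intro AE_I2) simp
    qed
  qed
  have "(\<lambda>n. LINT x|lebesgue. \<bar>F n x - f x\<bar>) \<longlonglongrightarrow> (LINT x|(lebesgue :: (real^'n) measure). 0)"
  proof (rule integral_dominated_convergence)
    show "integrable lebesgue (\<lambda>x. \<bar>f x\<bar>)" using f by simp
    show "(\<lambda>x. \<bar>F n x - f x\<bar>) \<in> borel_measurable lebesgue" for n using Fi[of n] f by auto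
    show "AE x in lebesgue. (\<lambda>n. \<bar>F n x - f x\<bar>) \<longlonglongrightarrow> 0"
    proof (intro AE_I2 tendsto_eventually)
      fix x
      obtain k where k: "\<bar>f x\<bar> \<le> real k" using real_arch_simple by blast
      show "\<forall>\<^sub>F n in sequentially. \<bar>F n x - f x\<bar> = 0"
        using eventually_ge_at_top[of k]
      proof eventually_elim
        case (elim n)
        then have "x \<in> S n" using k unfolding S_def by simp
        then show ?case by (simp add: F_def)
      qed
    qed
    show "AE x in lebesgue. norm \<bar>F n x - f x\<bar> \<le> \<bar>f x\<bar>" for n
      by (intro AE_I2) (auto simp: F_def indicator_def)
  qed simp
  then show ?thesis using Fi Fs by auto
qed

context dyadic_shift
begin

abbreviation "sym_part n f x \<equiv> part (- int n) (int n) f x"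

lemma gam_ge_shift: "0 \<le> j \<Longrightarrow> gam 0 + j \<le> gam j"
proof (induction j rule: int_ge_induct)
  case (step i)
  then show ?case using gam_less[of i "i + 1"] by simp
qed simp

lemma gam_le_shift: "j \<le> 0 \<Longrightarrow> gam j \<le> gam 0 + j"
proof (induction j rule: int_le_induct)
  case (step i)
  then show ?case using gam_less[of "i - 1" i] by simp
qed simp

lemma filterlim_gam_top: "filterlim (\<lambda>n. gam (int n)) at_top sequentially"
  unfolding filterlim_at_top
proof
  fix Z
  show "\<forall>\<^sub>F n in sequentially. Z \<le> gam (int n)"
    using eventually_ge_at_top[of "nat (Z - gam 0)"]
  proof eventually_elim
    case (elim n)
    then show ?case using gam_ge_shift[of "int n"] by linarith
  qed
qed

text \<open>The partial sum is a difference of averages of \<open>T g\<close>: those over small cubes converge to \<open>T g\<close>, and those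
over large cubes tend to 0 because \<open>T g\<close> is square integrable.\<close>

lemma sym_part_tendsto_square:
  assumes g: "square_integrable g"
  shows "AE x in lebesgue. (\<lambda>n. sym_part n g x) \<longlonglongrightarrow> T g x"
proof -
  have s: "set_integrable lebesgue (cube_at t 0 z) (T g)" for z
    by (rule square_integrable_set_integrable[OF T_square[OF g]]) simp
  have h: "integrable lebesgue (\<lambda>x. (T g x)\<^sup>2)" using T_square[OF g] by (simp add: square_integrable_def)
  show ?thesis using dyadic_differentiation[OF s]
  proof eventually_elim
    case (elim x)
    have 1: "(\<lambda>n. average (T g) (cube_at t (gam (int n)) x)) \<longlonglongrightarrow> T g x"
      using elim filterlim_gam_top by (rule filterlim_compose)
    have 2: "(\<lambda>n. average (T g) (cube_at t (gam (- int n)) x)) \<longlonglongrightarrow> 0"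
    proof (rule tendstoI)
      fix e :: real assume e: "e > 0"
      then obtain j0 where j0: "\<And>j x. j \<le> j0 \<Longrightarrow> average (\<lambda>x. \<bar>(T g x)\<^sup>2\<bar>) (cube_at t j x) < e\<^sup>2"
        using average_abs_small[OF h, of "e\<^sup>2" t] by auto
      show "\<forall>\<^sub>F n in sequentially. dist (average (T g) (cube_at t (gam (- int n)) x)) 0 < e"
        using eventually_ge_at_top[of "nat (gam 0 - j0)"]
      proof eventually_elim
        case (elim n)
        then have "gam (- int n) \<le> j0" using gam_le_shift[of "- int n"] by linarith
        from j0[OF this, of x] have "(average (T g) (cube_at t (gam (- int n)) x))\<^sup>2 < e\<^sup>2"
          using average_square_le[OF T_square[OF g], of t "gam (- int n)" x] by simp
        then have "\<bar>average (T g) (cube_at t (gam (- int n)) x)\<bar> < e"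
          using e by (simp add: power2_less_imp_less[of "\<bar>average (T g) (cube_at t (gam (- int n)) x)\<bar>" e])
        then show ?case by (simp add: dist_real_def)
      qed
    qed
    have "sym_part n g x = average (T g) (cube_at t (gam (int n)) x) - average (T g) (cube_at t (gam (- int n)) x)" for n
      by (rule part_telescope[OF g]) simp
    then show ?case using tendsto_diff[OF 1 2] by simp
  qed
qed

text \<open>The oscillation of the partial sums of \<open>f\<close> differs from that of a square integrable approximation by at
most twice the maximal truncation of the difference, which is small outside a small set.\<close>

lemma sym_part_convergent:
  fixes f :: "real^'n \<Rightarrow> real"
  assumes f: "integrable lebesgue f"
  shows "AE x in lebesgue. convergent (\<lambda>n. sym_part n f x)"
proof -
  define Z where "Z \<delta> = {x. \<not> (\<exists>k. \<forall>m\<ge>k. \<forall>n\<ge>k. \<bar>sym_part m f x - sym_part n f x\<bar> < 3 * \<delta>)}" for \<delta>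
  obtain F where F: "\<And>n. integrable lebesgue (F n)" "\<And>n. square_integrable (F n)"
      "(\<lambda>n::nat. LINT x|lebesgue. \<bar>F n x - f x\<bar>) \<longlonglongrightarrow> 0"
    using square_integrable_dense_L1[OF f] by blast
  let ?C = "weak_const A CARD('n)"
  have C: "?C > 0" using A_ge_1 unfolding weak_const_def by (intro add_pos_pos) auto
  have Znull: "Z \<delta> \<in> null_sets lebesgue" if \<delta>: "\<delta> > 0" for \<delta>
  proof (rule null_setsI_small_cover)
    fix e :: real assume e: "e > 0"
    have "\<forall>\<^sub>F n in sequentially. (LINT x|lebesgue. \<bar>F n x - f x\<bar>) < e * \<delta> / ?C"
      using F(3) e \<delta> C by (intro order_tendstoD) auto
    then obtain i where i: "(LINT x|lebesgue. \<bar>F i x - f x\<bar>) < e * \<delta> / ?C"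
      by (auto simp: eventually_sequentially)
    have hi: "integrable lebesgue (\<lambda>x. F i x - f x)" using F f by auto
    define B where "B = {x. \<exists>m n. m \<le> n \<and> \<delta> < \<bar>part m n (\<lambda>x. F i x - f x) x\<bar>}"
    have Bm: "B \<in> sets lebesgue" unfolding B_def by (rule sets_part_exceed)
    have "emeasure lebesgue B \<le> ennreal (?C * (LINT x|lebesgue. \<bar>F i x - f x\<bar>) / \<delta>)"
      unfolding B_def by (rule weak_type[OF hi \<delta>])
    also have "\<dots> \<le> ennreal e"
      using i C \<delta> by (intro ennreal_leI) (simp add: field_simps)
    finally have Be: "emeasure lebesgue B \<le> ennreal e" .
    obtain N where N: "{x\<in>space lebesgue. \<not> (\<lambda>n. sym_part n (F i) x) \<longlonglongrightarrow> T (F i) x} \<subseteq> N"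
        "emeasure lebesgue N = 0" "N \<in> sets lebesgue"
      using AE_E[OF sym_part_tendsto_square[OF F(2)[of i]]] by blast
    have "emeasure lebesgue (B \<union> N) \<le> emeasure lebesgue B + emeasure lebesgue N"
      by (rule emeasure_subadditive[OF Bm N(3)])
    then have le: "emeasure lebesgue (B \<union> N) \<le> ennreal e" using Be N(2) by simp
    have "Z \<delta> \<subseteq> B \<union> N"
    proof (rule subsetI, rule ccontr)
      fix x assume x: "x \<in> Z \<delta>" and nx: "x \<notin> B \<union> N"
      have "Cauchy (\<lambda>n. sym_part n (F i) x)"
        using nx N(1) by (intro LIMSEQ_imp_Cauchy[of _ "T (F i) x"]) auto
      then obtain k where k: "\<And>m n. m \<ge> k \<Longrightarrow> n \<ge> k \<Longrightarrow> \<bar>sym_part m (F i) x - sym_part n (F i) x\<bar> < \<delta>"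
        unfolding Cauchy_def dist_real_def using \<delta> by blast
      have d: "\<bar>sym_part m (F i) x - sym_part m f x\<bar> \<le> \<delta>" for m
      proof -
        have "\<not> \<delta> < \<bar>sym_part m (\<lambda>x. F i x - f x) x\<bar>"
          using nx unfolding B_def by auto
        then show ?thesis by (simp add: part_diff[OF F(1) f])
      qed
      have "\<bar>sym_part m f x - sym_part n f x\<bar> < 3 * \<delta>" if "m \<ge> k" "n \<ge> k" for m n
        using k[OF that] d[of m] d[of n] by linarith
      then show False using x unfolding Z_def by blast
    qed
    then show "\<exists>B\<in>sets lebesgue. Z \<delta> \<subseteq> B \<and> emeasure lebesgue B \<le> ennreal e"
      using Bm N(3) le by (intro bexI[of _ "B \<union> N"]) auto
  qed
  have "AE x in lebesgue. \<forall>n. x \<notin> Z (1 / Suc n)"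
    using Znull by (subst AE_all_countable) (auto intro: AE_not_in)
  then show ?thesis
  proof eventually_elim
    case (elim x)
    have "Cauchy (\<lambda>n. sym_part n f x)"
      unfolding Cauchy_def
    proof (intro allI impI)
      fix e :: real assume "e > 0"
      then obtain n where "inverse (real (Suc n)) < e / 3" using reals_Archimedean[of "e/3"] by auto
      then have le: "3 * (1 / Suc n) < e" by (simp add: field_simps)
      obtain k where "\<forall>i\<ge>k. \<forall>j\<ge>k. \<bar>sym_part i f x - sym_part j f x\<bar> < 3 * (1 / Suc n)"
        using elim unfolding Z_def by blast
      then show "\<exists>M. \<forall>m\<ge>M. \<forall>n\<ge>M. dist (sym_part m f x) (sym_part n f x) < e"
        unfolding dist_real_def using le by (meson less_trans)
    qed
    then show ?case by (simp add: Cauchy_convergent_iff)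
  qed
qed

lemma lim_tends_in_measure:
  fixes f :: "real^'n \<Rightarrow> real"
  assumes f: "integrable lebesgue f"
    and F: "\<And>n. integrable lebesgue (F n)" "\<And>n. square_integrable (F n)"
    and conv: "(\<lambda>n::nat. LINT x|lebesgue. \<bar>F n x - f x\<bar>) \<longlonglongrightarrow> 0"
  shows "tends_in_measure (\<lambda>n. T (F n)) (\<lambda>x. lim (\<lambda>n. sym_part n f x))"
  unfolding tends_in_measure_def
proof (intro allI impI)
  fix \<delta> :: real assume \<delta>: "\<delta> > 0"
  let ?C = "weak_const A CARD('n)"
  let ?g = "\<lambda>x. lim (\<lambda>n. sym_part n f x)"
  have bound: "emeasure lebesgue {x. \<delta> < \<bar>T (F i) x - ?g x\<bar>} \<le> ennreal (?C * (LINT x|lebesgue. \<bar>F i x - f x\<bar>) / \<delta>)" for i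
  proof -
    have hi: "integrable lebesgue (\<lambda>x. F i x - f x)" using F f by auto
    define B where "B = {x. \<exists>m n. m \<le> n \<and> \<delta> < \<bar>part m n (\<lambda>x. F i x - f x) x\<bar>}"
    have Bm: "B \<in> sets lebesgue" unfolding B_def by (rule sets_part_exceed)
    have ae: "AE x in lebesgue. (\<lambda>n. sym_part n (F i) x) \<longlonglongrightarrow> T (F i) x \<and> convergent (\<lambda>n. sym_part n f x)"
      using sym_part_tendsto_square[OF F(2)[of i]] sym_part_convergent[OF f] by (rule AE_conjI)
    have "AE x in lebesgue. x \<in> {x. \<delta> < \<bar>T (F i) x - ?g x\<bar>} \<longrightarrow> x \<in> B"
      using ae
    proof eventually_elim
      case (elim x)
      show ?case
      proof
        assume x: "x \<in> {x. \<delta> < \<bar>T (F i) x - ?g x\<bar>}"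
        have "(\<lambda>n. sym_part n f x) \<longlonglongrightarrow> ?g x" using elim by (simp add: convergent_LIMSEQ_iff)
        then have "(\<lambda>n. \<bar>sym_part n (F i) x - sym_part n f x\<bar>) \<longlonglongrightarrow> \<bar>T (F i) x - ?g x\<bar>"
          using elim by (intro tendsto_intros) auto
        then have "\<forall>\<^sub>F n in sequentially. \<delta> < \<bar>sym_part n (F i) x - sym_part n f x\<bar>"
          using x by (intro order_tendstoD) auto
        then obtain n where "\<delta> < \<bar>sym_part n (F i) x - sym_part n f x\<bar>"
          by (auto simp: eventually_sequentially)
        then have "\<delta> < \<bar>sym_part n (\<lambda>x. F i x - f x) x\<bar>" by (simp add: part_diff[OF F(1) f])
        then show "x \<in> B" unfolding B_def by (intro CollectI exI[of _ "- int n"] exI[of _ "int n"]) simp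
      qed
    qed
    then have "emeasure lebesgue {x. \<delta> < \<bar>T (F i) x - ?g x\<bar>} \<le> emeasure lebesgue B"
      using Bm by (rule emeasure_mono_AE)
    also have "\<dots> \<le> ennreal (?C * (LINT x|lebesgue. \<bar>F i x - f x\<bar>) / \<delta>)"
      unfolding B_def by (rule weak_type[OF hi \<delta>])
    finally show ?thesis .
  qed
  have "(\<lambda>i. ennreal (?C * (LINT x|lebesgue. \<bar>F i x - f x\<bar>) / \<delta>)) \<longlonglongrightarrow> ennreal (?C * 0 / \<delta>)"
    using \<delta> by (intro tendsto_ennrealI tendsto_intros conv) auto
  then have "(\<lambda>i. ennreal (?C * (LINT x|lebesgue. \<bar>F i x - f x\<bar>) / \<delta>)) \<longlonglongrightarrow> 0" by simp
  then show "(\<lambda>i. emeasure lebesgue {x. \<delta> < \<bar>T (F i) x - ?g x\<bar>}) \<longlonglongrightarrow> 0"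
    by (rule tendsto_sandwich[OF always_eventually[OF allI] always_eventually[OF allI] tendsto_const, rotated -1])
       (auto intro: bound)
qed

text \<open>The limit of the partial sums has the property that defines the extension, and two functions with this
property agree almost everywhere, since both are limits in measure of the same sequence.\<close>

theorem L1_extension_eq_lim:
  fixes f :: "real^'n \<Rightarrow> real"
  assumes f: "integrable lebesgue f"
  shows "AE x in lebesgue. (\<lambda>n. sym_part n f x) \<longlonglongrightarrow> L1_extension T f x"
proof -
  let ?P = "\<lambda>g. g \<in> borel_measurable lebesgue \<and>
        (\<forall>F. (\<forall>n. integrable lebesgue (F n) \<and> square_integrable (F n)) \<and>
             (\<lambda>n. LINT x|lebesgue. \<bar>F n x - f x\<bar>) \<longlonglongrightarrow> 0
           \<longrightarrow> tends_in_measure (\<lambda>n. T (F n)) g)"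
  define g where "g x = lim (\<lambda>n. sym_part n f x)" for x
  have gm: "g \<in> borel_measurable lebesgue"
    unfolding g_def using part_measurable by (rule borel_measurable_lim_metric)
  have Pg: "?P g"
    using gm lim_tends_in_measure[OF f, folded g_def] by blast
  define G where "G = L1_extension T f"
  have "?P G" unfolding G_def L1_extension_def by (rule someI[where P="?P", OF Pg])
  obtain F where F: "\<And>n. integrable lebesgue (F n)" "\<And>n. square_integrable (F n)"
      "(\<lambda>n::nat. LINT x|lebesgue. \<bar>F n x - f x\<bar>) \<longlonglongrightarrow> 0"
    using square_integrable_dense_L1[OF f] by blast
  have Gm: "G \<in> borel_measurable lebesgue" and tG: "tends_in_measure (\<lambda>n. T (F n)) G"
    and tg: "tends_in_measure (\<lambda>n. T (F n)) g"
    using \<open>?P G\<close> Pg F by blast+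
  have Tm: "T (F n) \<in> borel_measurable lebesgue" for n
    using T_square[OF F(2)] by (simp add: square_integrable_def)
  have null: "emeasure lebesgue {x. 2 * \<delta> < \<bar>G x - g x\<bar>} = 0" if \<delta>: "\<delta> > 0" for \<delta>
  proof -
    let ?a = "\<lambda>n. emeasure lebesgue {x. \<delta> < \<bar>T (F n) x - G x\<bar>}"
    let ?b = "\<lambda>n. emeasure lebesgue {x. \<delta> < \<bar>T (F n) x - g x\<bar>}"
    have "?a \<longlonglongrightarrow> 0" "?b \<longlonglongrightarrow> 0" using tG tg \<delta> unfolding tends_in_measure_def by auto
    then have "(\<lambda>n. ?a n + ?b n) \<longlonglongrightarrow> 0 + 0" by (rule tendsto_add)
    moreover have "emeasure lebesgue {x. 2 * \<delta> < \<bar>G x - g x\<bar>} \<le> ?a n + ?b n" for n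
    proof -
      have ma: "{x. \<delta> < \<bar>T (F n) x - G x\<bar>} \<in> sets lebesgue"
      proof -
        have "{x\<in>space lebesgue. \<delta> < \<bar>T (F n) x - G x\<bar>} \<in> sets lebesgue" using Tm[of n] Gm by measurable
        then show ?thesis by simp
      qed
      have mb: "{x. \<delta> < \<bar>T (F n) x - g x\<bar>} \<in> sets lebesgue"
      proof -
        have "{x\<in>space lebesgue. \<delta> < \<bar>T (F n) x - g x\<bar>} \<in> sets lebesgue" using Tm[of n] gm by measurable
        then show ?thesis by simp
      qed
      have "{x. 2 * \<delta> < \<bar>G x - g x\<bar>} \<subseteq> {x. \<delta> < \<bar>T (F n) x - G x\<bar>} \<union> {x. \<delta> < \<bar>T (F n) x - g x\<bar>}"
        by auto
      then have "emeasure lebesgue {x. 2 * \<delta> < \<bar>G x - g x\<bar>} \<le> emeasure lebesgue ({x. \<delta> < \<bar>T (F n) x - G x\<bar>} \<union> {x. \<delta> < \<bar>T (F n) x - g x\<bar>})"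
        using ma mb by (intro emeasure_mono) auto
      also have "\<dots> \<le> ?a n + ?b n" using ma mb by (rule emeasure_subadditive)
      finally show ?thesis .
    qed
    ultimately have "emeasure lebesgue {x. 2 * \<delta> < \<bar>G x - g x\<bar>} \<le> 0 + 0"
      by (intro LIMSEQ_le_const[of "\<lambda>n. ?a n + ?b n"]) auto
    then show ?thesis by simp
  qed
  have "AE x in lebesgue. \<forall>k::nat. \<not> (2 * (1 / Suc k) < \<bar>G x - g x\<bar>)"
  proof (subst AE_all_countable, rule allI, rule AE_I)
    fix k :: nat
    show "emeasure lebesgue {x. 2 * (1 / Suc k) < \<bar>G x - g x\<bar>} = 0" by (rule null) simp
    have "{x\<in>space lebesgue. 2 * (1 / Suc k) < \<bar>G x - g x\<bar>} \<in> sets lebesgue" using Gm gm by measurable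
    then show "{x. 2 * (1 / Suc k) < \<bar>G x - g x\<bar>} \<in> sets lebesgue" by simp
  qed auto
  then have "AE x in lebesgue. G x = g x"
  proof eventually_elim
    case (elim x)
    show ?case
    proof (rule ccontr)
      assume "G x \<noteq> g x"
      then obtain k where "inverse (real (Suc k)) < \<bar>G x - g x\<bar> / 2" using reals_Archimedean[of "\<bar>G x - g x\<bar> / 2"] by auto
      then have "2 * (1 / Suc k) < \<bar>G x - g x\<bar>" by (simp add: field_simps)
      then show False using elim by blast
    qed
  qed
  with sym_part_convergent[OF f] show ?thesis
  proof eventually_elim
    case (elim x)
    then show ?case unfolding G_def[symmetric] by (simp add: g_def convergent_LIMSEQ_iff)
  qed
qed

lemma block_bounded_linear:
  fixes f :: "real^'n \<Rightarrow> 'b::{banach, second_countable_topology}" and l :: "'b \<Rightarrow> 'c::{banach, second_countable_topology}"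
  assumes f: "integrable lebesgue f" and l: "bounded_linear l"
  shows "block j (\<lambda>y. l (f y)) x = l (block j f x)"
proof -
  have "block j (\<lambda>y. l (f y)) x = (LINT y|lebesgue. l (kap j x y *\<^sub>R f y))"
    unfolding block_def using l by (simp add: linear_simps bounded_linear.linear linear_scale)
  also have "\<dots> = l (block j f x)"
    unfolding block_def by (rule integral_bounded_linear[OF l block_integrable[OF f]])
  finally show ?thesis .
qed

lemma part_bounded_linear:
  fixes f :: "real^'n \<Rightarrow> 'b::{banach, second_countable_topology}" and l :: "'b \<Rightarrow> 'c::{banach, second_countable_topology}"
  assumes f: "integrable lebesgue f" and l: "bounded_linear l"
  shows "part m n (\<lambda>y. l (f y)) x = l (part m n f x)"
  unfolding part_def by (simp add: block_bounded_linear[OF f l] linear_sum[OF bounded_linear.linear[OF l]])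

theorem L1_extension_vec_eq_lim:
  fixes f :: "real^'n \<Rightarrow> real^'d"
  assumes f: "integrable lebesgue f"
  shows "AE x in lebesgue. (\<lambda>n. sym_part n f x) \<longlonglongrightarrow> L1_extension_vec T f x"
proof -
  have fi: "integrable lebesgue (\<lambda>y. f y $ i)" for i
    using integrable_bounded_linear[OF bounded_linear_vec_nth f] .
  have "AE x in lebesgue. \<forall>i. (\<lambda>n. sym_part n (\<lambda>y. f y $ i) x) \<longlonglongrightarrow> L1_extension T (\<lambda>y. f y $ i) x"
    by (subst AE_all_countable) (intro allI L1_extension_eq_lim fi)
  then show ?thesis
  proof eventually_elim
    case (elim x)
    show ?case
    proof (rule vec_tendstoI)
      fix i
      show "(\<lambda>n. sym_part n f x $ i) \<longlonglongrightarrow> L1_extension_vec T f x $ i"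
        using elim[rule_format, of i] part_bounded_linear[OF f bounded_linear_vec_nth[of i]]
        by (simp add: L1_extension_vec_def)
    qed
  qed
qed

end

section \<open>Almost Auerbach bases\<close>

text \<open>The bound on the coordinate functionals that the greedy construction in \<open>almost_auerbach_basis\<close> gives.\<close>

primrec basis_const :: "nat \<Rightarrow> real" where
  "basis_const 0 = 1"
| "basis_const (Suc m) = 2 + (1 + 2 * real m) * basis_const m"

lemma basis_const_ge_1: "1 \<le> basis_const m"
proof (induction m)
  case (Suc m)
  then have "0 \<le> (1 + 2 * real m) * basis_const m" by (intro mult_nonneg_nonneg) auto
  then show ?case unfolding basis_const.simps by linarith
qed simp

lemma basis_const_Suc: "basis_const m \<le> basis_const (Suc m)" "2 + 2 * real m * basis_const m \<le> basis_const (Suc m)"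
proof -
  have "0 \<le> real m * basis_const m" using basis_const_ge_1[of m] by (intro mult_nonneg_nonneg) auto
  then show "basis_const m \<le> basis_const (Suc m)" "2 + 2 * real m * basis_const m \<le> basis_const (Suc m)"
    using basis_const_ge_1[of m] by (simp_all add: algebra_simps)
qed

lemma basis_const_mono: "m \<le> n \<Longrightarrow> basis_const m \<le> basis_const n"
  using basis_const_Suc(1) by (rule lift_Suc_mono_le)

lemma large_element:
  fixes K :: "'v::euclidean_space set"
  assumes "bounded K" "v \<in> K" "v \<noteq> 0"
  shows "\<exists>e\<in>K. e \<noteq> 0 \<and> (\<forall>w\<in>K. norm w \<le> 2 * norm e)"
proof -
  define s where "s = Sup (norm ` K)"
  have bd: "bdd_above (norm ` K)" using assms(1) by (simp add: bounded_norm_comp bounded_imp_bdd_above)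
  have le: "norm w \<le> s" if "w \<in> K" for w unfolding s_def using bd that by (intro cSup_upper) auto
  have s: "s > 0" using le[OF assms(2)] assms(3) by (metis less_le_trans zero_less_norm_iff)
  have "s / 2 < Sup (norm ` K)" using s unfolding s_def[symmetric] by simp
  then obtain e where e: "e \<in> K" "s / 2 < norm e"
    using less_cSup_iff[OF _ bd, of "s / 2"] assms(2) by blast
  have "norm w \<le> 2 * norm e" if "w \<in> K" for w using le[OF that] e(2) by linarith
  moreover have "e \<noteq> 0" using e s by auto
  ultimately show ?thesis using e(1) by blast
qed

text \<open>Take a vector \<open>e\<^sub>0\<close> of nearly maximal norm, project \<open>K\<close> to its orthogonal complement and continue by
induction on the dimension. An Auerbach basis proper would give the bound 1 on the functionals, by
maximizing a determinant over a compact set; the greedy choice works in any bounded set, at the price of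
a constant that grows with the dimension.\<close>

theorem almost_auerbach_basis:
  fixes K :: "'v::euclidean_space set"
  assumes "bounded K" "dim K = m"
  shows "\<exists>e l. (\<forall>i<m. e i \<in> K) \<and> (\<forall>i<m. linear (l i)) \<and>
    (\<forall>i<m. \<forall>v\<in>K. \<bar>l i v\<bar> \<le> basis_const m) \<and> (\<forall>v\<in>span K. v = (\<Sum>i<m. l i v *\<^sub>R e i))"
  using assms
proof (induction m arbitrary: K)
  case 0
  then have "K \<subseteq> {0}" by (simp add: dim_eq_0)
  then have "span K \<subseteq> span {0}" by (rule span_mono)
  then have "v = 0" if "v \<in> span K" for v using that by auto
  then show ?case by auto
next
  case (Suc m)
  have "\<not> K \<subseteq> {0}" using Suc.prems(2) dim_eq_0[of K] by simp
  then obtain e0 where e0: "e0 \<in> K" "e0 \<noteq> 0" "\<And>w. w \<in> K \<Longrightarrow> norm w \<le> 2 * norm e0"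
    using large_element[OF Suc.prems(1)] by blast
  define \<mu> where "\<mu> v = (v \<bullet> e0) / (e0 \<bullet> e0)" for v
  define P where "P v = v - \<mu> v *\<^sub>R e0" for v
  have e00: "e0 \<bullet> e0 > 0" using e0 by simp
  have lin\<mu>: "linear \<mu>"
    unfolding \<mu>_def by (intro linearI) (simp_all add: inner_add_left add_divide_distrib)
  have linP: "linear P"
    unfolding P_def using linear_add[OF lin\<mu>] linear_scale[OF lin\<mu>]
    by (intro linearI) (simp_all add: algebra_simps)
  have P_orth: "P v \<bullet> e0 = 0" for v
    unfolding P_def \<mu>_def using e00 by (simp add: inner_diff_left)
  define K' where "K' = P ` K"
  have bK': "bounded K'"
    unfolding K'_def using Suc.prems(1) linP by (intro bounded_linear_image) (simp_all add: linear_conv_bounded_linear)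
  have spanK: "span (insert e0 K') = span K"
  proof (rule span_eq[THEN iffD2], intro conjI)
    show "insert e0 K' \<subseteq> span K"
    proof -
      have "e0 \<in> span K" using e0(1) by (rule span_base)
      moreover have "P v \<in> span K" if "v \<in> K" for v
        unfolding P_def by (intro span_diff span_scale span_base that e0(1))
      ultimately show ?thesis unfolding K'_def by blast
    qed
    show "K \<subseteq> span (insert e0 K')"
    proof
      fix v assume "v \<in> K"
      then have "P v \<in> span (insert e0 K')" by (intro span_base) (simp add: K'_def)
      moreover have "\<mu> v *\<^sub>R e0 \<in> span (insert e0 K')" by (intro span_scale span_base) simp
      ultimately have "P v + \<mu> v *\<^sub>R e0 \<in> span (insert e0 K')" by (rule span_add)
      then show "v \<in> span (insert e0 K')" by (simp add: P_def)
    qed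
  qed
  have "e0 \<notin> span K'"
  proof
    assume "e0 \<in> span K'"
    moreover have "span K' \<subseteq> {v. v \<bullet> e0 = 0}"
      unfolding K'_def by (intro span_minimal) (auto simp: P_orth subspace_def inner_add_left)
    ultimately show False using e00 by auto
  qed
  then have "dim (insert e0 K') = dim K' + 1" by (simp add: dim_insert)
  moreover have "dim (insert e0 K') = dim K" using spanK by (rule span_eq_dim)
  ultimately have "dim K' = m" using Suc.prems(2) by simp
  then obtain e' l' where IH: "\<forall>i<m. e' i \<in> K'" "\<forall>i<m. linear (l' i)"
      "\<forall>i<m. \<forall>v\<in>K'. \<bar>l' i v\<bar> \<le> basis_const m" "\<forall>v\<in>span K'. v = (\<Sum>i<m. l' i v *\<^sub>R e' i)"
    using Suc.IH[OF bK'] by auto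
  have "\<forall>i. \<exists>k. i < m \<longrightarrow> k \<in> K \<and> e' i = P k" using IH(1) unfolding K'_def by auto
  then obtain k where k: "\<And>i. i < m \<Longrightarrow> k i \<in> K" "\<And>i. i < m \<Longrightarrow> e' i = P (k i)" by metis
  have \<mu>2: "\<bar>\<mu> v\<bar> \<le> 2" if "v \<in> K" for v
  proof -
    have "\<bar>v \<bullet> e0\<bar> \<le> norm v * norm e0" by (rule Cauchy_Schwarz_ineq2)
    also have "\<dots> \<le> (2 * norm e0) * norm e0" using e0(3)[OF that] by (rule mult_right_mono) simp
    also have "\<dots> = 2 * (e0 \<bullet> e0)" by (simp add: power2_norm_eq_inner[symmetric] power2_eq_square)
    finally show ?thesis unfolding \<mu>_def using e00 by (simp add: abs_divide divide_le_eq)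
  qed
  define e where "e i = (case i of 0 \<Rightarrow> e0 | Suc i \<Rightarrow> k i)" for i
  define l where "l i v = (case i of 0 \<Rightarrow> \<mu> v - (\<Sum>i<m. l' i (P v) * \<mu> (k i)) | Suc i \<Rightarrow> l' i (P v))" for i v
  have l_Suc: "l (Suc i) = l' i \<circ> P" for i unfolding l_def by auto
  have l_0: "l 0 = (\<lambda>v. \<mu> v - (\<Sum>i<m. l' i (P v) * \<mu> (k i)))" unfolding l_def by auto
  have linl': "linear (l' i \<circ> P)" if "i < m" for i
    using linear_compose[OF linP IH(2)[rule_format, OF that]] .
  have "e i \<in> K" if "i < Suc m" for i
    using that e0(1) k(1) unfolding e_def by (cases i) auto
  moreover have "linear (l i)" if i: "i < Suc m" for i
  proof (cases i)
    case 0
    have "linear (\<lambda>v. \<Sum>i<m. l' i (P v) * \<mu> (k i))"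
    proof (rule linear_compose_sum, rule ballI)
      fix i assume "i \<in> {..<m}"
      then have "linear (l' i \<circ> P)" using linl' by simp
      then show "linear (\<lambda>v. l' i (P v) * \<mu> (k i))"
        using linear_add[OF \<open>linear (l' i \<circ> P)\<close>] linear_scale[OF \<open>linear (l' i \<circ> P)\<close>]
        by (intro linearI) (simp_all add: distrib_right)
    qed
    then show ?thesis unfolding 0 l_0 by (rule linear_compose_sub[OF lin\<mu>])
  next
    case (Suc i')
    then show ?thesis using linl'[of i'] i unfolding Suc l_Suc by simp
  qed
  moreover have "\<bar>l i v\<bar> \<le> basis_const (Suc m)" if i: "i < Suc m" and v: "v \<in> K" for i v
  proof (cases i)
    case 0
    have Pv: "P v \<in> K'" using v unfolding K'_def by simp
    have "\<bar>\<Sum>i<m. l' i (P v) * \<mu> (k i)\<bar> \<le> (\<Sum>i<m. basis_const m * 2)"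
    proof (rule order_trans[OF sum_abs], rule sum_mono)
      fix i assume "i \<in> {..<m}"
      then show "\<bar>l' i (P v) * \<mu> (k i)\<bar> \<le> basis_const m * 2"
        using IH(3) Pv \<mu>2[OF k(1)[of i]] basis_const_ge_1[of m] unfolding abs_mult by (intro mult_mono) auto
    qed
    then have "\<bar>l 0 v\<bar> \<le> 2 + 2 * real m * basis_const m"
      unfolding l_0 using \<mu>2[OF v] by (simp add: algebra_simps)
    then show ?thesis unfolding 0 using basis_const_Suc(2)[of m] by linarith
  next
    case (Suc i')
    then have "\<bar>l i v\<bar> \<le> basis_const m" using IH(3) i v unfolding K'_def by (simp add: l_Suc)
    then show ?thesis using basis_const_Suc(1)[of m] by linarith
  qed
  moreover have "v = (\<Sum>i<Suc m. l i v *\<^sub>R e i)" if v: "v \<in> span K" for v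
  proof -
    have "P v \<in> span K'" unfolding K'_def linear_span_image[OF linP] using v by (rule imageI)
    then have "P v = (\<Sum>i<m. l' i (P v) *\<^sub>R e' i)" using IH(4) by blast
    also have "\<dots> = (\<Sum>i<m. l' i (P v) *\<^sub>R k i - (l' i (P v) * \<mu> (k i)) *\<^sub>R e0)"
      by (intro sum.cong) (auto simp: k(2) P_def scaleR_diff_right)
    also have "\<dots> = (\<Sum>i<m. l' i (P v) *\<^sub>R k i) - (\<Sum>i<m. l' i (P v) * \<mu> (k i)) *\<^sub>R e0"
      by (simp add: sum_subtractf scaleR_left.sum)
    finally have Pv: "P v = (\<Sum>i<m. l' i (P v) *\<^sub>R k i) - (\<Sum>i<m. l' i (P v) * \<mu> (k i)) *\<^sub>R e0" .
    have "(\<Sum>i<Suc m. l i v *\<^sub>R e i) = l 0 v *\<^sub>R e0 + (\<Sum>i<m. l' i (P v) *\<^sub>R k i)"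
      unfolding sum.lessThan_Suc_shift by (simp add: e_def l_Suc)
    also have "\<dots> = \<mu> v *\<^sub>R e0 + P v"
      unfolding l_0 using Pv by (simp add: scaleR_diff_left)
    also have "\<dots> = v" by (simp add: P_def)
    finally show ?thesis by simp
  qed
  ultimately show ?case by blast
qed

section \<open>Sparse families given by a selection rule\<close>

lemma sets_selection:
  fixes t :: "real^'n"
  assumes inv: "\<And>j x y. y \<in> cube_at t j x \<Longrightarrow> Sel j y \<longleftrightarrow> Sel j x"
  shows "{y. \<exists>j'>j. Sel j' y} \<in> sets lebesgue"
proof -
  have "{y. Sel j' y} = {y. \<exists>z. dyadic_index t j' z = dyadic_index t j' y \<and> Sel j' z}" for j'
  proof (intro set_eqI iffI)
    fix y assume "y \<in> {y. \<exists>z. dyadic_index t j' z = dyadic_index t j' y \<and> Sel j' z}"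
    then obtain z where z: "dyadic_index t j' z = dyadic_index t j' y" "Sel j' z" by blast
    then have "y \<in> cube_at t j' z" by (simp add: mem_cube_at)
    then show "y \<in> {y. Sel j' y}" using inv[of y j' z] z(2) by simp
  qed blast
  then have "{y. Sel j' y} \<in> sets lebesgue" for j'
    using sets_dyadic_index[of "\<lambda>m. \<exists>z. dyadic_index t j' z = m \<and> Sel j' z" t j'] by simp
  then have "(\<Union>j'\<in>{j<..}. {y. Sel j' y}) \<in> sets lebesgue"
    by (intro sets.countable_UN'[OF countableI_type]) blast
  moreover have "(\<Union>j'\<in>{j<..}. {y. Sel j' y}) = {y. \<exists>j'>j. Sel j' y}" by auto
  ultimately show ?thesis by simp
qed

text \<open>Cubes are described by their generation and a point, and \<open>Sel j x\<close> says that the cube of generation \<open>j\<close> at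
\<open>x\<close> is taken. The maximal selected cubes strictly inside \<open>Q\<close> are disjoint and contained in the set of
points of \<open>Q\<close> that have a finer selected cube, so the smallness of this set is all that has to be checked.\<close>

theorem sparse_family_selection:
  fixes t :: "real^'n"
  assumes inv: "\<And>j x y. y \<in> cube_at t j x \<Longrightarrow> Sel j y \<longleftrightarrow> Sel j x"
    and small: "\<And>j x. Sel j x \<Longrightarrow>
      emeasure lebesgue {y \<in> cube_at t j x. \<exists>j'>j. Sel j' y} \<le> ennreal (\<epsilon> * measure lebesgue (cube_at t j x))"
    and eps: "0 \<le> \<epsilon>"
  shows "sparse_family \<epsilon> {cube_at t j x | j x. Sel j x}"
  unfolding sparse_family_def
proof (rule ballI)
  let ?S = "{cube_at t j x | j x. Sel j x}"
  fix Q assume "Q \<in> ?S"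
  then obtain j x where Q: "Q = cube_at t j x" and sel: "Sel j x" by blast
  let ?Y = "{y \<in> Q. \<exists>j'>j. Sel j' y}"
  have Ysub: "?Y \<subseteq> Q" by blast
  have Ym: "?Y \<in> lmeasurable"
  proof (rule fmeasurableI2)
    show "Q \<in> lmeasurable" unfolding Q by simp
    have "?Y = Q \<inter> {y. \<exists>j'>j. Sel j' y}" by blast
    then show "?Y \<in> sets lebesgue" unfolding Q using sets_selection[where Sel=Sel and j=j, OF inv] sets_cube_at[of t j x] by (simp only: sets.Int)
  qed (rule Ysub)
  have child: "R \<subseteq> ?Y \<and> (\<exists>j' y. R = cube_at t j' y)" if R: "R \<in> sparse_children ?S Q" for R
  proof -
    obtain j' y where R': "R = cube_at t j' y" "Sel j' y" using R unfolding sparse_children_def by blast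
    have sub: "R \<subset> Q" using R unfolding sparse_children_def by blast
    have "y \<in> Q" using sub R'(1) self_in_cube_at[of y t j'] by blast
    then have Qy: "Q = cube_at t j y" using cube_at_eq[of y t j x] unfolding Q by simp
    have "j < j'"
    proof (rule ccontr)
      assume "\<not> j < j'"
      then have "Q \<subseteq> R" unfolding Qy R'(1) by (intro cube_at_antimono) simp
      then show False using sub by blast
    qed
    have "R \<subseteq> ?Y"
    proof
      fix z assume z: "z \<in> R"
      then have "Sel j' z" using inv[of z j' y] R' by simp
      then show "z \<in> ?Y" using z sub \<open>j < j'\<close> by blast
    qed
    then show ?thesis using R' by blast
  qed
  have disj: "R1 \<inter> R2 = {}" if R: "R1 \<in> sparse_children ?S Q" "R2 \<in> sparse_children ?S Q" "R1 \<noteq> R2" for R1 R2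
  proof (rule ccontr)
    assume "R1 \<inter> R2 \<noteq> {}"
    then obtain z where z: "z \<in> R1" "z \<in> R2" by blast
    obtain j1 y1 where 1: "R1 = cube_at t j1 y1" using child[OF R(1)] by blast
    obtain j2 y2 where 2: "R2 = cube_at t j2 y2" using child[OF R(2)] by blast
    have "R1 = cube_at t j1 z" "R2 = cube_at t j2 z"
      using cube_at_eq[of z t j1 y1] cube_at_eq[of z t j2 y2] z unfolding 1 2 by simp_all
    then have "R1 \<subseteq> R2 \<or> R2 \<subseteq> R1"
      using cube_at_antimono[of j1 j2 t z] cube_at_antimono[of j2 j1 t z] linear[of j1 j2] by metis
    then have "R1 \<subset> R2 \<or> R2 \<subset> R1" using R(3) by (auto simp only: psubset_eq)
    moreover have "R1 \<in> ?S \<and> R1 \<subset> Q \<and> (\<forall>R'\<in>?S. R1 \<subset> R' \<longrightarrow> \<not> R' \<subset> Q)"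
      "R2 \<in> ?S \<and> R2 \<subset> Q \<and> (\<forall>R'\<in>?S. R2 \<subset> R' \<longrightarrow> \<not> R' \<subset> Q)"
      using R(1,2) unfolding sparse_children_def by (simp_all only: mem_Collect_eq Bex_def Ball_def) iprover+
    ultimately show False by (elim disjE conjE) (drule bspec, assumption, iprover)+
  qed
  have fin: "(\<Sum>R\<in>F. measure lebesgue R) \<le> \<epsilon> * measure lebesgue Q" if F: "finite F" "F \<subseteq> sparse_children ?S Q" for F
  proof -
    have ms: "R \<in> lmeasurable" if "R \<in> F" for R using child[of R] that F(2) fmeasurable_cube_at by blast
    have "measure lebesgue (\<Union>R\<in>F. R) = (\<Sum>R\<in>F. measure lebesgue R)"
    proof (rule measure_finite_Union[OF F(1)])
      show "(\<lambda>R. R) ` F \<subseteq> sets lebesgue" using fmeasurableD[OF ms] by blast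
      show "disjoint_family_on (\<lambda>R. R) F" unfolding disjoint_family_on_def using disj F(2) by blast
      show "emeasure lebesgue R \<noteq> \<infinity>" if "R \<in> F" for R
        using fmeasurableD2[OF ms[OF that]] by simp
    qed
    moreover have "measure lebesgue (\<Union>R\<in>F. R) \<le> measure lebesgue ?Y"
    proof (rule measure_mono_fmeasurable[OF _ _ Ym])
      show "(\<Union>R\<in>F. R) \<subseteq> ?Y" using child F(2) by blast
      show "(\<Union>R\<in>F. R) \<in> sets lebesgue" using F(1) ms by (intro sets.finite_UN) (auto simp: fmeasurable_def)
    qed
    moreover have "measure lebesgue ?Y \<le> \<epsilon> * measure lebesgue Q"
      using small[OF sel] eps unfolding Q measure_def by (intro enn2real_leI) (simp_all add: measure_def)
    ultimately show ?thesis by simp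
  qed
  have s: "measure lebesgue summable_on sparse_children ?S Q"
  proof (rule nonneg_bdd_above_summable_on)
    show "bdd_above (sum (measure lebesgue) ` {F. F \<subseteq> sparse_children ?S Q \<and> finite F})"
      by (rule bdd_aboveI2[where M="\<epsilon> * measure lebesgue Q"]) (elim CollectE conjE, rule fin)
  qed simp
  moreover have "(\<Sum>\<^sub>\<infinity>R\<in>sparse_children ?S Q. measure lebesgue R) \<le> \<epsilon> * measure lebesgue Q"
    by (rule infsum_le_finite_sums[OF s fin])
  ultimately show "measure lebesgue summable_on sparse_children ?S Q \<and>
      (\<Sum>\<^sub>\<infinity>R\<in>sparse_children ?S Q. measure lebesgue R) \<le> \<epsilon> * measure lebesgue Q" by blast
qed

text \<open>At almost every point \<open>x\<close> of the set \<open>E\<close> of points in infinitely many selected cubes, the density of \<open>E\<close> in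
the cubes at \<open>x\<close> tends to 1. But in each of the infinitely many selected cubes at \<open>x\<close> the density of \<open>E\<close> is at
most \<open>\<epsilon>\<close>.\<close>

theorem selection_finite_AE:
  fixes t :: "real^'n"
  assumes inv: "\<And>j x y. y \<in> cube_at t j x \<Longrightarrow> Sel j y \<longleftrightarrow> Sel j x"
    and small: "\<And>j x. Sel j x \<Longrightarrow>
      emeasure lebesgue {y \<in> cube_at t j x. \<exists>j'>j. Sel j' y} \<le> ennreal (\<epsilon> * measure lebesgue (cube_at t j x))"
    and eps: "0 \<le> \<epsilon>" "\<epsilon> < 1"
  shows "AE x in lebesgue. \<exists>j. \<forall>j'>j. \<not> Sel j' x"
proof -
  define E where "E = (\<Inter>j. {y. \<exists>j'>j. Sel j' y})"
  have E: "E \<in> sets lebesgue"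
    unfolding E_def using sets_selection[where Sel=Sel, OF inv] by (intro sets.countable_INT'') auto
  have avg: "average (indicat_real E) (cube_at t j x) \<le> \<epsilon>" if sel: "Sel j x" for j x
  proof -
    have "(LINT y:cube_at t j x|lebesgue. indicat_real E y) = measure lebesgue (cube_at t j x \<inter> E)"
      unfolding set_lebesgue_integral_def using E by (simp flip: indicator_inter_arith)
    also have "\<dots> \<le> \<epsilon> * measure lebesgue (cube_at t j x)"
    proof -
      have "emeasure lebesgue (cube_at t j x \<inter> E) \<le> emeasure lebesgue {y \<in> cube_at t j x. \<exists>j'>j. Sel j' y}"
      proof (rule emeasure_mono)
        show "cube_at t j x \<inter> E \<subseteq> {y \<in> cube_at t j x. \<exists>j'>j. Sel j' y}" unfolding E_def by blast
        have "{y \<in> cube_at t j x. \<exists>j'>j. Sel j' y} = cube_at t j x \<inter> {y. \<exists>j'>j. Sel j' y}" by blast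
        then show "{y \<in> cube_at t j x. \<exists>j'>j. Sel j' y} \<in> sets lebesgue"
          using sets_selection[where Sel=Sel and j=j, OF inv] sets_cube_at[of t j x] by (simp only: sets.Int)
      qed
      also note small[OF sel]
      finally show ?thesis using eps unfolding measure_def by (intro enn2real_leI) (simp_all add: measure_def)
    qed
    finally show ?thesis
      using measure_cube_at_pos[of t j x] unfolding average_def by (simp add: field_simps)
  qed
  have si: "set_integrable lebesgue (cube_at t 0 z) (indicat_real E)" for z
  proof -
    have "cube_at t 0 z \<inter> E \<in> lmeasurable" using E by (intro fmeasurable_Int_fmeasurable) auto
    then show ?thesis
      unfolding set_integrable_def by (simp add: lmeasurable_iff_integrable flip: indicator_inter_arith)
  qed
  show ?thesis using dyadic_differentiation[OF si]
  proof eventually_elim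
    case (elim x)
    show ?case
    proof (rule ccontr)
      assume "\<nexists>j. \<forall>j'>j. \<not> Sel j' x"
      then have inf: "\<exists>j'>j. Sel j' x" for j by blast
      then have "x \<in> E" unfolding E_def by blast
      then have "((\<lambda>j. average (indicat_real E) (cube_at t j x)) \<longlongrightarrow> 1) at_top" using elim by simp
      then have "\<forall>\<^sub>F j in at_top. \<epsilon> < average (indicat_real E) (cube_at t j x)"
        using eps by (intro order_tendstoD) auto
      then obtain J where J: "\<And>j. j \<ge> J \<Longrightarrow> \<epsilon> < average (indicat_real E) (cube_at t j x)"
        by (auto simp: eventually_at_top_linorder)
      obtain j where "j > J" "Sel j x" using inf by blast
      then show False using J[of j] avg[of j x] by simp
    qed
  qed
qed

text \<open>Choosing 0 in all other convex bodies turns the series in the definition of the sparse operator into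
a finite sum.\<close>

lemma sparse_operator_finite_sum:
  fixes t :: "real^'n" and f :: "real^'n \<Rightarrow> real^'d" and g :: "'i \<Rightarrow> int"
  assumes F: "finite F" "inj_on g F" "\<And>i. i \<in> F \<Longrightarrow> Sel (g i) x"
    and w: "\<And>i. i \<in> F \<Longrightarrow> w i \<in> convex_body_average f (cube_at t (g i) x)"
    and zero: "\<And>Q. 0 \<in> convex_body_average f Q"
  shows "(\<Sum>i\<in>F. w i) \<in> sparse_operator {cube_at t j x | j x. Sel j x} f x"
proof -
  let ?S = "{cube_at t j x | j x. Sel j x}"
  let ?q = "\<lambda>i. cube_at t (g i) x"
  define v where "v Q = (if Q \<in> ?q ` F then w (inv_into F ?q Q) else 0)" for Q
  have inj: "inj_on ?q F"
  proof (rule inj_onI)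
    fix i i' assume "i \<in> F" "i' \<in> F" "?q i = ?q i'"
    then show "i = i'" using cube_at_inj_gen F(2) by (metis inj_onD)
  qed
  have v_eq: "v (?q i) = w i" if "i \<in> F" for i
    using that inv_into_f_f[OF inj that] unfolding v_def by simp
  have sub: "?q ` F \<subseteq> {Q \<in> ?S. x \<in> Q}" using F(3) by auto
  have v0: "v Q = 0" if "Q \<notin> ?q ` F" for Q using that unfolding v_def by simp
  have "(\<Sum>\<^sub>\<infinity>Q\<in>{Q \<in> ?S. x \<in> Q}. v Q) = (\<Sum>\<^sub>\<infinity>Q\<in>?q ` F. v Q)"
    using sub v0 by (intro infsum_cong_neutral) auto
  also have "\<dots> = (\<Sum>Q\<in>?q ` F. v Q)" using F(1) by simp
  also have "\<dots> = (\<Sum>i\<in>F. w i)" using inj v_eq by (simp add: sum.reindex)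
  finally have sum: "(\<Sum>i\<in>F. w i) = (\<Sum>\<^sub>\<infinity>Q\<in>{Q \<in> ?S. x \<in> Q}. v Q)" by simp
  have "v Q \<in> convex_body_average f Q" for Q
  proof (cases "Q \<in> ?q ` F")
    case True
    then obtain i where "i \<in> F" "Q = ?q i" by blast
    then show ?thesis using w v_eq by simp
  next
    case False
    then show ?thesis using v0 zero by simp
  qed
  moreover have "(\<lambda>Q. norm (v Q)) summable_on {Q \<in> ?S. x \<in> Q}"
  proof -
    have "(\<lambda>Q. norm (v Q)) summable_on (?q ` F)" using F(1) by (intro summable_on_finite) simp
    then show ?thesis using sub v0 by (subst summable_on_cong_neutral[where T="?q ` F" and g="\<lambda>Q. norm (v Q)"]) auto
  qed
  ultimately show ?thesis unfolding sparse_operator_def sum by blast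
qed

section \<open>Convex body averages\<close>

abbreviation scaled_body :: "real \<Rightarrow> (real^'n \<Rightarrow> real^'d) \<Rightarrow> (real^'n) set \<Rightarrow> (real^'d) set" where
  "scaled_body c f Q \<equiv> (\<lambda>w. c *\<^sub>R w) ` convex_body_average f Q"

context
  fixes f :: "real^'n \<Rightarrow> real^'d" and Q :: "(real^'n) set"
  assumes f: "integrable lebesgue f" and Q: "Q \<in> sets lebesgue"
begin

lemma convex_body_multiplier_integrable:
  fixes \<phi> :: "real^'n \<Rightarrow> real"
  assumes m: "\<phi> \<in> borel_measurable (lebesgue_on Q)" and b: "AE x in lebesgue_on Q. \<bar>\<phi> x\<bar> \<le> 1"
  shows "integrable lebesgue (\<lambda>x. indicat_real Q x *\<^sub>R \<phi> x *\<^sub>R f x)"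
proof (rule Bochner_Integration.integrable_bound[OF f])
  have Qs: "Q \<inter> space lebesgue \<in> sets lebesgue" using Q by simp
  have "(\<lambda>x. indicat_real Q x *\<^sub>R \<phi> x) \<in> borel_measurable lebesgue"
    using m borel_measurable_restrict_space_iff[OF Qs, of \<phi>] by simp
  then have "(\<lambda>x. (indicat_real Q x *\<^sub>R \<phi> x) *\<^sub>R f x) \<in> borel_measurable lebesgue"
    using borel_measurable_integrable[OF f] by (rule borel_measurable_scaleR)
  then show "(\<lambda>x. indicat_real Q x *\<^sub>R \<phi> x *\<^sub>R f x) \<in> borel_measurable lebesgue" by simp
  have "AE x in lebesgue. x \<in> Q \<longrightarrow> \<bar>\<phi> x\<bar> \<le> 1"
    using b AE_restrict_space_iff[OF Qs, of "\<lambda>x. \<bar>\<phi> x\<bar> \<le> 1"] by simp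
  then show "AE x in lebesgue. norm (indicat_real Q x *\<^sub>R \<phi> x *\<^sub>R f x) \<le> norm (f x)"
  proof eventually_elim
    case (elim x)
    then show ?case
      by (cases "x \<in> Q") (auto intro: mult_left_le_one_le)
  qed
qed

lemma convex_body_averageE:
  assumes "v \<in> convex_body_average f Q"
  obtains \<phi> where "\<phi> \<in> borel_measurable (lebesgue_on Q)" "AE x in lebesgue_on Q. \<bar>\<phi> x\<bar> \<le> 1"
    "v = average (\<lambda>x. \<phi> x *\<^sub>R f x) Q"
  using assms unfolding convex_body_average_def by (elim CollectE exE conjE) (rule that)

lemma zero_in_convex_body: "0 \<in> convex_body_average f Q"
  unfolding convex_body_average_def
  by (intro CollectI exI[of _ "\<lambda>x. 0"]) (simp add: average_def set_lebesgue_integral_def)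

text \<open>All operators in question produce averages of \<open>f\<close> against a bounded kernel; this is how such an average
enters a multiple of the convex body.\<close>

lemma average_in_convex_body:
  fixes h :: "real^'n \<Rightarrow> real"
  assumes h: "h \<in> borel_measurable lebesgue" and b: "\<And>y. y \<in> Q \<Longrightarrow> \<bar>h y\<bar> \<le> c" and c: "0 < c"
  shows "average (\<lambda>y. h y *\<^sub>R f y) Q \<in> scaled_body c f Q"
proof (rule image_eqI)
  have "(\<lambda>y. h y / c) \<in> borel_measurable lebesgue" using h by (intro borel_measurable_divide) auto
  then have "(\<lambda>y. h y / c) \<in> borel_measurable (lebesgue_on Q)" by (rule measurable_restrict_space1)
  moreover have "AE x in lebesgue_on Q. \<bar>h x / c\<bar> \<le> 1"
    using b c Q by (intro AE_I2) (auto simp: space_restrict_space divide_le_eq)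
  ultimately show "average (\<lambda>y. (h y / c) *\<^sub>R f y) Q \<in> convex_body_average f Q"
    unfolding convex_body_average_def by (intro CollectI exI conjI) (rule refl)
  have "(\<lambda>y. indicat_real Q y *\<^sub>R h y *\<^sub>R f y) = (\<lambda>y. c *\<^sub>R (indicat_real Q y *\<^sub>R (h y / c) *\<^sub>R f y))"
    using c by auto
  then show "average (\<lambda>y. h y *\<^sub>R f y) Q = c *\<^sub>R average (\<lambda>y. (h y / c) *\<^sub>R f y) Q"
    unfolding average_def set_lebesgue_integral_def by (simp only: integral_scaleR_right scaleR_left_commute)
qed

lemma convex_body_combination:
  fixes e :: "'i \<Rightarrow> real^'d"
  assumes fin: "finite I" and e: "\<And>i. i \<in> I \<Longrightarrow> e i \<in> convex_body_average f Q" and a: "(\<Sum>i\<in>I. \<bar>a i\<bar>) \<le> 1"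
  shows "(\<Sum>i\<in>I. a i *\<^sub>R e i) \<in> convex_body_average f Q"
proof -
  let ?P = "\<lambda>i \<phi>. \<phi> \<in> borel_measurable (lebesgue_on Q) \<and> (AE x in lebesgue_on Q. \<bar>\<phi> x\<bar> \<le> 1)
      \<and> e i = average (\<lambda>x. \<phi> x *\<^sub>R f x) Q"
  have "\<forall>i\<in>I. \<exists>\<phi>. ?P i \<phi>"
  proof
    fix i assume "i \<in> I"
    then have "e i \<in> convex_body_average f Q" by (rule e)
    then show "\<exists>\<phi>. ?P i \<phi>" by (rule convex_body_averageE) iprover
  qed
  then obtain \<phi> where P: "\<forall>i\<in>I. ?P i (\<phi> i)" using bchoice[of I ?P] by iprover
  then have \<phi>: "\<phi> i \<in> borel_measurable (lebesgue_on Q)" "AE x in lebesgue_on Q. \<bar>\<phi> i x\<bar> \<le> 1"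
      "e i = average (\<lambda>x. \<phi> i x *\<^sub>R f x) Q" if "i \<in> I" for i
    using that by simp_all
  define \<psi> where "\<psi> x = (\<Sum>i\<in>I. a i * \<phi> i x)" for x
  have "\<psi> \<in> borel_measurable (lebesgue_on Q)"
    unfolding \<psi>_def using \<phi>(1) by (intro borel_measurable_sum borel_measurable_times) auto
  moreover have "AE x in lebesgue_on Q. \<bar>\<psi> x\<bar> \<le> 1"
  proof -
    have "AE x in lebesgue_on Q. \<forall>i\<in>I. \<bar>\<phi> i x\<bar> \<le> 1" using \<phi>(2) by (intro AE_finite_allI fin)
    then show ?thesis
    proof eventually_elim
      case (elim x)
      have "\<bar>\<psi> x\<bar> \<le> (\<Sum>i\<in>I. \<bar>a i * \<phi> i x\<bar>)" unfolding \<psi>_def by (rule sum_abs)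
      also have "\<dots> \<le> (\<Sum>i\<in>I. \<bar>a i\<bar>)" using elim by (intro sum_mono) (auto simp: abs_mult intro: mult_left_le)
      finally show ?case using a by linarith
    qed
  qed
  moreover have "(\<Sum>i\<in>I. a i *\<^sub>R e i) = average (\<lambda>x. \<psi> x *\<^sub>R f x) Q"
  proof -
    have int: "integrable lebesgue (\<lambda>x. indicat_real Q x *\<^sub>R \<phi> i x *\<^sub>R f x)" if "i \<in> I" for i
      using \<phi>(1,2)[OF that] by (rule convex_body_multiplier_integrable)
    have eq: "(\<lambda>x. indicat_real Q x *\<^sub>R \<psi> x *\<^sub>R f x) = (\<lambda>x. \<Sum>i\<in>I. a i *\<^sub>R (indicat_real Q x *\<^sub>R \<phi> i x *\<^sub>R f x))"
      unfolding \<psi>_def by (simp add: scaleR_sum_left scaleR_sum_right mult_ac)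
    have "average (\<lambda>x. \<psi> x *\<^sub>R f x) Q = (\<Sum>i\<in>I. a i *\<^sub>R (LINT x|lebesgue. indicat_real Q x *\<^sub>R \<phi> i x *\<^sub>R f x)) /\<^sub>R measure lebesgue Q"
      unfolding average_def set_lebesgue_integral_def eq using int
      by (subst Bochner_Integration.integral_sum) (auto intro!: integrable_scaleR_right simp del: scaleR_scaleR)
    also have "\<dots> = (\<Sum>i\<in>I. a i *\<^sub>R e i)"
      unfolding scaleR_sum_right using \<phi>(3)
      by (intro sum.cong) (auto simp: average_def set_lebesgue_integral_def)
    finally show ?thesis by simp
  qed
  ultimately show ?thesis unfolding convex_body_average_def by (intro CollectI exI conjI)
qed

lemma scaled_body_add:
  assumes "v \<in> scaled_body a f Q" "w \<in> scaled_body b f Q" "0 \<le> a" "0 \<le> b"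
  shows "v + w \<in> scaled_body (a + b) f Q"
proof (cases "a + b = 0")
  case True
  then have ab: "a = 0" "b = 0" using assms(3,4) by auto
  then have "v + w = 0" using assms(1,2) by auto
  then show ?thesis using zero_in_convex_body ab by (intro image_eqI[where x=0]) auto
next
  case False
  then have ab: "a + b > 0" using assms by simp
  obtain v' w' where v': "v' \<in> convex_body_average f Q" "v = a *\<^sub>R v'" and w': "w' \<in> convex_body_average f Q" "w = b *\<^sub>R w'"
    using assms by blast
  let ?e = "\<lambda>i. if i then v' else w'" and ?a = "\<lambda>i. if i then a / (a + b) else b / (a + b)"
  have "(\<Sum>i\<in>UNIV. \<bar>?a i\<bar>) \<le> 1" using assms(3,4) ab by (simp add: UNIV_bool add_divide_distrib[symmetric])
  then have "(\<Sum>i\<in>UNIV. ?a i *\<^sub>R ?e i) \<in> convex_body_average f Q"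
    using v' w' by (intro convex_body_combination) auto
  moreover have "v + w = (a + b) *\<^sub>R (\<Sum>i\<in>UNIV. ?a i *\<^sub>R ?e i)"
    using ab v' w' by (simp add: UNIV_bool scaleR_add_right)
  ultimately show ?thesis by (rule image_eqI[rotated])
qed

lemma scaled_body_mono:
  assumes "v \<in> scaled_body a f Q" "0 \<le> a" "a \<le> b"
  shows "v \<in> scaled_body b f Q"
proof -
  have "0 \<in> scaled_body (b - a) f Q"
    using zero_in_convex_body by (intro image_eqI[where x=0]) auto
  then show ?thesis using scaled_body_add[OF assms(1), of 0 "b - a"] assms by simp
qed

lemma convex_body_bounded: "bounded (convex_body_average f Q)"
proof -
  have "norm v \<le> inverse (measure lebesgue Q) * (LINT x|lebesgue. norm (f x))" if v: "v \<in> convex_body_average f Q" for v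
  proof -
    obtain \<phi> where \<phi>: "\<phi> \<in> borel_measurable (lebesgue_on Q)" "AE x in lebesgue_on Q. \<bar>\<phi> x\<bar> \<le> 1"
        "v = average (\<lambda>x. \<phi> x *\<^sub>R f x) Q"
      using v by (rule convex_body_averageE)
    have Qs: "Q \<inter> space lebesgue \<in> sets lebesgue" using Q by simp
    have ae: "AE x in lebesgue. x \<in> Q \<longrightarrow> \<bar>\<phi> x\<bar> \<le> 1"
      using \<phi>(2) AE_restrict_space_iff[OF Qs, of "\<lambda>x. \<bar>\<phi> x\<bar> \<le> 1"] by simp
    have i: "integrable lebesgue (\<lambda>x. indicat_real Q x *\<^sub>R \<phi> x *\<^sub>R f x)"
      by (rule convex_body_multiplier_integrable[OF \<phi>(1,2)])
    have "norm (LINT x|lebesgue. indicat_real Q x *\<^sub>R \<phi> x *\<^sub>R f x) \<le> (LINT x|lebesgue. norm (indicat_real Q x *\<^sub>R \<phi> x *\<^sub>R f x))"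
      by (rule integral_norm_bound)
    also have "\<dots> \<le> (LINT x|lebesgue. norm (f x))"
    proof (rule integral_mono_AE)
      show "integrable lebesgue (\<lambda>x. norm (indicat_real Q x *\<^sub>R \<phi> x *\<^sub>R f x))" using i by (rule integrable_norm)
      show "integrable lebesgue (\<lambda>x. norm (f x))" using f by (rule integrable_norm)
      show "AE x in lebesgue. norm (indicat_real Q x *\<^sub>R \<phi> x *\<^sub>R f x) \<le> norm (f x)"
        using ae
      proof eventually_elim
        case (elim x)
        then show ?case by (cases "x \<in> Q") (auto intro: mult_left_le_one_le)
      qed
    qed
    finally show ?thesis
      unfolding \<phi>(3) average_def set_lebesgue_integral_def by (simp add: mult_left_mono)
  qed
  then show ?thesis unfolding bounded_iff by blast
qed

text \<open>Use the multiplier \<open>sgn (l \<circ> f)\<close>.\<close>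

lemma average_functional_le:
  fixes l :: "real^'d \<Rightarrow> real"
  assumes l: "bounded_linear l" and c: "\<And>v. v \<in> convex_body_average f Q \<Longrightarrow> \<bar>l v\<bar> \<le> c"
  shows "average (\<lambda>y. \<bar>l (f y)\<bar>) Q \<le> c"
proof -
  define h where "h y = sgn (l (f y))" for y
  have lf: "integrable lebesgue (\<lambda>y. l (f y))" by (rule integrable_bounded_linear[OF l f])
  have hm: "h \<in> borel_measurable lebesgue"
    unfolding h_def sgn_if using borel_measurable_integrable[OF lf] by measurable
  then have hm': "h \<in> borel_measurable (lebesgue_on Q)" by (rule measurable_restrict_space1)
  have hb: "AE x in lebesgue_on Q. \<bar>h x\<bar> \<le> 1" by (intro AE_I2) (simp add: h_def abs_sgn_eq)
  define v where "v = average (\<lambda>y. h y *\<^sub>R f y) Q"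
  have v: "v \<in> convex_body_average f Q"
    unfolding v_def convex_body_average_def using hm' hb by (intro CollectI exI conjI) (rule refl)
  have i: "integrable lebesgue (\<lambda>x. indicat_real Q x *\<^sub>R h x *\<^sub>R f x)"
    by (rule convex_body_multiplier_integrable[OF hm' hb])
  have ls: "l (a *\<^sub>R w) = a * l w" for a w using linear_scale[OF bounded_linear.linear[OF l], of a w] by simp
  have "l v = inverse (measure lebesgue Q) * (LINT x|lebesgue. l (indicat_real Q x *\<^sub>R h x *\<^sub>R f x))"
    unfolding v_def average_def set_lebesgue_integral_def integral_bounded_linear[OF l i] by (rule ls)
  also have "\<dots> = average (\<lambda>y. \<bar>l (f y)\<bar>) Q"
  proof -
    have "l (indicat_real Q x *\<^sub>R h x *\<^sub>R f x) = indicat_real Q x * \<bar>l (f x)\<bar>" for x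
      unfolding ls h_def by (simp add: sgn_mult_abs[symmetric] abs_sgn mult.commute)
    then show ?thesis unfolding average_def set_lebesgue_integral_def by simp
  qed
  finally show ?thesis using c[OF v] by linarith
qed

text \<open>The index runs up to \<open>d\<close> for every cube: if the convex body spans a smaller space, the remaining
functionals are 0. The coordinates reduce membership in a multiple of the body to \<open>d\<close> scalar inequalities
within its span, a condition that is preserved by limits.\<close>

theorem convex_body_coordinates:
  shows "\<exists>l :: nat \<Rightarrow> real^'d \<Rightarrow> real. (\<forall>i. bounded_linear (l i)) \<and>
    (\<forall>i. average (\<lambda>y. \<bar>l i (f y)\<bar>) Q \<le> basis_const CARD('d)) \<and>
    (\<forall>i. \<forall>v\<in>convex_body_average f Q. \<bar>l i v\<bar> \<le> basis_const CARD('d)) \<and>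
    (\<forall>v\<in>span (convex_body_average f Q). \<forall>c>0. (\<forall>i<CARD('d). \<bar>l i v\<bar> \<le> c) \<longrightarrow>
      v \<in> scaled_body (real CARD('d) * c) f Q)"
proof -
  let ?K = "convex_body_average f Q"
  obtain m where m: "dim ?K = m" by blast
  have md: "m \<le> CARD('d)" using dim_subset_UNIV[of ?K] m by simp
  obtain e l where el: "\<forall>i<m. e i \<in> ?K" "\<forall>i<m. linear (l i)" "\<forall>i<m. \<forall>v\<in>?K. \<bar>l i v\<bar> \<le> basis_const m"
      "\<forall>v\<in>span ?K. v = (\<Sum>i<m. l i v *\<^sub>R e i)"
    using almost_auerbach_basis[OF convex_body_bounded m] by blast
  define l' where "l' i = (if i < m then l i else (\<lambda>_. 0))" for i
  have "bounded_linear (l' i)" for i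
    unfolding l'_def using el(2) linear_conv_bounded_linear by auto
  moreover have lK: "\<bar>l' i v\<bar> \<le> basis_const CARD('d)" if "v \<in> ?K" for i v
    using that el(3) basis_const_mono[OF md] basis_const_ge_1[of "CARD('d)"] unfolding l'_def by fastforce
  moreover have "average (\<lambda>y. \<bar>l' i (f y)\<bar>) Q \<le> basis_const CARD('d)" for i
    using \<open>\<And>i. bounded_linear (l' i)\<close> lK by (rule average_functional_le)
  moreover have "v \<in> (\<lambda>w. (real CARD('d) * c) *\<^sub>R w) ` ?K"
    if v: "v \<in> span ?K" and c: "0 < c" and b: "\<forall>i<CARD('d). \<bar>l' i v\<bar> \<le> c" for v c
  proof (rule image_eqI)
    have d: "real CARD('d) * c > 0" using c by simp
    show "(\<Sum>i<m. (l i v / (real CARD('d) * c)) *\<^sub>R e i) \<in> ?K"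
    proof (rule convex_body_combination)
      have "(\<Sum>i<m. \<bar>l i v / (real CARD('d) * c)\<bar>) \<le> (\<Sum>i<m. 1 / real CARD('d))"
      proof (rule sum_mono)
        fix i assume "i \<in> {..<m}"
        then have "\<bar>l i v\<bar> \<le> c" using b[rule_format, of i] md unfolding l'_def by auto
        then show "\<bar>l i v / (real CARD('d) * c)\<bar> \<le> 1 / real CARD('d)"
          using c by (simp add: abs_divide abs_mult divide_simps)
      qed
      also have "\<dots> \<le> 1" using md by (simp add: divide_simps)
      finally show "(\<Sum>i<m. \<bar>l i v / (real CARD('d) * c)\<bar>) \<le> 1" .
    qed (use el(1) in auto)
    have "v = (\<Sum>i<m. l i v *\<^sub>R e i)" using el(4) v by blast
    also have "\<dots> = (real CARD('d) * c) *\<^sub>R (\<Sum>i<m. (l i v / (real CARD('d) * c)) *\<^sub>R e i)"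
      unfolding scaleR_sum_right using d by (intro sum.cong) auto
    finally show "v = (real CARD('d) * c) *\<^sub>R (\<Sum>i<m. (l i v / (real CARD('d) * c)) *\<^sub>R e i)" .
  qed
  ultimately show ?thesis by blast
qed

end

section \<open>Cubes around the centre of the lattice\<close>

text \<open>The cubes with index entries 0 and -1 are those that touch the translation vector \<open>t\<close>. There are \<open>2\<^sup>N\<close> of them
in each generation, one in each quadrant, and the ancestors of a central cube are central with the same index.\<close>

definition central :: "real^'n \<Rightarrow> int \<Rightarrow> real^'n \<Rightarrow> bool" where
  "central t j x \<longleftrightarrow> (\<forall>i. dyadic_index t j x $ i \<in> {0, -1})"

lemma central_coarser:
  assumes "central t j x" "j' \<le> j"
  shows "central t j' x" "dyadic_index t j' x = dyadic_index t j x"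
proof -
  obtain s where s: "j' = j - int s" using assms(2) zle_iff_zadd[of j' j] by auto
  have "dyadic_index t j' x $ i = dyadic_index t j x $ i" for i
    using assms(1)[unfolded central_def, rule_format, of i] unfolding s dyadic_index_div
    by (auto simp: minus_1_div_exp_eq_int)
  then show "dyadic_index t j' x = dyadic_index t j x" by (simp add: vec_eq_iff)
  then show "central t j' x" using assms(1) by (simp add: central_def)
qed

lemma central_cong: "y \<in> cube_at t j x \<Longrightarrow> central t j y \<longleftrightarrow> central t j x"
  by (simp add: central_def mem_cube_at)

lemma bounded_central:
  fixes t :: "real^'n"
  assumes "bounded A"
  shows "\<exists>j0. \<forall>j\<le>j0. \<forall>x\<in>A. central t j x"
proof -
  obtain b where b: "\<And>x. x \<in> A \<Longrightarrow> norm x \<le> b" using assms by (auto simp: bounded_iff)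
  obtain n where n: "b + norm t < 2 ^ n" using real_arch_pow[of 2 "b + norm t"] by auto
  have "central t (- int n) x" if x: "x \<in> A" for x
  proof -
    have "\<lfloor>(x $ i - t $ i) * 2 powi (- int n)\<rfloor> \<in> {0, -1}" for i
    proof -
      have "\<bar>(x - t) $ i\<bar> \<le> norm (x - t)" by (rule component_le_norm_cart)
      also have "\<dots> < 2 ^ n" using norm_triangle_ineq4[of x t] b[OF x] n by linarith
      finally have lt: "\<bar>x $ i - t $ i\<bar> < 2 ^ n" by simp
      have pos: "(2::real) ^ n > 0" by simp
      have "-1 < (x $ i - t $ i) / 2 ^ n" "(x $ i - t $ i) / 2 ^ n < 1"
        using lt pos by (simp_all add: less_divide_eq divide_less_eq abs_less_iff)
      then have "\<lfloor>(x $ i - t $ i) / 2 ^ n\<rfloor> \<in> {0, -1}" by (simp add: floor_eq_iff) linarith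
      then show ?thesis by (simp add: power_int_minus divide_inverse)
    qed
    then show ?thesis by (simp add: central_def dyadic_index_def)
  qed
  then show ?thesis using central_coarser(1) by blast
qed

lemma ex_central: "\<exists>j. central t j x"
  using bounded_central[of "{x}" t] by auto

section \<open>Coordinates in the convex body of a cube\<close>

text \<open>One choice of the functionals of \<open>convex_body_coordinates\<close> for each cube, so that the stopping rule
can refer to them.\<close>

definition body_coords :: "(real^'n \<Rightarrow> real^'d) \<Rightarrow> (real^'n) set \<Rightarrow> nat \<Rightarrow> real^'d \<Rightarrow> real" where
  "body_coords f Q = (SOME l. (\<forall>i. bounded_linear (l i)) \<and>
    (\<forall>i. average (\<lambda>y. \<bar>l i (f y)\<bar>) Q \<le> basis_const CARD('d)) \<and>
    (\<forall>i. \<forall>v\<in>convex_body_average f Q. \<bar>l i v\<bar> \<le> basis_const CARD('d)) \<and>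
    (\<forall>v\<in>span (convex_body_average f Q). \<forall>c>0. (\<forall>i<CARD('d). \<bar>l i v\<bar> \<le> c) \<longrightarrow>
      v \<in> scaled_body (real CARD('d) * c) f Q))"

lemma body_coords:
  fixes f :: "real^'n \<Rightarrow> real^'d"
  assumes "integrable lebesgue f" "Q \<in> sets lebesgue"
  shows "bounded_linear (body_coords f Q i)"
    "average (\<lambda>y. \<bar>body_coords f Q i (f y)\<bar>) Q \<le> basis_const CARD('d)"
    "v \<in> convex_body_average f Q \<Longrightarrow> \<bar>body_coords f Q i v\<bar> \<le> basis_const CARD('d)"
    "v \<in> span (convex_body_average f Q) \<Longrightarrow> 0 < c \<Longrightarrow> (\<And>i. i < CARD('d) \<Longrightarrow> \<bar>body_coords f Q i v\<bar> \<le> c) \<Longrightarrow>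
      v \<in> scaled_body (real CARD('d) * c) f Q"
  using someI_ex[OF convex_body_coordinates[OF assms], folded body_coords_def] by blast+

lemma scaled_body_subset_span: "(\<lambda>w. c *\<^sub>R w) ` K \<subseteq> span K"
  by (auto intro: span_scale span_base)

text \<open>Passing to the limit in the coordinates costs only a constant factor.\<close>

lemma scaled_body_limit:
  fixes f :: "real^'n \<Rightarrow> real^'d"
  assumes f: "integrable lebesgue f" and Q: "Q \<in> sets lebesgue" and c: "0 < c"
    and u: "\<forall>\<^sub>F n in sequentially. u n \<in> scaled_body c f Q" and lim: "u \<longlonglongrightarrow> v"
  shows "v \<in> scaled_body (real CARD('d) * (c * basis_const CARD('d))) f Q"
proof (rule body_coords(4)[OF f Q])
  let ?B = "basis_const CARD('d)"
  have "\<forall>\<^sub>F n in sequentially. u n \<in> span (convex_body_average f Q)"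
    by (rule eventually_mono[OF u]) (use scaled_body_subset_span in blast)
  then show "v \<in> span (convex_body_average f Q)"
    using closed_subspace[OF subspace_span] lim by (intro Lim_in_closed_set) auto
  show "0 < c * ?B" using c basis_const_ge_1[of "CARD('d)"] by simp
  fix i
  have bl: "bounded_linear (body_coords f Q i)" by (rule body_coords(1)[OF f Q])
  have "(\<lambda>n. \<bar>body_coords f Q i (u n)\<bar>) \<longlonglongrightarrow> \<bar>body_coords f Q i v\<bar>"
    by (intro tendsto_rabs bounded_linear.tendsto[OF bl] lim)
  moreover have "\<forall>\<^sub>F n in sequentially. \<bar>body_coords f Q i (u n)\<bar> \<le> c * ?B"
    using u
  proof eventually_elim
    case (elim n)
    then obtain w where w: "w \<in> convex_body_average f Q" "u n = c *\<^sub>R w" by blast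
    have "body_coords f Q i (u n) = c * body_coords f Q i w"
      unfolding w(2) using linear_scale[OF bounded_linear.linear[OF bl], of c w] by simp
    then show ?case using body_coords(3)[OF f Q w(1), of i] c by (simp add: abs_mult)
  qed
  ultimately show "\<bar>body_coords f Q i v\<bar> \<le> c * ?B"
    by (rule tendsto_upperbound) simp
qed

section \<open>Partial sums in convex bodies\<close>

context dyadic_shift
begin

lemma part_cong_cube:
  assumes "y \<in> cube_at t (gam n) x"
  shows "part m n f y = part m n f x"
  unfolding part_def
proof (rule sum.cong)
  fix j assume "j \<in> {m..<n}"
  then have "gam (j + 1) \<le> gam n" by (intro gam_le) auto
  then have "y \<in> cube_at t (gam (j + 1)) x" using assms cube_at_antimono by blast
  then show "block j f y = block j f x" by (rule block_const)
qed simp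

lemma part_localize:
  fixes f :: "real^'n \<Rightarrow> real"
  assumes y: "y \<in> cube_at t (gam m) x"
  shows "part m n f y = part m n (\<lambda>z. indicator (cube_at t (gam m) x) z * f z) y"
  unfolding part_def
proof (rule sum.cong)
  fix j assume "j \<in> {m..<n}"
  then have le: "gam m \<le> gam j" by (intro gam_le) auto
  have "kap j y z * f z = kap j y z * (indicator (cube_at t (gam m) x) z * f z)" for z
  proof (cases "kap j y z = 0")
    case False
    then have "z \<in> cube_at t (gam m) y" using kap_support cube_at_antimono[OF le] by blast
    then have "z \<in> cube_at t (gam m) x" using cube_at_eq[OF y] by simp
    then show ?thesis by simp
  qed simp
  then have "(\<lambda>z. kap j y z * f z) = (\<lambda>z. kap j y z * (indicator (cube_at t (gam m) x) z * f z))" by (rule ext)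
  then show "block j f y = block j (\<lambda>z. indicator (cube_at t (gam m) x) z * f z) y"
    by (simp only: block_def real_scaleR_def)
qed simp

text \<open>The functionals give coordinates only in the span of the convex body, so the partial sums have to be
located there first.\<close>

lemma block_in_span:
  fixes f :: "real^'n \<Rightarrow> real^'d"
  assumes f: "integrable lebesgue f" and "m \<le> j"
  shows "block j f x \<in> span (convex_body_average f (cube_at t (gam m) x))"
proof -
  let ?Q = "cube_at t (gam m) x"
  let ?c = "measure lebesgue ?Q * (A / measure lebesgue (cube_at t (gam j) x))"
  have mpos: "measure lebesgue ?Q > 0" by (rule measure_cube_at_pos)
  have "block j f x = average (\<lambda>y. (measure lebesgue ?Q * kap j x y) *\<^sub>R f y) ?Q"
  proof -
    have "indicat_real ?Q y *\<^sub>R (measure lebesgue ?Q * kap j x y) *\<^sub>R f y = measure lebesgue ?Q *\<^sub>R (kap j x y *\<^sub>R f y)" for y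
    proof (cases "kap j x y = 0")
      case False
      then have "y \<in> ?Q" using kap_support cube_at_antimono[OF gam_le[OF assms(2)]] by blast
      then show ?thesis by simp
    qed simp
    then have "(\<lambda>y. indicat_real ?Q y *\<^sub>R (measure lebesgue ?Q * kap j x y) *\<^sub>R f y) = (\<lambda>y. measure lebesgue ?Q *\<^sub>R (kap j x y *\<^sub>R f y))"
      by (rule ext)
    then have "average (\<lambda>y. (measure lebesgue ?Q * kap j x y) *\<^sub>R f y) ?Q = (measure lebesgue ?Q *\<^sub>R block j f x) /\<^sub>R measure lebesgue ?Q"
      by (simp only: average_def set_lebesgue_integral_def block_def integral_scaleR_right)
    then show ?thesis using mpos by simp
  qed
  also have "\<dots> \<in> scaled_body ?c f ?Q"
  proof (rule average_in_convex_body[OF f sets_cube_at])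
    show "(\<lambda>y. measure lebesgue ?Q * kap j x y) \<in> borel_measurable lebesgue"
      using kap_measurable by (intro borel_measurable_times) auto
    show "0 < ?c" using mpos measure_cube_at_pos[of t "gam j" x] A_ge_1 by simp
    show "\<bar>measure lebesgue ?Q * kap j x y\<bar> \<le> ?c" for y
      unfolding abs_mult abs_of_pos[OF mpos] using kap_bound mpos by (intro mult_left_mono) auto
  qed
  finally show ?thesis using scaled_body_subset_span by blast
qed

lemma part_in_span:
  fixes f :: "real^'n \<Rightarrow> real^'d"
  assumes "integrable lebesgue f"
  shows "part m n f x \<in> span (convex_body_average f (cube_at t (gam m) x))"
  unfolding part_def by (intro span_sum block_in_span assms) auto

text \<open>The generations \<open>gam j\<close> are distinct integers below \<open>b\<close>, so this is a geometric series.\<close>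

lemma sum_powi_gam_le: 
  assumes "m \<le> n" "\<And>j. m \<le> j \<Longrightarrow> j < n \<Longrightarrow> gam j < b"
  shows "(\<Sum>j\<in>{m..<n}. 2 powi gam j) \<le> (2::real) powi b"
  using assms
proof (induction n arbitrary: b rule: int_ge_induct)
  case base
  then show ?case by simp
next
  case (step i)
  have "{m..<i+1} = insert i {m..<i}" using step.hyps by auto
  then have "(\<Sum>j\<in>{m..<i+1}. 2 powi gam j) = 2 powi gam i + (\<Sum>j\<in>{m..<i}. (2::real) powi gam j)" by simp
  also have "\<dots> \<le> 2 powi gam i + 2 powi gam i"
    using step.IH[of "gam i"] gam_less by simp
  also have "\<dots> = 2 powi (gam i + 1)" by (simp add: power_int_add)
  also have "\<dots> \<le> 2 powi b" using step.prems[of i] step.hyps by (intro power_int_increasing) auto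
  finally show ?case .
qed

text \<open>A block of a large cube that contains \<open>x\<close> sees only the part of \<open>f\<close> in the quadrant of \<open>x\<close>, because \<open>f\<close> is
supported in central cubes. So all these blocks are averages of \<open>f\<close> over one and the same central cube,
against kernels whose sizes form a geometric series.\<close>

lemma ancestor_part:
  fixes f :: "real^'n \<Rightarrow> real^'d"
  assumes f: "integrable lebesgue f" and supp: "AE y in lebesgue. f y \<noteq> 0 \<longrightarrow> central t J0 y"
    and x: "central t j1 x" and j1: "j1 \<le> J0" and b: "\<And>j. j < n \<Longrightarrow> gam j < j1 + int M" and mn: "m \<le> n"
  shows "part m n f x \<in> scaled_body (A * (2 ^ M) ^ CARD('n)) f (cube_at t j1 x)"
proof -
  let ?Q = "cube_at t j1 x"
  let ?N = "CARD('n)"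
  have mpos: "measure lebesgue ?Q > 0" by (rule measure_cube_at_pos)
  define h where "h y = (\<Sum>j\<in>{m..<n}. measure lebesgue ?Q * kap j x y)" for y
  have hm: "h \<in> borel_measurable lebesgue"
    unfolding h_def using kap_measurable by (intro borel_measurable_sum borel_measurable_times) auto
  have hb: "\<bar>h y\<bar> \<le> A * (2 ^ M) ^ ?N" for y
  proof -
    have "\<bar>measure lebesgue ?Q * kap j x y\<bar> \<le> A * (2 ^ M) ^ ?N * 2 powi (gam j - (j1 + int M))" if j: "j < n" for j
    proof -
      have "measure lebesgue ?Q * \<bar>kap j x y\<bar> \<le> measure lebesgue ?Q * (A / measure lebesgue (cube_at t (gam j) x))"
        using kap_bound mpos by (intro mult_left_mono) auto
      also have "\<dots> = A * (2 powi (gam j - j1)) ^ ?N"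
        by (simp add: measure_cube_at power_int_minus power_int_diff field_simps)
      also have "(2::real) powi (gam j - j1) = 2 ^ M * 2 powi (gam j - (j1 + int M))"
        using power_int_add[of "2::real" "int M" "gam j - (j1 + int M)"] by simp
      also have "A * (2 ^ M * 2 powi (gam j - (j1 + int M))) ^ ?N = A * (2 ^ M) ^ ?N * (2 powi (gam j - (j1 + int M))) ^ ?N"
        by (simp add: power_mult_distrib)
      also have "\<dots> \<le> A * (2 ^ M) ^ ?N * (2 powi (gam j - (j1 + int M))) ^ 1"
      proof (intro mult_left_mono power_decreasing)
        show "(2::real) powi (gam j - (j1 + int M)) \<le> 1"
          using power_int_increasing[of "gam j - (j1 + int M)" 0 "2::real"] b[OF j] by simp
      qed (use A_ge_1 in \<open>auto simp: Suc_le_eq\<close>)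
      finally show ?thesis using mpos by (simp add: abs_mult)
    qed
    then have "\<bar>h y\<bar> \<le> (\<Sum>j\<in>{m..<n}. A * (2 ^ M) ^ ?N * 2 powi (gam j - (j1 + int M)))"
      unfolding h_def by (intro order_trans[OF sum_abs] sum_mono) auto
    also have "\<dots> = A * (2 ^ M) ^ ?N * ((\<Sum>j\<in>{m..<n}. 2 powi gam j) / 2 powi (j1 + int M))"
      unfolding sum_divide_distrib sum_distrib_left by (simp add: power_int_diff)
    also have "\<dots> \<le> A * (2 ^ M) ^ ?N * 1"
      using sum_powi_gam_le[OF mn, of "j1 + int M"] b A_ge_1 by (intro mult_left_mono) (auto simp: divide_le_eq)
    finally show ?thesis by simp
  qed
  have ae: "AE y in lebesgue. \<forall>j\<in>{m..<n}. indicat_real ?Q y *\<^sub>R (measure lebesgue ?Q * kap j x y) *\<^sub>R f y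
      = measure lebesgue ?Q *\<^sub>R (kap j x y *\<^sub>R f y)"
    using supp
  proof eventually_elim
    case (elim y)
    show ?case
    proof
      fix j
      show "indicat_real ?Q y *\<^sub>R (measure lebesgue ?Q * kap j x y) *\<^sub>R f y
      = measure lebesgue ?Q *\<^sub>R (kap j x y *\<^sub>R f y)"
      proof (cases "kap j x y = 0 \<or> f y = 0")
        case False
        then have y: "dyadic_index t (gam j) y = dyadic_index t (gam j) x" and cy: "central t J0 y"
          using kap_support[of j x y] elim by (auto simp: mem_cube_at)
        have "dyadic_index t j1 y = dyadic_index t j1 x"
        proof (cases "j1 \<le> gam j")
          case True
          then show ?thesis using y by (rule dyadic_index_coarser)
        next
          case False
          then have "gam j \<le> j1" by simp
          then show ?thesis
            using central_coarser(2)[OF x, of "gam j"] central_coarser[OF cy j1] central_coarser(2)[OF cy, of "gam j"] y j1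
            by simp
        qed
        then have "y \<in> ?Q" by (simp add: mem_cube_at)
        then show ?thesis by simp
      qed auto
    qed
  qed
  have int: "integrable lebesgue (\<lambda>y. indicat_real ?Q y *\<^sub>R (measure lebesgue ?Q * kap j x y) *\<^sub>R f y)" for j
    using integrable_scaleR_right[OF integrable_mult_indicator[OF sets_cube_at block_integrable[OF f, of j x]], of "measure lebesgue ?Q" t j1 x]
    by (simp add: mult.commute mult.left_commute)
  have "measure lebesgue ?Q *\<^sub>R part m n f x = (\<Sum>j\<in>{m..<n}. measure lebesgue ?Q *\<^sub>R (LINT y|lebesgue. kap j x y *\<^sub>R f y))"
    unfolding part_def block_def by (rule scaleR_sum_right)
  also have "\<dots> = (\<Sum>j\<in>{m..<n}. LINT y|lebesgue. indicat_real ?Q y *\<^sub>R (measure lebesgue ?Q * kap j x y) *\<^sub>R f y)"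
  proof (rule sum.cong)
    fix j assume j: "j \<in> {m..<n}"
    have "(LINT y|lebesgue. indicat_real ?Q y *\<^sub>R (measure lebesgue ?Q * kap j x y) *\<^sub>R f y)
        = (LINT y|lebesgue. measure lebesgue ?Q *\<^sub>R (kap j x y *\<^sub>R f y))"
    proof (rule integral_cong_AE)
      show "(\<lambda>y. indicat_real ?Q y *\<^sub>R (measure lebesgue ?Q * kap j x y) *\<^sub>R f y) \<in> borel_measurable lebesgue"
        using int by (rule borel_measurable_integrable)
      show "(\<lambda>y. measure lebesgue ?Q *\<^sub>R (kap j x y *\<^sub>R f y)) \<in> borel_measurable lebesgue"
        using block_integrable[OF f, of j x] by (intro borel_measurable_integrable integrable_scaleR_right)
      show "AE y in lebesgue. indicat_real ?Q y *\<^sub>R (measure lebesgue ?Q * kap j x y) *\<^sub>R f y = measure lebesgue ?Q *\<^sub>R (kap j x y *\<^sub>R f y)"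
        using ae by eventually_elim (use j in blast)
    qed
    then show "measure lebesgue ?Q *\<^sub>R (LINT y|lebesgue. kap j x y *\<^sub>R f y)
        = (LINT y|lebesgue. indicat_real ?Q y *\<^sub>R (measure lebesgue ?Q * kap j x y) *\<^sub>R f y)"
      by (simp only: integral_scaleR_right)
  qed simp
  also have "\<dots> = (LINT y|lebesgue. (\<Sum>j\<in>{m..<n}. indicat_real ?Q y *\<^sub>R (measure lebesgue ?Q * kap j x y) *\<^sub>R f y))"
    using int by (intro Bochner_Integration.integral_sum[symmetric]) auto
  also have "\<dots> = (LINT y|lebesgue. indicat_real ?Q y *\<^sub>R h y *\<^sub>R f y)"
    unfolding h_def by (simp only: scaleR_sum_left scaleR_sum_right)
  finally have "part m n f x = average (\<lambda>y. h y *\<^sub>R f y) ?Q"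
    unfolding average_def set_lebesgue_integral_def using mpos
    by (metis (no_types, lifting) less_numeral_extra(3) scaleR_one scaleR_scaleR left_inverse)
  moreover have "average (\<lambda>y. h y *\<^sub>R f y) ?Q \<in> scaled_body (A * (2 ^ M) ^ ?N) f ?Q"
    using A_ge_1 by (intro average_in_convex_body[OF f sets_cube_at hm hb]) auto
  ultimately show ?thesis by simp
qed

end

section \<open>Stopping cubes of a vector-valued function\<close>

text \<open>The sum of the \<open>d\<close> weak type bounds for the partial sums and for the averages at this height is \<open>\<epsilon> |Q|\<close>.\<close>

definition stop_threshold :: "real \<Rightarrow> nat \<Rightarrow> nat \<Rightarrow> real \<Rightarrow> real" where
  "stop_threshold A N d \<epsilon> = real d * (weak_const A N + 1) * basis_const d / \<epsilon>"

text \<open>The first term bounds the pieces between consecutive stopping cubes, the second the piece after the last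
one, the third the contribution of the large cubes.\<close>

definition domination_const :: "real \<Rightarrow> nat \<Rightarrow> nat \<Rightarrow> real \<Rightarrow> nat \<Rightarrow> real" where
  "domination_const A N d \<epsilon> M =
     real d * ((1 + A) * stop_threshold A N d \<epsilon>) + real d * stop_threshold A N d \<epsilon>
     + real d * (A * (2 ^ M) ^ N * basis_const d)"

context dyadic_shift
begin

text \<open>The stopping rule for a piece that starts at level \<open>m\<close> and has reached level \<open>n\<close> at the point \<open>x\<close>.\<close>

definition bad :: "(real^'n \<Rightarrow> real^'d) \<Rightarrow> real \<Rightarrow> int \<Rightarrow> int \<Rightarrow> real^'n \<Rightarrow> bool" where
  "bad f \<alpha> m n x \<longleftrightarrow> (\<exists>i<CARD('d).
     \<alpha> < \<bar>part m n (\<lambda>y. body_coords f (cube_at t (gam m) x) i (f y)) x\<bar> \<or>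
     \<alpha> < average (\<lambda>y. \<bar>body_coords f (cube_at t (gam m) x) i (f y)\<bar>) (cube_at t (gam n) x))"

text \<open>The last level at which the process, started at level \<open>m0\<close>, has stopped before or at level \<open>m0 + k\<close>. The point
\<open>x\<close> lies in the stopping cubes of exactly those levels that occur as values.\<close>

primrec last_stop :: "(real^'n \<Rightarrow> real^'d) \<Rightarrow> real \<Rightarrow> int \<Rightarrow> nat \<Rightarrow> real^'n \<Rightarrow> int" where
  "last_stop f \<alpha> m0 0 x = m0"
| "last_stop f \<alpha> m0 (Suc k) x =
     (if bad f \<alpha> (last_stop f \<alpha> m0 k x) (m0 + int (Suc k)) x then m0 + int (Suc k) else last_stop f \<alpha> m0 k x)"

text \<open>The first alternative takes every \<open>M\<close>-th ancestor of the central cubes of level \<open>m0\<close>, the second the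
stopping cubes inside the central cubes; \<open>k = 0\<close> gives the central cubes of level \<open>m0\<close> themselves.\<close>

definition selected :: "(real^'n \<Rightarrow> real^'d) \<Rightarrow> real \<Rightarrow> int \<Rightarrow> nat \<Rightarrow> int \<Rightarrow> real^'n \<Rightarrow> bool" where
  "selected f \<alpha> m0 M j x \<longleftrightarrow>
     (\<exists>i::nat. 1 \<le> i \<and> j = gam m0 - int M * int i \<and> central t j x) \<or>
     (\<exists>k. j = gam (m0 + int k) \<and> central t (gam m0) x \<and> last_stop f \<alpha> m0 k x = m0 + int k)"

lemma bad_cong:
  assumes y: "y \<in> cube_at t (gam n) x" and "m \<le> n"
  shows "bad f \<alpha> m n y \<longleftrightarrow> bad f \<alpha> m n x"
proof -
  have "y \<in> cube_at t (gam m) x" using y cube_at_antimono[OF gam_le[OF assms(2)]] by blast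
  then have "cube_at t (gam m) y = cube_at t (gam m) x" by (rule cube_at_eq)
  moreover have "cube_at t (gam n) y = cube_at t (gam n) x" using y by (rule cube_at_eq)
  moreover have "part m n g y = part m n g x" for g :: "real^'n \<Rightarrow> real" by (rule part_cong_cube[OF y])
  ultimately show ?thesis unfolding bad_def by (simp only:)
qed

lemma last_stop_bounds: "m0 \<le> last_stop f \<alpha> m0 k x" "last_stop f \<alpha> m0 k x \<le> m0 + int k"
  by (induction k) auto

lemma last_stop_cong:
  assumes "y \<in> cube_at t (gam (m0 + int k)) x"
  shows "last_stop f \<alpha> m0 k y = last_stop f \<alpha> m0 k x"
  using assms
proof (induction k)
  case (Suc k)
  have "y \<in> cube_at t (gam (m0 + int k)) x"
    using Suc.prems cube_at_antimono[OF gam_le[of "m0 + int k" "m0 + int (Suc k)"]] by auto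
  then have IH: "last_stop f \<alpha> m0 k y = last_stop f \<alpha> m0 k x" by (rule Suc.IH)
  have "bad f \<alpha> (last_stop f \<alpha> m0 k x) (m0 + int (Suc k)) y = bad f \<alpha> (last_stop f \<alpha> m0 k x) (m0 + int (Suc k)) x"
    using last_stop_bounds(2)[of f \<alpha> m0 k x] by (intro bad_cong[OF Suc.prems]) simp
  then show ?case unfolding last_stop.simps IH by (simp only:)
qed simp

lemma last_stop_selected:
  "\<exists>k'\<le>k. last_stop f \<alpha> m0 k x = m0 + int k' \<and> last_stop f \<alpha> m0 k' x = m0 + int k'"
proof (induction k)
  case (Suc k)
  show ?case
  proof (cases "bad f \<alpha> (last_stop f \<alpha> m0 k x) (m0 + int (Suc k)) x")
    case True
    then have "last_stop f \<alpha> m0 (Suc k) x = m0 + int (Suc k)" by simp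
    then show ?thesis by blast
  next
    case False
    then have "last_stop f \<alpha> m0 (Suc k) x = last_stop f \<alpha> m0 k x" by simp
    then show ?thesis using Suc.IH le_SucI by metis
  qed
qed simp

text \<open>A level at which the process did not stop satisfies both stopping inequalities in reverse.\<close>

lemma last_stop_not_bad:
  assumes "last_stop f \<alpha> m0 k x \<noteq> m0 + int k"
  shows "\<not> bad f \<alpha> (last_stop f \<alpha> m0 k x) (m0 + int k) x"
proof (cases k)
  case (Suc k')
  show ?thesis
  proof (cases "bad f \<alpha> (last_stop f \<alpha> m0 k' x) (m0 + int (Suc k')) x")
    case True
    then have "last_stop f \<alpha> m0 k x = m0 + int k" unfolding Suc by simp
    then show ?thesis using assms by blast
  next
    case False
    then have "last_stop f \<alpha> m0 k x = last_stop f \<alpha> m0 k' x" unfolding Suc by simp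
    then show ?thesis using False unfolding Suc by simp
  qed
qed (use assms in simp)

lemma last_stop_stays:
  assumes "last_stop f \<alpha> m0 k x = m" "k \<le> k'" "\<And>i. k < i \<Longrightarrow> i \<le> k' \<Longrightarrow> \<not> bad f \<alpha> m (m0 + int i) x"
  shows "last_stop f \<alpha> m0 k' x = m"
  using assms(2,3)
proof (induction k' rule: dec_induct)
  case base
  then show ?case using assms(1) by simp
next
  case (step i)
  have "last_stop f \<alpha> m0 i x = m" using step.prems by (intro step.IH) auto
  moreover have "\<not> bad f \<alpha> m (m0 + int (Suc i)) x" using step.hyps by (intro step.prems) auto
  ultimately show ?case by simp
qed

lemma stop_threshold_ge:
  assumes "0 < \<epsilon>" "\<epsilon> < 1" "1 \<le> d"
  shows "basis_const d \<le> stop_threshold A N d \<epsilon>" "0 < stop_threshold A N d \<epsilon>"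
proof -
  have w: "1 \<le> weak_const A N + 1" using A_ge_1 by (simp add: weak_const_def)
  have B: "1 \<le> basis_const d" by (rule basis_const_ge_1)
  have "1 * 1 \<le> real d * (weak_const A N + 1)" using assms w by (intro mult_mono) auto
  then have "1 * basis_const d \<le> real d * (weak_const A N + 1) * basis_const d"
    using B by (intro mult_right_mono) auto
  moreover have "basis_const d * \<epsilon> \<le> basis_const d * 1" using assms B by (intro mult_left_mono) auto
  ultimately show "basis_const d \<le> stop_threshold A N d \<epsilon>"
    unfolding stop_threshold_def using assms by (simp add: le_divide_eq)
  then show "0 < stop_threshold A N d \<epsilon>" using B by linarith
qed

text \<open>For levels beyond \<open>m\<close> both quantities in the stopping rule depend only on \<open>f\<close> restricted to \<open>Q\<close>, and the
integral of \<open>|l\<^sub>i \<circ> f|\<close> over \<open>Q\<close> is at most a constant times \<open>|Q|\<close>. So the weak type estimates apply to the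
restrictions.\<close>

lemma emeasure_bad:
  fixes f :: "real^'n \<Rightarrow> real^'d"
  assumes f: "integrable lebesgue f" and eps: "0 < \<epsilon>" "\<epsilon> < 1"
  defines "\<alpha> \<equiv> stop_threshold A CARD('n) CARD('d) \<epsilon>"
  shows "\<exists>B\<in>sets lebesgue. {y \<in> cube_at t (gam m) x. \<exists>n>m. bad f \<alpha> m n y} \<subseteq> B \<and>
    emeasure lebesgue B \<le> ennreal (\<epsilon> * measure lebesgue (cube_at t (gam m) x))"
proof -
  let ?Q = "cube_at t (gam m) x"
  let ?d = "CARD('d)"
  let ?B = "basis_const CARD('d)"
  let ?W = "weak_const A CARD('n)"
  have \<alpha>: "0 < \<alpha>" unfolding \<alpha>_def using stop_threshold_ge(2)[OF eps] by (simp add: Suc_le_eq)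
  have W: "0 \<le> ?W" using A_ge_1 by (simp add: weak_const_def)
  define l where "l = body_coords f ?Q"
  have lf: "integrable lebesgue (\<lambda>y. l i (f y))" for i
    unfolding l_def by (rule integrable_bounded_linear[OF body_coords(1)[OF f sets_cube_at] f])
  define h where "h i y = indicat_real ?Q y * l i (f y)" for i y
  have h: "integrable lebesgue (h i)" for i
    unfolding h_def using integrable_mult_indicator[OF sets_cube_at lf, of t "gam m" x i] by simp
  have h1: "(LINT y|lebesgue. \<bar>h i y\<bar>) \<le> ?B * measure lebesgue ?Q" for i
  proof -
    have "(LINT y|lebesgue. \<bar>h i y\<bar>) = average (\<lambda>y. \<bar>l i (f y)\<bar>) ?Q * measure lebesgue ?Q"
      using measure_cube_at_pos[of t "gam m" x]
      unfolding average_def set_lebesgue_integral_def h_def by (simp add: abs_mult)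
    then show ?thesis using body_coords(2)[OF f sets_cube_at, of t "gam m" x i] unfolding l_def
      by (simp add: mult_right_mono)
  qed
  define U where "U i = {y. \<exists>m n. m \<le> n \<and> \<alpha> < \<bar>part m n (h i) y\<bar>}" for i
  define V where "V i = {y. \<exists>j. True \<and> \<alpha> < average (\<lambda>z. \<bar>h i z\<bar>) (cube_at t j y)}" for i
  have Um: "U i \<in> sets lebesgue" and Vm: "V i \<in> sets lebesgue" for i
    unfolding U_def V_def by (rule sets_part_exceed, rule sets_dyadic_exceed)
  have "emeasure lebesgue (U i) \<le> ennreal (?W * (?B * measure lebesgue ?Q) / \<alpha>)" for i
  proof -
    have "emeasure lebesgue (U i) \<le> ennreal (?W * (LINT y|lebesgue. \<bar>h i y\<bar>) / \<alpha>)"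
      unfolding U_def by (rule weak_type[OF h \<alpha>])
    also have "\<dots> \<le> ennreal (?W * (?B * measure lebesgue ?Q) / \<alpha>)"
      using h1[of i] W \<alpha> by (intro ennreal_leI divide_right_mono mult_left_mono) auto
    finally show ?thesis .
  qed
  moreover have "emeasure lebesgue (V i) \<le> ennreal (?B * measure lebesgue ?Q / \<alpha>)" for i
  proof -
    have "emeasure lebesgue (V i) \<le> ennreal ((LINT y|lebesgue. \<bar>h i y\<bar>) / \<alpha>)"
      unfolding V_def using dyadic_maximal_weak[OF h \<alpha>] by simp
    also have "\<dots> \<le> ennreal (?B * measure lebesgue ?Q / \<alpha>)"
      using h1[of i] \<alpha> by (intro ennreal_leI divide_right_mono) auto
    finally show ?thesis .
  qed
  moreover have B0: "0 \<le> ?B * measure lebesgue ?Q" using basis_const_ge_1[of ?d] by (intro mult_nonneg_nonneg) auto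
  ultimately have UV: "emeasure lebesgue (U i \<union> V i) \<le> ennreal ((?W + 1) * (?B * measure lebesgue ?Q) / \<alpha>)" for i
  proof -
    have "emeasure lebesgue (U i \<union> V i) \<le> emeasure lebesgue (U i) + emeasure lebesgue (V i)"
      by (rule emeasure_subadditive[OF Um Vm])
    also have "\<dots> \<le> ennreal (?W * (?B * measure lebesgue ?Q) / \<alpha>) + ennreal (?B * measure lebesgue ?Q / \<alpha>)"
      by (intro add_mono) fact+
    also have "\<dots> = ennreal (?W * (?B * measure lebesgue ?Q) / \<alpha> + ?B * measure lebesgue ?Q / \<alpha>)"
      using divide_nonneg_pos[OF mult_nonneg_nonneg[OF W B0] \<alpha>] divide_nonneg_pos[OF B0 \<alpha>] by (rule ennreal_plus[symmetric])
    also have "?W * (?B * measure lebesgue ?Q) / \<alpha> + ?B * measure lebesgue ?Q / \<alpha> = (?W + 1) * (?B * measure lebesgue ?Q) / \<alpha>"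
      by (simp add: add_divide_distrib algebra_simps)
    finally show ?thesis .
  qed
  define B where "B = (\<Union>i<?d. U i \<union> V i)"
  have Bm: "B \<in> sets lebesgue" unfolding B_def using Um Vm by (intro sets.finite_UN) auto
  have "emeasure lebesgue B \<le> (\<Sum>i<?d. emeasure lebesgue (U i \<union> V i))"
    unfolding B_def using Um Vm by (intro emeasure_subadditive_finite) auto
  also have "\<dots> \<le> (\<Sum>i<?d. ennreal ((?W + 1) * (?B * measure lebesgue ?Q) / \<alpha>))"
    by (intro sum_mono UV)
  also have "\<dots> = ennreal (real ?d * ((?W + 1) * (?B * measure lebesgue ?Q) / \<alpha>))"
  proof -
    have "0 \<le> ?W + 1" using W by simp
    from divide_nonneg_pos[OF mult_nonneg_nonneg[OF this B0] \<alpha>] show ?thesis by (subst sum_ennreal) simp_all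
  qed
  also have "real ?d * ((?W + 1) * (?B * measure lebesgue ?Q) / \<alpha>) = \<epsilon> * measure lebesgue ?Q"
  proof -
    have eq: "\<alpha> * \<epsilon> = real ?d * (?W + 1) * ?B" unfolding \<alpha>_def stop_threshold_def using eps by simp
    have "real ?d * ((?W + 1) * (?B * measure lebesgue ?Q)) = (\<alpha> * \<epsilon>) * measure lebesgue ?Q"
      unfolding eq by (simp only: mult.assoc)
    also have "\<dots> = \<epsilon> * measure lebesgue ?Q * \<alpha>" by (simp only: mult_ac)
    finally have "real ?d * ((?W + 1) * (?B * measure lebesgue ?Q)) = \<epsilon> * measure lebesgue ?Q * \<alpha>" .
    then show ?thesis using \<alpha> by (simp add: divide_eq_eq)
  qed
  finally have "emeasure lebesgue B \<le> ennreal (\<epsilon> * measure lebesgue ?Q)" .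
  moreover have "{y \<in> ?Q. \<exists>n>m. bad f \<alpha> m n y} \<subseteq> B"
  proof
    fix y assume "y \<in> {y \<in> ?Q. \<exists>n>m. bad f \<alpha> m n y}"
    then obtain n where y: "y \<in> ?Q" and n: "m < n" and bad: "bad f \<alpha> m n y" by blast
    have Qy: "cube_at t (gam m) y = ?Q" using y by (rule cube_at_eq)
    obtain i where i: "i < ?d" and or: "\<alpha> < \<bar>part m n (\<lambda>y. l i (f y)) y\<bar> \<or>
        \<alpha> < average (\<lambda>y. \<bar>l i (f y)\<bar>) (cube_at t (gam n) y)"
      using bad unfolding bad_def Qy l_def by blast
    have "y \<in> U i \<union> V i" using or
    proof
      assume "\<alpha> < \<bar>part m n (\<lambda>y. l i (f y)) y\<bar>"
      then have "\<alpha> < \<bar>part m n (h i) y\<bar>" unfolding h_def using part_localize[OF y, of n "\<lambda>y. l i (f y)"] by simp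
      then show ?thesis unfolding U_def using n by (intro UnI1 CollectI exI[of _ m] exI[of _ n]) simp
    next
      assume a: "\<alpha> < average (\<lambda>y. \<bar>l i (f y)\<bar>) (cube_at t (gam n) y)"
      have "cube_at t (gam n) y \<subseteq> ?Q"
        using cube_at_antimono[OF gam_le[of m n]] n unfolding Qy[symmetric] by simp
      then have "average (\<lambda>y. \<bar>l i (f y)\<bar>) (cube_at t (gam n) y) = average (\<lambda>z. \<bar>h i z\<bar>) (cube_at t (gam n) y)"
        unfolding h_def by (intro average_cong) (auto simp: indicator_def)
      then have "\<alpha> < average (\<lambda>z. \<bar>h i z\<bar>) (cube_at t (gam n) y)" using a by simp
      then show ?thesis unfolding V_def by (intro UnI2 CollectI exI[of _ "gam n"]) simp
    qed
    then show "y \<in> B" unfolding B_def using i by blast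
  qed
  ultimately show ?thesis using Bm by blast
qed

lemma selected_cong:
  assumes y: "y \<in> cube_at t j x"
  shows "selected f \<alpha> m0 M j y \<longleftrightarrow> selected f \<alpha> m0 M j x"
proof -
  have imp: "selected f \<alpha> m0 M j z \<Longrightarrow> selected f \<alpha> m0 M j z'" if zz: "z' \<in> cube_at t j z" for z z'
  proof -
    assume "selected f \<alpha> m0 M j z"
    then consider (anc) i :: nat where "1 \<le> i" "j = gam m0 - int M * int i" "central t j z"
      | (loc) k where "j = gam (m0 + int k)" "central t (gam m0) z" "last_stop f \<alpha> m0 k z = m0 + int k"
      unfolding selected_def by blast
    then show "selected f \<alpha> m0 M j z'"
    proof cases
      case anc
      have "central t j z'" using central_cong[OF zz] anc(3) by simp
      then show ?thesis unfolding selected_def using anc(1,2) by blast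
    next
      case loc
      have z': "z' \<in> cube_at t (gam m0) z"
        using zz cube_at_antimono[OF gam_le[of m0 "m0 + int k"], of t z] unfolding loc(1) by auto
      have "central t (gam m0) z'" using central_cong[OF z'] loc(2) by simp
      moreover have "last_stop f \<alpha> m0 k z' = m0 + int k"
        using last_stop_cong[OF zz[unfolded loc(1)], of f \<alpha>] loc(3) by simp
      ultimately show ?thesis unfolding selected_def using loc(1) by blast
    qed
  qed
  have "x \<in> cube_at t j y" using y by (simp add: mem_cube_at)
  then show ?thesis using imp[OF y] imp by blast
qed

lemma gam_inject: "gam m = gam n \<Longrightarrow> m = n"
  using gam_less[of m n] gam_less[of n m] by (cases m n rule: linorder_cases) auto

text \<open>Below a stopping cube, finer selected cubes lie in the set of \<open>emeasure_bad\<close>. Below an ancestor of generation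
\<open>j\<close>, they lie in a single cube of generation \<open>j + M\<close>.\<close>

lemma emeasure_selected:
  fixes f :: "real^'n \<Rightarrow> real^'d"
  assumes f: "integrable lebesgue f" and eps: "0 < \<epsilon>" "\<epsilon> < 1" and M: "(1/2) ^ M \<le> \<epsilon>"
  defines "\<alpha> \<equiv> stop_threshold A CARD('n) CARD('d) \<epsilon>"
  assumes sel: "selected f \<alpha> m0 M j x"
  shows "emeasure lebesgue {y \<in> cube_at t j x. \<exists>j'>j. selected f \<alpha> m0 M j' y}
    \<le> ennreal (\<epsilon> * measure lebesgue (cube_at t j x))" (is "emeasure lebesgue ?Y \<le> _")
proof -
  from sel consider (anc) i :: nat where "1 \<le> i" "j = gam m0 - int M * int i" "central t j x"
    | (loc) k where "j = gam (m0 + int k)" "central t (gam m0) x" "last_stop f \<alpha> m0 k x = m0 + int k"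
    unfolding selected_def by blast
  then have "\<exists>B\<in>sets lebesgue. ?Y \<subseteq> B \<and> emeasure lebesgue B \<le> ennreal (\<epsilon> * measure lebesgue (cube_at t j x))"
  proof cases
    case anc
    obtain z where z: "dyadic_index t (j + int M) z = dyadic_index t j x" using dyadic_index_surj by blast
    have jM: "j + int M \<le> gam m0"
      using anc(1) mult_left_mono[of 1 "int i" "int M"] unfolding anc(2) by simp
    have "?Y \<subseteq> cube_at t (j + int M) z"
    proof
      fix y assume "y \<in> ?Y"
      then obtain j' where y: "y \<in> cube_at t j x" and j': "j < j'" "selected f \<alpha> m0 M j' y" by blast
      have cy: "central t (j + int M) y"
      proof -
        from j'(2) consider (a) i' :: nat where "j' = gam m0 - int M * int i'" "central t j' y"
          | (l) "central t (gam m0) y" unfolding selected_def by blast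
        then show ?thesis
        proof cases
          case a
          have "int M * int i' < int M * int i" using j'(1) unfolding a(1) anc(2) by simp
          then have "i' < i" by (simp add: mult_less_cancel_left_disj)
          then have "int M * (int i' + 1) \<le> int M * int i" by (intro mult_left_mono) auto
          then have "j + int M \<le> j'" unfolding a(1) anc(2) by (simp add: algebra_simps)
          then show ?thesis by (rule central_coarser(1)[OF a(2)])
        next
          case l
          then show ?thesis using jM by (rule central_coarser(1))
        qed
      qed
      have "dyadic_index t (j + int M) y = dyadic_index t j y"
        using central_coarser(2)[OF cy, of j] by simp
      then show "y \<in> cube_at t (j + int M) z" using y z by (simp add: mem_cube_at)
    qed
    moreover have "emeasure lebesgue (cube_at t (j + int M) z) \<le> ennreal (\<epsilon> * measure lebesgue (cube_at t j x))"
      unfolding emeasure_cube_at measure_cube_at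
    proof (rule ennreal_leI)
      have "((2::real) powi - (j + int M)) ^ CARD('n) = ((1/2) ^ M) ^ CARD('n) * (2 powi - j) ^ CARD('n)"
      proof -
        have "(2::real) powi - (j + int M) = 2 powi (- int M) * 2 powi - j"
          using power_int_add[of "2::real" "- int M" "- j"] by (simp add: add.commute)
        moreover have "(2::real) powi (- int M) = (1/2) ^ M" by (simp add: power_int_minus power_one_over inverse_eq_divide)
        ultimately show ?thesis by (simp only: power_mult_distrib)
      qed
      also have "\<dots> \<le> ((1/2) ^ M) ^ 1 * (2 powi - j) ^ CARD('n)"
        by (intro mult_right_mono power_decreasing) (auto simp: Suc_le_eq power_le_one)
      also have "\<dots> \<le> \<epsilon> * (2 powi - j) ^ CARD('n)"
        using M by (intro mult_right_mono) auto
      finally show "((2::real) powi - (j + int M)) ^ CARD('n) \<le> \<epsilon> * (2 powi - j) ^ CARD('n)" .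
    qed
    ultimately show ?thesis using sets_cube_at by blast
  next
    case loc
    let ?m = "m0 + int k"
    have "?Y \<subseteq> {y \<in> cube_at t (gam ?m) x. \<exists>n>?m. bad f \<alpha> ?m n y}"
    proof
      fix y assume "y \<in> ?Y"
      then obtain j' where y: "y \<in> cube_at t (gam ?m) x" and j': "gam ?m < j'" "selected f \<alpha> m0 M j' y"
        unfolding loc(1) by blast
      have "gam m0 \<le> gam ?m" by (rule gam_le) simp
      then have "\<not> j' = gam m0 - int M * int i" for i :: nat using j'(1) by (smt (verit) mult_nonneg_nonneg of_nat_0_le_iff)
      then obtain k' where k': "j' = gam (m0 + int k')" "last_stop f \<alpha> m0 k' y = m0 + int k'"
        using j'(2) unfolding selected_def by blast
      have kk: "k < k'"
      proof (rule ccontr)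
        assume "\<not> k < k'"
        then have "gam (m0 + int k') \<le> gam ?m" by (intro gam_le) simp
        then show False using j'(1) k'(1) by simp
      qed
      have ly: "last_stop f \<alpha> m0 k y = ?m" using last_stop_cong[OF y, of f \<alpha>] loc(3) by simp
      have "\<exists>i. k < i \<and> i \<le> k' \<and> bad f \<alpha> ?m (m0 + int i) y"
      proof (rule ccontr)
        assume "\<not> ?thesis"
        then have "last_stop f \<alpha> m0 k' y = ?m" using kk by (intro last_stop_stays[OF ly]) auto
        then show False using k'(2) kk by simp
      qed
      then obtain i where "k < i" "bad f \<alpha> ?m (m0 + int i) y" by blast
      then show "y \<in> {y \<in> cube_at t (gam ?m) x. \<exists>n>?m. bad f \<alpha> ?m n y}"
        using y by (intro CollectI conjI exI[of _ "m0 + int i"]) auto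
    qed
    then show ?thesis
      using emeasure_bad[OF f eps, of ?m x, folded \<alpha>_def] unfolding loc(1) by blast
  qed
  then obtain B where B: "B \<in> sets lebesgue" "?Y \<subseteq> B" "emeasure lebesgue B \<le> ennreal (\<epsilon> * measure lebesgue (cube_at t j x))"
    by blast
  have "emeasure lebesgue ?Y \<le> emeasure lebesgue B" by (rule emeasure_mono[OF B(2,1)])
  then show ?thesis using B(3) by (rule order_trans)
qed

end

section \<open>Pointwise domination\<close>

lemma domination_const_parts:
  fixes d :: nat
  assumes A: "1 \<le> A" and \<alpha>: "0 < stop_threshold A N d \<epsilon>"
  shows "0 \<le> real d * ((1 + A) * stop_threshold A N d \<epsilon>)" "0 \<le> real d * stop_threshold A N d \<epsilon>"
    "0 \<le> real d * (A * (2 ^ M) ^ N * basis_const d)"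
    "real d * (A * basis_const d) \<le> real d * (A * (2 ^ M) ^ N * basis_const d)"
proof -
  have B: "0 \<le> basis_const d" using basis_const_ge_1[of d] by simp
  have two: "1 \<le> ((2::real) ^ M) ^ N" by simp
  show "0 \<le> real d * ((1 + A) * stop_threshold A N d \<epsilon>)" "0 \<le> real d * stop_threshold A N d \<epsilon>"
    "0 \<le> real d * (A * (2 ^ M) ^ N * basis_const d)"
    using A \<alpha> B by (auto intro!: mult_nonneg_nonneg)
  have "A * 1 * basis_const d \<le> A * (2 ^ M) ^ N * basis_const d"
    using A B two by (intro mult_right_mono mult_left_mono) auto
  then show "real d * (A * basis_const d) \<le> real d * (A * (2 ^ M) ^ N * basis_const d)"
    by (intro mult_left_mono) auto
qed

lemma scaled_sparse_operator_sum:
  fixes t :: "real^'n" and f :: "real^'n \<Rightarrow> real^'d" and g :: "'i \<Rightarrow> int"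
  assumes f: "integrable lebesgue f"
    and F: "finite F" "inj_on g F" "\<And>i. i \<in> F \<Longrightarrow> Sel (g i) x"
    and w: "\<And>i. i \<in> F \<Longrightarrow> w i \<in> scaled_body c f (cube_at t (g i) x)"
  shows "(\<Sum>i\<in>F. w i) \<in> (\<lambda>w. c *\<^sub>R w) ` sparse_operator {cube_at t j x | j x. Sel j x} f x"
proof -
  have "\<forall>i\<in>F. \<exists>v. v \<in> convex_body_average f (cube_at t (g i) x) \<and> w i = c *\<^sub>R v" using w by blast
  then obtain v where v: "\<forall>i\<in>F. v i \<in> convex_body_average f (cube_at t (g i) x) \<and> w i = c *\<^sub>R v i"
    using bchoice[of F "\<lambda>i v. v \<in> convex_body_average f (cube_at t (g i) x) \<and> w i = c *\<^sub>R v"] by blast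
  have zero: "0 \<in> convex_body_average f Q" for Q
    unfolding convex_body_average_def
    by (intro CollectI exI[of _ "\<lambda>x. 0"]) (simp add: average_def set_lebesgue_integral_def)
  have "(\<Sum>i\<in>F. v i) \<in> sparse_operator {cube_at t j x | j x. Sel j x} f x"
    using v by (intro sparse_operator_finite_sum[where Sel=Sel and g=g, OF F(1,2)] F(3) zero) auto
  moreover have "(\<Sum>i\<in>F. w i) = c *\<^sub>R (\<Sum>i\<in>F. v i)"
    unfolding scaleR_sum_right using v by (intro sum.cong) auto
  ultimately show ?thesis by blast
qed

context dyadic_shift
begin

lemma part_split:
  assumes "m \<le> k" "k \<le> n"
  shows "part m n f x = part m k f x + part k n f x"
proof -
  have "{m..<n} = {m..<k} \<union> {k..<n}" "{m..<k} \<inter> {k..<n} = {}" using assms by auto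
  then show ?thesis unfolding part_def by (simp add: sum.union_disjoint)
qed

text \<open>At the starting level the partial sum is empty and the average is bounded by the choice of the functionals;
later levels have not been stopped.\<close>

lemma last_stop_tail:
  fixes f :: "real^'n \<Rightarrow> real^'d"
  assumes f: "integrable lebesgue f" and eps: "0 < \<epsilon>" "\<epsilon> < 1"
  defines "\<alpha> \<equiv> stop_threshold A CARD('n) CARD('d) \<epsilon>"
  assumes p: "last_stop f \<alpha> m0 k x = p" and i: "i < CARD('d)"
  defines "l \<equiv> body_coords f (cube_at t (gam p) x) i"
  shows "\<bar>l (part p (m0 + int k) f x)\<bar> \<le> \<alpha>" "average (\<lambda>y. \<bar>l (f y)\<bar>) (cube_at t (gam (m0 + int k)) x) \<le> \<alpha>"
proof -
  have thr: "basis_const CARD('d) \<le> \<alpha>" "0 < \<alpha>"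
    unfolding \<alpha>_def using stop_threshold_ge[OF eps] by (simp_all add: Suc_le_eq)
  have bl: "bounded_linear l" unfolding l_def by (rule body_coords(1)[OF f sets_cube_at])
  have pl: "part p n (\<lambda>y. l (f y)) x = l (part p n f x)" for n by (rule part_bounded_linear[OF f bl])
  have "\<bar>l (part p (m0 + int k) f x)\<bar> \<le> \<alpha> \<and> average (\<lambda>y. \<bar>l (f y)\<bar>) (cube_at t (gam (m0 + int k)) x) \<le> \<alpha>"
  proof (cases "p = m0 + int k")
    case True
    have "average (\<lambda>y. \<bar>l (f y)\<bar>) (cube_at t (gam p) x) \<le> \<alpha>"
      using body_coords(2)[OF f sets_cube_at, of t "gam p" x i] thr unfolding l_def by linarith
    moreover have "l 0 = 0" using linear_0[OF bounded_linear.linear[OF bl]] .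
    ultimately show ?thesis unfolding True[symmetric] using thr by (simp add: part_def)
  next
    case False
    then have "\<not> bad f \<alpha> p (m0 + int k) x" using last_stop_not_bad[of f \<alpha> m0 k x] unfolding p by blast
    then have "\<not> (\<alpha> < \<bar>part p (m0 + int k) (\<lambda>y. l (f y)) x\<bar> \<or>
        \<alpha> < average (\<lambda>y. \<bar>l (f y)\<bar>) (cube_at t (gam (m0 + int k)) x))"
      using i unfolding bad_def l_def by blast
    then show ?thesis using pl[of "m0 + int k"] by (simp add: not_less)
  qed
  then show "\<bar>l (part p (m0 + int k) f x)\<bar> \<le> \<alpha>" "average (\<lambda>y. \<bar>l (f y)\<bar>) (cube_at t (gam (m0 + int k)) x) \<le> \<alpha>"
    by blast+
qed

text \<open>The partial sum up to the first stopping level is the last unstopped partial sum plus one block, and the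
block is bounded by the average over its cube, which was not stopped either.\<close>

lemma stop_piece:
  fixes f :: "real^'n \<Rightarrow> real^'d"
  assumes f: "integrable lebesgue f" and eps: "0 < \<epsilon>" "\<epsilon> < 1"
  defines "\<alpha> \<equiv> stop_threshold A CARD('n) CARD('d) \<epsilon>"
  assumes p: "last_stop f \<alpha> m0 k x = p"
  shows "part p (m0 + int k + 1) f x \<in>
    scaled_body (real CARD('d) * ((1 + A) * \<alpha>)) f (cube_at t (gam p) x)"
proof (rule body_coords(4)[OF f sets_cube_at part_in_span[OF f]])
  have \<alpha>0: "0 < \<alpha>" unfolding \<alpha>_def using stop_threshold_ge(2)[OF eps] by (simp add: Suc_le_eq)
  then show "0 < (1 + A) * \<alpha>" using A_ge_1 by simp
  fix i assume i: "i < CARD('d)"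
  let ?n = "m0 + int k"
  let ?l = "body_coords f (cube_at t (gam p) x) i"
  have bl: "bounded_linear ?l" by (rule body_coords(1)[OF f sets_cube_at])
  have lf: "integrable lebesgue (\<lambda>y. ?l (f y))" by (rule integrable_bounded_linear[OF bl f])
  note tail = last_stop_tail[OF f eps, folded \<alpha>_def, OF p i]
  have pn: "p \<le> ?n" using last_stop_bounds(2)[of f \<alpha> m0 k x] p by simp
  have "{?n..<?n + 1} = {?n}" by auto
  then have "part p (?n + 1) f x = part p ?n f x + block ?n f x"
    using part_split[OF pn, of "?n + 1" f x] by (simp add: part_def)
  then have "?l (part p (?n + 1) f x) = ?l (part p ?n f x) + ?l (block ?n f x)"
    using linear_add[OF bounded_linear.linear[OF bl]] by simp
  moreover have "\<bar>?l (block ?n f x)\<bar> \<le> A * \<alpha>"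
  proof -
    have "\<bar>?l (block ?n f x)\<bar> \<le> A * average (\<lambda>y. \<bar>?l (f y)\<bar>) (cube_at t (gam ?n) x)"
      using block_abs_le[OF lf, of ?n x] unfolding block_bounded_linear[OF f bl] .
    also have "\<dots> \<le> A * \<alpha>" using tail(2) A_ge_1 by (intro mult_left_mono) auto
    finally show ?thesis .
  qed
  ultimately show "\<bar>?l (part p (?n + 1) f x)\<bar> \<le> (1 + A) * \<alpha>"
    using tail(1) by (simp add: distrib_right)
qed

lemma stop_chain:
  fixes f :: "real^'n \<Rightarrow> real^'d"
  assumes f: "integrable lebesgue f" and eps: "0 < \<epsilon>" "\<epsilon> < 1"
  defines "\<alpha> \<equiv> stop_threshold A CARD('n) CARD('d) \<epsilon>"
  shows "\<exists>F w. finite F \<and> (\<forall>n\<in>F. n < last_stop f \<alpha> m0 k x \<and> (\<exists>k'. n = m0 + int k' \<and> last_stop f \<alpha> m0 k' x = n) \<and>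
      w n \<in> scaled_body (real CARD('d) * ((1 + A) * \<alpha>)) f (cube_at t (gam n) x)) \<and>
    part m0 (last_stop f \<alpha> m0 k x) f x = (\<Sum>n\<in>F. w n)"
proof (induction k)
  case 0
  show ?case by (intro exI[of _ "{}"]) (simp add: part_def)
next
  case (Suc k)
  let ?p = "last_stop f \<alpha> m0 k x"
  show ?case
  proof (cases "bad f \<alpha> ?p (m0 + int (Suc k)) x")
    case False
    then have "last_stop f \<alpha> m0 (Suc k) x = ?p" by simp
    then show ?thesis using Suc.IH by (simp only:)
  next
    case True
    then have new: "last_stop f \<alpha> m0 (Suc k) x = m0 + int k + 1" by simp
    obtain F w where F: "finite F" "\<And>n. n \<in> F \<Longrightarrow> n < ?p"
        "\<And>n. n \<in> F \<Longrightarrow> \<exists>k'. n = m0 + int k' \<and> last_stop f \<alpha> m0 k' x = n"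
        "\<And>n. n \<in> F \<Longrightarrow> w n \<in> scaled_body (real CARD('d) * ((1 + A) * \<alpha>)) f (cube_at t (gam n) x)"
        "part m0 ?p f x = (\<Sum>n\<in>F. w n)"
      using Suc.IH by blast
    define w' where "w' = w(?p := part ?p (m0 + int k + 1) f x)"
    have pn: "m0 \<le> ?p" "?p \<le> m0 + int k" by (rule last_stop_bounds)+
    have pF: "?p \<notin> F" using F(2) by blast
    have "part m0 (m0 + int k + 1) f x = part m0 ?p f x + part ?p (m0 + int k + 1) f x"
      using pn by (intro part_split) auto
    also have "\<dots> = (\<Sum>n\<in>insert ?p F. w' n)"
    proof -
      have "(\<Sum>n\<in>F. w' n) = (\<Sum>n\<in>F. w n)" using pF by (intro sum.cong) (auto simp: w'_def)
      then show ?thesis using F(1,5) pF by (simp add: w'_def add.commute)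
    qed
    finally have sum: "part m0 (last_stop f \<alpha> m0 (Suc k) x) f x = (\<Sum>n\<in>insert ?p F. w' n)" unfolding new .
    have props: "n < last_stop f \<alpha> m0 (Suc k) x \<and> (\<exists>k'. n = m0 + int k' \<and> last_stop f \<alpha> m0 k' x = n) \<and>
      w' n \<in> scaled_body (real CARD('d) * ((1 + A) * \<alpha>)) f (cube_at t (gam n) x)"
      if n: "n \<in> insert ?p F" for n
    proof (cases "n = ?p")
      case True
      have "w' n = part ?p (m0 + int k + 1) f x" using True by (simp add: w'_def)
      moreover have "part ?p (m0 + int k + 1) f x \<in> scaled_body (real CARD('d) * ((1 + A) * \<alpha>)) f (cube_at t (gam ?p) x)"
        unfolding \<alpha>_def by (rule stop_piece[OF f eps refl])
      moreover have "\<exists>k'. n = m0 + int k' \<and> last_stop f \<alpha> m0 k' x = n"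
        using last_stop_selected[of k f \<alpha> m0 x] True by auto
      ultimately show ?thesis using pn unfolding True new by (simp only:) simp
    next
      case False
      then have nF: "n \<in> F" using n by blast
      have "n < m0 + int k + 1" using F(2)[OF nF] pn by linarith
      moreover have "w' n = w n" using False unfolding w'_def by simp
      ultimately show ?thesis using F(3)[OF nF] F(4)[OF nF] unfolding new by (simp only:)
    qed
    show ?thesis using F(1) sum props by (intro exI[of _ "insert ?p F"] exI[of _ w']) blast
  qed
qed

text \<open>The partial sums split into the blocks of the ancestors, the finitely many pieces between consecutive
stopping levels at \<open>x\<close>, and the piece after the last one. The first and the last piece still depend on the
cut-off. Along a subsequence the first one converges, hence so does the last one, and both limits stay in
multiples of the respective convex bodies.\<close>

lemma domination_central:
  fixes f :: "real^'n \<Rightarrow> real^'d"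
  assumes f: "integrable lebesgue f" and supp: "AE y in lebesgue. f y \<noteq> 0 \<longrightarrow> central t (gam m0) y"
    and eps: "0 < \<epsilon>" "\<epsilon> < 1"
  defines "\<alpha> \<equiv> stop_threshold A CARD('n) CARD('d) \<epsilon>"
  assumes lim: "(\<lambda>n. sym_part n f x) \<longlonglongrightarrow> v"
    and fin: "\<exists>j. \<forall>j'>j. \<not> selected f \<alpha> m0 M j' x"
    and x: "central t (gam m0) x"
  shows "v \<in> (\<lambda>w. domination_const A CARD('n) CARD('d) \<epsilon> M *\<^sub>R w) `
    sparse_operator {cube_at t j x | j x. selected f \<alpha> m0 M j x} f x"
proof -
  let ?d = "real CARD('d)" and ?B = "basis_const CARD('d)" and ?N = "CARD('n)"
  let ?K = "\<lambda>n. convex_body_average f (cube_at t (gam n) x)"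
  have \<alpha>0: "0 < \<alpha>" unfolding \<alpha>_def using stop_threshold_ge(2)[OF eps] by (simp add: Suc_le_eq)
  note parts = domination_const_parts[OF A_ge_1 \<alpha>0[unfolded \<alpha>_def], folded \<alpha>_def]
  obtain j where j: "\<And>j'. j < j' \<Longrightarrow> \<not> selected f \<alpha> m0 M j' x" using fin by blast
  \<comment> \<open>from this step on the generations are beyond every selected cube at \<open>x\<close>\<close>
  define k0 where "k0 = nat (\<bar>m0\<bar> + \<bar>j - gam 0 - m0\<bar> + 1)"
  have gam_big: "j < gam (m0 + int k)" if "k0 \<le> k" for k
    using that gam_ge_shift[of "m0 + int k"] unfolding k0_def by linarith
  define p where "p = last_stop f \<alpha> m0 k0 x"
  have stay: "last_stop f \<alpha> m0 k x = p" if "k0 \<le> k" for k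
    using that
  proof (induction k rule: dec_induct)
    case base
    then show ?case by (simp add: p_def)
  next
    case (step k)
    show ?case
    proof (rule ccontr)
      assume "last_stop f \<alpha> m0 (Suc k) x \<noteq> p"
      then have "last_stop f \<alpha> m0 (Suc k) x = m0 + int (Suc k)" using step.IH by (auto split: if_splits)
      then have "selected f \<alpha> m0 M (gam (m0 + int (Suc k))) x" unfolding selected_def using x by blast
      then show False using j gam_big[of "Suc k"] step.hyps by auto
    qed
  qed
  obtain kp where kp: "p = m0 + int kp" "last_stop f \<alpha> m0 kp x = p"
    using last_stop_selected[of k0 f \<alpha> m0 x] unfolding p_def by auto
  have pk0: "m0 \<le> p" "p \<le> m0 + int k0" unfolding p_def by (rule last_stop_bounds)+
  obtain F w where F: "finite F" "\<And>n. n \<in> F \<Longrightarrow> n < p"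
      "\<And>n. n \<in> F \<Longrightarrow> \<exists>k'. n = m0 + int k' \<and> last_stop f \<alpha> m0 k' x = n"
      "\<And>n. n \<in> F \<Longrightarrow> w n \<in> (\<lambda>w. (?d * ((1 + A) * \<alpha>)) *\<^sub>R w) ` ?K n"
      "part m0 p f x = (\<Sum>n\<in>F. w n)"
    using stop_chain[OF f eps, of m0 k0 x, folded \<alpha>_def, folded p_def] by blast
  define n0 where "n0 = nat (\<bar>m0\<bar> + int k0)"
  define u where "u n = sym_part (n + n0) f x" for n
  define a where "a n = part (- int (n + n0)) m0 f x" for n
  define b where "b n = part p (int (n + n0)) f x" for n
  have u: "u n = a n + (\<Sum>n\<in>F. w n) + b n" for n
  proof -
    have 1: "- int (n + n0) \<le> m0" "m0 \<le> int (n + n0)" "p \<le> int (n + n0)" using pk0 unfolding n0_def by linarith+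
    have "u n = a n + part m0 (int (n + n0)) f x" unfolding u_def a_def using 1 by (intro part_split) auto
    also have "part m0 (int (n + n0)) f x = part m0 p f x + b n" unfolding b_def using 1 pk0 by (intro part_split) auto
    finally show ?thesis using F(5) by simp
  qed
  have ulim: "u \<longlonglongrightarrow> v" unfolding u_def by (rule LIMSEQ_ignore_initial_segment[OF lim])
  have aK: "a n \<in> (\<lambda>w. A *\<^sub>R w) ` ?K m0" for n
  proof -
    have "part (- int (n + n0)) m0 f x \<in> scaled_body (A * (2 ^ 0) ^ ?N) f (cube_at t (gam m0) x)"
    proof (rule ancestor_part[OF f supp x order_refl])
      show "gam j < gam m0 + int 0" if "j < m0" for j using gam_less[OF that] by simp
      show "- int (n + n0) \<le> m0" unfolding n0_def by linarith
    qed
    then show ?thesis unfolding a_def by simp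
  qed
  have "bounded ((\<lambda>w. A *\<^sub>R w) ` ?K m0)"
    by (rule bounded_scaling[OF convex_body_bounded[OF f sets_cube_at]])
  then have "bounded (range a)" by (rule bounded_subset) (use aK in blast)
  then obtain a' r where r: "strict_mono r" "(a \<circ> r) \<longlonglongrightarrow> a'"
    using bounded_imp_convergent_subsequence by blast
  have a'K: "a' \<in> (\<lambda>w. (?d * (A * ?B)) *\<^sub>R w) ` ?K m0"
  proof (rule scaled_body_limit[OF f sets_cube_at _ _ r(2)])
    show "0 < A" using A_ge_1 by simp
    show "\<forall>\<^sub>F n in sequentially. (a \<circ> r) n \<in> (\<lambda>w. A *\<^sub>R w) ` ?K m0"
      using aK by (intro always_eventually) simp
  qed
  \<comment> \<open>convergence of the last piece along the subsequence is forced by the convergence of the whole\<close>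
  define b' where "b' = v - a' - (\<Sum>n\<in>F. w n)"
  have blim: "(b \<circ> r) \<longlonglongrightarrow> b'"
  proof -
    have "(\<lambda>n. (u \<circ> r) n - (a \<circ> r) n - (\<Sum>n\<in>F. w n)) \<longlonglongrightarrow> b'"
      unfolding b'_def by (intro tendsto_diff LIMSEQ_subseq_LIMSEQ[OF ulim r(1)] r(2) tendsto_const)
    moreover have "(\<lambda>n. (u \<circ> r) n - (a \<circ> r) n - (\<Sum>n\<in>F. w n)) = b \<circ> r"
      by (rule ext) (simp add: u)
    ultimately show ?thesis by simp
  qed
  have b'K: "b' \<in> (\<lambda>w. (?d * \<alpha>) *\<^sub>R w) ` ?K p"
  proof (rule body_coords(4)[OF f sets_cube_at _ \<alpha>0])
    show "b' \<in> span (?K p)"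
      using part_in_span[OF f] unfolding b_def
      by (intro Lim_in_closed_set[OF closed_subspace[OF subspace_span] _ _ blim]) (auto intro!: always_eventually simp: b_def)
    fix i assume i: "i < CARD('d)"
    have bl: "bounded_linear (body_coords f (cube_at t (gam p) x) i)" by (rule body_coords(1)[OF f sets_cube_at])
    have "\<bar>body_coords f (cube_at t (gam p) x) i (b n)\<bar> \<le> \<alpha>" for n
    proof -
      define k where "k = nat (int (n + n0) - m0)"
      have k: "m0 + int k = int (n + n0)" "k0 \<le> k" unfolding k_def n0_def by linarith+
      show ?thesis
        using last_stop_tail(1)[OF f eps _ i, of m0 k x p, folded \<alpha>_def] stay[OF k(2)] unfolding k(1) b_def by blast
    qed
    then have "\<forall>\<^sub>F n in sequentially. \<bar>body_coords f (cube_at t (gam p) x) i ((b \<circ> r) n)\<bar> \<le> \<alpha>"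
      by (intro always_eventually) simp
    moreover have "(\<lambda>n. \<bar>body_coords f (cube_at t (gam p) x) i ((b \<circ> r) n)\<bar>) \<longlonglongrightarrow> \<bar>body_coords f (cube_at t (gam p) x) i b'\<bar>"
      by (intro tendsto_rabs bounded_linear.tendsto[OF bl] blim)
    ultimately show "\<bar>body_coords f (cube_at t (gam p) x) i b'\<bar> \<le> \<alpha>"
      by (intro tendsto_upperbound[where F=sequentially]) auto
  qed
  define W where "W n = (if n \<in> F then w n else 0) + (if n = p then b' else 0) + (if n = m0 then a' else 0)" for n
  let ?F = "F \<union> {p, m0}"
  have fin: "finite ?F" using F(1) by simp
  have "(\<Sum>n\<in>?F. W n) = (\<Sum>n\<in>?F. if n \<in> F then w n else 0) + (\<Sum>n\<in>?F. if n = p then b' else 0) + (\<Sum>n\<in>?F. if n = m0 then a' else 0)"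
    unfolding W_def by (simp only: sum.distrib)
  also have "(\<Sum>n\<in>?F. if n \<in> F then w n else 0) = (\<Sum>n\<in>F. w n)"
    using fin by (intro sum.mono_neutral_cong_right) auto
  also have "(\<Sum>n\<in>?F. if n = p then b' else 0) = b'" using fin by (simp add: sum.delta)
  also have "(\<Sum>n\<in>?F. if n = m0 then a' else 0) = a'" using fin by (simp add: sum.delta)
  finally have v: "v = (\<Sum>n\<in>?F. W n)" by (simp add: b'_def)
  have WK: "W n \<in> (\<lambda>w. domination_const A ?N CARD('d) \<epsilon> M *\<^sub>R w) ` ?K n" for n
  proof -
    have z: "0 \<in> (\<lambda>w. c *\<^sub>R w) ` ?K n" for c
      using zero_in_convex_body[OF f sets_cube_at, of t "gam n" x] by (intro image_eqI[where x=0]) auto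
    have "(if n \<in> F then w n else 0) \<in> (\<lambda>w. (?d * ((1 + A) * \<alpha>)) *\<^sub>R w) ` ?K n" using F(4) z by simp
    moreover have "(if n = p then b' else 0) \<in> (\<lambda>w. (?d * \<alpha>) *\<^sub>R w) ` ?K n" using b'K z by simp
    moreover have "(if n = m0 then a' else 0) \<in> (\<lambda>w. (?d * (A * (2 ^ M) ^ ?N * ?B)) *\<^sub>R w) ` ?K n"
    proof (cases "n = m0")
      case True
      have "0 \<le> ?d * (A * ?B)" using A_ge_1 basis_const_ge_1[of "CARD('d)"] by (intro mult_nonneg_nonneg) auto
      then show ?thesis using scaled_body_mono[OF f sets_cube_at a'K _ parts(4)] True by simp
    qed (use z in simp)
    ultimately show ?thesis
      unfolding W_def domination_const_def \<alpha>_def[symmetric]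
      by (intro scaled_body_add[OF f sets_cube_at] add_nonneg_nonneg parts(1-3))
  qed
  have sel: "selected f \<alpha> m0 M (gam n) x" if n: "n \<in> ?F" for n
  proof -
    have "\<exists>k'. n = m0 + int k' \<and> last_stop f \<alpha> m0 k' x = n"
    proof -
      consider "n \<in> F" | "n = p" | "n = m0" using n by blast
      then show ?thesis
      proof cases
        case 1
        then show ?thesis by (rule F(3))
      next
        case 2
        then show ?thesis using kp by blast
      next
        case 3
        then show ?thesis by (intro exI[of _ 0]) simp
      qed
    qed
    then show ?thesis unfolding selected_def using x by blast
  qed
  show ?thesis
    unfolding v
  proof (rule scaled_sparse_operator_sum[where Sel="selected f \<alpha> m0 M" and g=gam, OF f fin])
    show "inj_on gam ?F" using gam_inject by (rule inj_onI)
    show "selected f \<alpha> m0 M (gam n) x" if "n \<in> ?F" for n using that by (rule sel)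
    show "W n \<in> (\<lambda>w. domination_const A ?N CARD('d) \<epsilon> M *\<^sub>R w) ` ?K n" for n by (rule WK)
  qed
qed

text \<open>Let the smallest selected ancestor around \<open>x\<close> be of generation \<open>j1\<close>. The cube of generation \<open>j1 + M\<close> at \<open>x\<close> is
not central, so cubes at \<open>x\<close> of this or a finer generation miss the support of \<open>f\<close>, and only the blocks
covered by \<open>ancestor_part\<close> contribute.\<close>

lemma domination_noncentral:
  fixes f :: "real^'n \<Rightarrow> real^'d"
  assumes f: "integrable lebesgue f" and supp: "AE y in lebesgue. f y \<noteq> 0 \<longrightarrow> central t (gam m0) y"
    and eps: "0 < \<epsilon>" "\<epsilon> < 1" and M: "(1/2) ^ M \<le> \<epsilon>"
  defines "\<alpha> \<equiv> stop_threshold A CARD('n) CARD('d) \<epsilon>"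
  assumes lim: "(\<lambda>n. sym_part n f x) \<longlonglongrightarrow> v"
    and x: "\<not> central t (gam m0) x"
  shows "v \<in> (\<lambda>w. domination_const A CARD('n) CARD('d) \<epsilon> M *\<^sub>R w) `
    sparse_operator {cube_at t j x | j x. selected f \<alpha> m0 M j x} f x"
proof -
  let ?d = "real CARD('d)" and ?B = "basis_const CARD('d)" and ?N = "CARD('n)"
  have M1: "1 \<le> M" using M eps by (cases M) auto
  have \<alpha>0: "0 < \<alpha>" unfolding \<alpha>_def using stop_threshold_ge(2)[OF eps] by (simp add: Suc_le_eq)
  note parts = domination_const_parts[OF A_ge_1 \<alpha>0[unfolded \<alpha>_def], folded \<alpha>_def]
  obtain j where j: "central t j x" using ex_central by blast
  have "central t (gam m0 - int M * int (nat \<bar>gam m0 - j\<bar>)) x"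
  proof (rule central_coarser(1)[OF j])
    have "1 * int (nat \<bar>gam m0 - j\<bar>) \<le> int M * int (nat \<bar>gam m0 - j\<bar>)" using M1 by (intro mult_right_mono) auto
    then show "gam m0 - int M * int (nat \<bar>gam m0 - j\<bar>) \<le> j" by linarith
  qed
  \<comment> \<open>every point is in a central cube of some coarse generation\<close>
  define i where "i = (LEAST i::nat. central t (gam m0 - int M * int i) x)"
  have i: "central t (gam m0 - int M * int i) x" unfolding i_def by (rule LeastI) fact
  have least: "\<not> central t (gam m0 - int M * int i') x" if "i' < i" for i'
    using not_less_Least[of i' "\<lambda>i. central t (gam m0 - int M * int i) x"] that unfolding i_def by blast
  have i1: "1 \<le> i" using i x by (cases i) auto
  define j1 where "j1 = gam m0 - int M * int i"
  have j1: "central t j1 x" "j1 \<le> gam m0" using i unfolding j1_def by auto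
  have j2: "\<not> central t (j1 + int M) x" "j1 + int M \<le> gam m0"
  proof -
    obtain i' where i': "i = Suc i'" using i1 by (cases i) auto
    have "j1 + int M = gam m0 - int M * int i'" unfolding j1_def i' by (simp add: algebra_simps)
    then show "\<not> central t (j1 + int M) x" "j1 + int M \<le> gam m0" using least[of i'] i' by simp_all
  qed
  have "\<exists>n2\<le>\<bar>j1 + int M - gam 0\<bar>. j1 + int M \<le> gam n2 \<and> (\<forall>i<n2. \<not> j1 + int M \<le> gam i)"
  proof (rule int_least_bounded)
    show "j1 + int M \<le> gam \<bar>j1 + int M - gam 0\<bar>" using gam_ge_shift[of "\<bar>j1 + int M - gam 0\<bar>"] by linarith
    show "\<not> j1 + int M \<le> gam i" if "i \<le> - \<bar>j1 + int M - gam 0\<bar> - 1" for i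
      using that gam_le_shift[of i] by linarith
  qed
  then obtain n2 where n2: "j1 + int M \<le> gam n2" "\<And>i. i < n2 \<Longrightarrow> gam i < j1 + int M" by (meson not_le)
  have zero: "block j f x = 0" if "n2 \<le> j" for j
  proof -
    have "AE y in lebesgue. kap j x y *\<^sub>R f y = 0"
      using supp
    proof eventually_elim
      case (elim y)
      show ?case
      proof (rule ccontr)
        assume "kap j x y *\<^sub>R f y \<noteq> 0"
        then have y: "y \<in> cube_at t (gam j) x" "central t (gam m0) y" using kap_support[of j x y] elim by auto
        have "j1 + int M \<le> gam j" using n2(1) gam_le[OF that] by linarith
        then have "y \<in> cube_at t (j1 + int M) x" using y(1) cube_at_antimono by blast
        then have "central t (j1 + int M) x" using central_cong central_coarser(1)[OF y(2) j2(2)] by blast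
        then show False using j2(1) by blast
      qed
    qed
    then show ?thesis unfolding block_def by (rule integral_eq_zero_AE)
  qed
  have K: "\<forall>\<^sub>F n in sequentially. sym_part n f x \<in> scaled_body (A * (2 ^ M) ^ ?N) f (cube_at t j1 x)"
    using eventually_ge_at_top[of "nat \<bar>n2\<bar>"]
  proof eventually_elim
    case (elim n)
    have "sym_part n f x = part (- int n) n2 f x + part n2 (int n) f x" using elim by (intro part_split) auto
    also have "part n2 (int n) f x = 0" unfolding part_def using zero by (intro sum.neutral) auto
    finally have "sym_part n f x = part (- int n) n2 f x" by simp
    moreover have "- int n \<le> n2" using elim by linarith
    ultimately show ?case using ancestor_part[OF f supp j1, of n2 M "- int n"] n2(2) by auto
  qed
  have "v \<in> scaled_body (?d * (A * (2 ^ M) ^ ?N * ?B)) f (cube_at t j1 x)"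
    using A_ge_1 by (intro scaled_body_limit[OF f sets_cube_at _ K lim]) auto
  then have vK: "v \<in> scaled_body (domination_const A ?N CARD('d) \<epsilon> M) f (cube_at t j1 x)"
    by (rule scaled_body_mono[OF f sets_cube_at]) (use parts(1-3) in \<open>simp_all add: domination_const_def \<alpha>_def\<close>)
  have "selected f \<alpha> m0 M j1 x" unfolding selected_def using i1 j1(1) j1_def by blast
  then have "(\<Sum>j\<in>{j1}. v) \<in> (\<lambda>w. domination_const A ?N CARD('d) \<epsilon> M *\<^sub>R w) `
    sparse_operator {cube_at t j x | j x. selected f \<alpha> m0 M j x} f x"
    using vK by (intro scaled_sparse_operator_sum[where Sel="selected f \<alpha> m0 M" and g="\<lambda>j. j", OF f]) simp_all
  then show ?thesis by simp
qed

theorem sparse_domination: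
  fixes f :: "real^'n \<Rightarrow> real^'d"
  assumes f: "integrable lebesgue f" and supp: "ae_compactly_supported f"
    and eps: "0 < \<epsilon>" "\<epsilon> < 1" and M: "(1/2) ^ M \<le> \<epsilon>"
  shows "\<exists>\<S>\<subseteq>dyadic_lattice t. sparse_family \<epsilon> \<S> \<and>
    (AE x in lebesgue. L1_extension_vec T f x \<in>
      (\<lambda>v. domination_const A CARD('n) CARD('d) \<epsilon> M *\<^sub>R v) ` sparse_operator \<S> f x)"
proof -
  obtain S where S: "compact S" "AE x in lebesgue. x \<notin> S \<longrightarrow> f x = 0"
    using supp unfolding ae_compactly_supported_def by blast
  obtain j0 where j0: "\<And>j x. j \<le> j0 \<Longrightarrow> x \<in> S \<Longrightarrow> central t j x"
    using bounded_central[OF compact_imp_bounded[OF S(1)], of t] by blast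
  define m0 where "m0 = - \<bar>gam 0 - j0\<bar>"
  have m0: "gam m0 \<le> j0" using gam_le_shift[of m0] unfolding m0_def by linarith
  have supp': "AE y in lebesgue. f y \<noteq> 0 \<longrightarrow> central t (gam m0) y"
    using S(2)
  proof eventually_elim
    case (elim y)
    show ?case
    proof
      assume "f y \<noteq> 0"
      then have "y \<in> S" using elim by blast
      then show "central t (gam m0) y" by (rule j0[OF m0])
    qed
  qed
  define \<alpha> where "\<alpha> = stop_threshold A CARD('n) CARD('d) \<epsilon>"
  let ?S = "{cube_at t j x | j x. selected f \<alpha> m0 M j x}"
  have small: "emeasure lebesgue {y \<in> cube_at t j x. \<exists>j'>j. selected f \<alpha> m0 M j' y} \<le> ennreal (\<epsilon> * measure lebesgue (cube_at t j x))"
    if "selected f \<alpha> m0 M j x" for j x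
    unfolding \<alpha>_def by (rule emeasure_selected[OF f eps M that[unfolded \<alpha>_def]])
  have sub: "?S \<subseteq> dyadic_lattice t"
    unfolding dyadic_lattice_def dyadic_gen_eq by blast
  have sparse: "sparse_family \<epsilon> ?S"
    by (rule sparse_family_selection[OF selected_cong small]) (use eps in auto)
  have fin: "AE x in lebesgue. \<exists>j. \<forall>j'>j. \<not> selected f \<alpha> m0 M j' x"
    by (rule selection_finite_AE[OF selected_cong small]) (use eps in auto)
  have "AE x in lebesgue. L1_extension_vec T f x \<in>
      (\<lambda>v. domination_const A CARD('n) CARD('d) \<epsilon> M *\<^sub>R v) ` sparse_operator ?S f x"
    using fin L1_extension_vec_eq_lim[OF f]
  proof eventually_elim
    case (elim x)
    show ?case
    proof (cases "central t (gam m0) x")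
      case True
      show ?thesis
        unfolding \<alpha>_def by (rule domination_central[OF f supp' eps elim(2) elim(1)[unfolded \<alpha>_def] True])
    next
      case False
      show ?thesis
        unfolding \<alpha>_def by (rule domination_noncentral[OF f supp' eps M elim(2) False])
    qed
  qed
  then show ?thesis using sub sparse by blast
qed

end

section \<open>Increments of a sum of blocks\<close>

text \<open>The values of a block over a cube of generation \<open>a\<close> whose kernel is constant on cubes of generation \<open>b\<close>:
supported in the cube, constant on its descendants of generation \<open>b\<close>, and of mean zero.\<close>

definition block_fun :: "real^'n \<Rightarrow> int \<Rightarrow> int \<Rightarrow> real^'n \<Rightarrow> (real^'n \<Rightarrow> real) \<Rightarrow> bool" where
  "block_fun t a b z u \<longleftrightarrow> square_integrable u \<and> (\<forall>y. u y \<noteq> 0 \<longrightarrow> y \<in> cube_at t a z) \<and>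
     (\<forall>y y'. y' \<in> cube_at t b y \<longrightarrow> u y' = u y) \<and> (LINT y|lebesgue. u y) = 0"

lemma block_fun_integrable:
  assumes "block_fun t a b z u"
  shows "integrable lebesgue u"
proof -
  have "set_integrable lebesgue (cube_at t a z) u"
    using assms unfolding block_fun_def by (intro square_integrable_set_integrable) auto
  moreover have "(\<lambda>x. indicat_real (cube_at t a z) x *\<^sub>R u x) = u"
  proof
    fix y show "indicat_real (cube_at t a z) y *\<^sub>R u y = u y"
      using assms unfolding block_fun_def by (cases "u y = 0") auto
  qed
  ultimately show ?thesis by (simp add: set_integrable_def)
qed

lemma average_eq_integral:
  fixes u :: "real^'n \<Rightarrow> real"
  assumes "\<And>y. u y \<noteq> 0 \<Longrightarrow> y \<in> R"
  shows "average u R = (LINT y|lebesgue. u y) / measure lebesgue R"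
proof -
  have "(\<lambda>x. indicat_real R x *\<^sub>R u x) = u"
  proof
    fix y show "indicat_real R y *\<^sub>R u y = u y" using assms[of y] by (cases "u y = 0") auto
  qed
  then show ?thesis by (simp add: average_def set_lebesgue_integral_def divide_inverse)
qed

lemma average_zero: "(\<And>y. y \<in> R \<Longrightarrow> u y = 0) \<Longrightarrow> average u R = 0" for u :: "real^'n \<Rightarrow> real"
  using average_cong[of R u "\<lambda>_. 0"] by (simp add: average_def)

lemma block_fun_average_coarse:
  assumes u: "block_fun t a b z u" and c: "x \<notin> cube_at t a z \<or> c \<le> a"
  shows "average u (cube_at t c x) = 0"
proof (cases "cube_at t c x \<inter> cube_at t a z = {}")
  case True
  have "u y = 0" if "y \<in> cube_at t c x" for y
    using u True that unfolding block_fun_def by blast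
  then show ?thesis by (rule average_zero)
next
  case False
  then obtain w where w: "w \<in> cube_at t c x" "w \<in> cube_at t a z" by blast
  have eqs: "cube_at t c w = cube_at t c x" "cube_at t a w = cube_at t a z" using w cube_at_eq by blast+
  have "c \<le> a"
  proof (rule ccontr)
    assume n: "\<not> c \<le> a"
    then have "cube_at t c x \<subseteq> cube_at t a z" using cube_at_antimono[of a c t w] eqs by simp
    then have "x \<in> cube_at t a z" using self_in_cube_at[of x t c] by blast
    then show False using c n by blast
  qed
  then have sub: "cube_at t a z \<subseteq> cube_at t c x" using cube_at_antimono[of c a t w] eqs by simp
  have "average u (cube_at t c x) = (LINT y|lebesgue. u y) / measure lebesgue (cube_at t c x)"
    using u sub unfolding block_fun_def by (intro average_eq_integral) blast
  then show ?thesis using u unfolding block_fun_def by simp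
qed

lemma average_of_const:
  fixes u :: "real^'n \<Rightarrow> real"
  assumes "\<And>y. y \<in> cube_at t c x \<Longrightarrow> u y = k"
  shows "average u (cube_at t c x) = k"
  using average_cong[of "cube_at t c x" u "\<lambda>_. k"] assms by (simp add: average_const)

lemma block_fun_average_fine:
  assumes u: "block_fun t a b z u" and c: "b \<le> c"
  shows "average u (cube_at t c x) = u x"
proof (rule average_of_const)
  fix y assume "y \<in> cube_at t c x"
  then have "y \<in> cube_at t b x" using cube_at_antimono[OF c] by blast
  then show "u y = u x" using u unfolding block_fun_def by blast
qed

text \<open>Averages over cubes that are at least as large as the cube of the block vanish, averages over cubes of
the next level do not change the block. So passing from level \<open>j\<close> to level \<open>j + 1\<close> changes the average only
for the block over the level \<open>j\<close> cube at \<open>x\<close>.\<close>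

lemma block_fun_increment:
  fixes gam :: "int \<Rightarrow> int"
  assumes gam: "\<And>i j. i < j \<Longrightarrow> gam i < gam j"
    and u: "block_fun t (gam i) (gam (i + 1)) z u"
  shows "average u (cube_at t (gam (j + 1)) x) - average u (cube_at t (gam j) x)
    = (if cube_at t (gam i) z = cube_at t (gam j) x then u x else 0)"
proof (cases "x \<in> cube_at t (gam i) z")
  case False
  then have "cube_at t (gam i) z \<noteq> cube_at t (gam j) x" using self_in_cube_at by blast
  then show ?thesis using block_fun_average_coarse[OF u] False by simp
next
  case True
  have P: "cube_at t (gam i) x = cube_at t (gam i) z" using True by (rule cube_at_eq)
  have gle: "gam k \<le> gam l" if "k \<le> l" for k l using gam[of k l] that by (cases "k = l") auto
  have ne: "cube_at t (gam i) z \<noteq> cube_at t (gam j) x" if "i \<noteq> j"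
  proof
    assume "cube_at t (gam i) z = cube_at t (gam j) x"
    then have "gam i = gam j" by (rule cube_at_inj_gen)
    then show False using that gam[of i j] gam[of j i] by (cases i j rule: linorder_cases) auto
  qed
  consider "i < j" | "i = j" | "j < i" by linarith
  then show ?thesis
  proof cases
    case 1
    then have "gam (i + 1) \<le> gam j" "gam (i + 1) \<le> gam (j + 1)" by (auto intro: gle)
    then show ?thesis using block_fun_average_fine[OF u] ne 1 by simp
  next
    case 2
    have "average u (cube_at t (gam j) x) = 0" by (rule block_fun_average_coarse[OF u]) (simp add: 2)
    then show ?thesis using block_fun_average_fine[OF u, of "gam (j + 1)" x] P 2 by simp
  next
    case 3
    then have "gam j \<le> gam i" "gam (j + 1) \<le> gam i" by (auto intro: gle)
    then show ?thesis using block_fun_average_coarse[OF u] ne 3 by simp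
  qed
qed

lemma square_integrable_add:
  assumes "square_integrable f" "square_integrable g"
  shows "square_integrable (\<lambda>x. f x + g x)"
  unfolding square_integrable_def
proof
  show m: "(\<lambda>x. f x + g x) \<in> borel_measurable lebesgue" using assms by (auto simp: square_integrable_def)
  show "integrable lebesgue (\<lambda>x. (f x + g x)\<^sup>2)"
  proof (rule Bochner_Integration.integrable_bound)
    show "integrable lebesgue (\<lambda>x. 2 * (f x)\<^sup>2 + 2 * (g x)\<^sup>2)" using assms by (auto simp: square_integrable_def)
    show "(\<lambda>x. (f x + g x)\<^sup>2) \<in> borel_measurable lebesgue" using m by (rule borel_measurable_power)
    have "(f x + g x)\<^sup>2 \<le> 2 * (f x)\<^sup>2 + 2 * (g x)\<^sup>2" for x
      using sum_squares_bound[of "f x" "g x"] by (simp add: power2_sum)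
    then show "AE x in lebesgue. norm ((f x + g x)\<^sup>2) \<le> norm (2 * (f x)\<^sup>2 + 2 * (g x)\<^sup>2)"
      by (intro AE_I2) simp
  qed
qed

lemma square_integrable_cmult: "square_integrable f \<Longrightarrow> square_integrable (\<lambda>x. c * f x)"
  unfolding square_integrable_def by (auto simp: power_mult_distrib)

lemma square_integrable_diff:
  assumes "square_integrable f" "square_integrable g"
  shows "square_integrable (\<lambda>x. f x - g x)"
  using square_integrable_add[OF assms(1) square_integrable_cmult[OF assms(2), of "-1"]] by simp

lemma square_integrable_sum:
  assumes "\<And>i. i \<in> I \<Longrightarrow> square_integrable (f i)"
  shows "square_integrable (\<lambda>x. \<Sum>i\<in>I. f i x)"
  using assms
proof (induction I rule: infinite_finite_induct)
  case (insert i I)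
  then show ?case using square_integrable_add[of "f i" "\<lambda>x. \<Sum>i\<in>I. f i x"] by simp
qed (simp_all add: square_integrable_def)

lemma square_integrable_mult:
  assumes "square_integrable f" "square_integrable g"
  shows "integrable lebesgue (\<lambda>x. f x * g x)"
proof (rule Bochner_Integration.integrable_bound)
  show "integrable lebesgue (\<lambda>x. (f x)\<^sup>2 + (g x)\<^sup>2)" using assms by (auto simp: square_integrable_def)
  show "(\<lambda>x. f x * g x) \<in> borel_measurable lebesgue" using assms by (auto simp: square_integrable_def)
  have "\<bar>f x * g x\<bar> \<le> (f x)\<^sup>2 + (g x)\<^sup>2" for x
  proof -
    have "2 * (\<bar>f x\<bar> * \<bar>g x\<bar>) \<le> (f x)\<^sup>2 + (g x)\<^sup>2"
      using sum_squares_bound[of "\<bar>f x\<bar>" "\<bar>g x\<bar>"] by (simp add: mult.assoc)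
    moreover have "0 \<le> \<bar>f x\<bar> * \<bar>g x\<bar>" by simp
    ultimately show ?thesis unfolding abs_mult by linarith
  qed
  then show "AE x in lebesgue. norm (f x * g x) \<le> norm ((f x)\<^sup>2 + (g x)\<^sup>2)" by (intro AE_I2) simp
qed

lemma abs_average_le_L2_norm:
  assumes u: "square_integrable u"
  shows "\<bar>average u (cube_at t c x)\<bar> \<le> L2_norm_fun u / sqrt (measure lebesgue (cube_at t c x))"
proof -
  let ?R = "cube_at t c x"
  have "(average u ?R)\<^sup>2 \<le> average (\<lambda>x. (u x)\<^sup>2) ?R" by (rule average_square_le[OF u])
  also have "\<dots> \<le> (LINT x|lebesgue. (u x)\<^sup>2) / measure lebesgue ?R"
    using set_integral_abs_le[of "\<lambda>x. (u x)\<^sup>2" ?R] u measure_cube_at_pos[of t c x]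
    by (simp add: average_def square_integrable_def divide_inverse mult.commute mult_left_mono)
  finally have "sqrt ((average u ?R)\<^sup>2) \<le> sqrt ((LINT x|lebesgue. (u x)\<^sup>2) / measure lebesgue ?R)" by (rule real_sqrt_le_mono)
  then show ?thesis by (simp add: L2_norm_fun_def real_sqrt_divide)
qed

text \<open>The increment is a continuous functional on \<open>L\<^sup>2\<close>, so it can be computed on the finite sums of blocks, where
\<open>block_fun_increment\<close> leaves a single term.\<close>

theorem L2_operator_sum_increment:
  fixes t :: "real^'n" and \<T> :: "(real^'n) set \<Rightarrow> 'n operator" and gam :: "int \<Rightarrow> int"
  assumes gam: "\<And>i j. i < j \<Longrightarrow> gam i < gam j"
    and sum: "L2_operator_sum (dyadic_lattice t) \<T> T" and g: "square_integrable g"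
    and off: "\<And>P. P \<in> dyadic_lattice t \<Longrightarrow> (\<And>i z. P \<noteq> cube_at t (gam i) z) \<Longrightarrow> AE x in lebesgue. \<T> P g x = 0"
    and blk: "\<And>i z. block_fun t (gam i) (gam (i + 1)) z (\<T> (cube_at t (gam i) z) g)"
  shows "average (T g) (cube_at t (gam (j + 1)) x) - average (T g) (cube_at t (gam j) x)
    = \<T> (cube_at t (gam j) x) g x"
proof -
  let ?D = "dyadic_lattice t"
  let ?S = "cube_at t (gam (j + 1)) x" and ?Q = "cube_at t (gam j) x"
  define inc where "inc u = average u ?S - average u ?Q" for u :: "real^'n \<Rightarrow> real"
  have si: "set_integrable lebesgue (cube_at t c x) u" if "square_integrable u" for u c
    using that by (rule square_integrable_set_integrable) simp
  have QD: "?Q \<in> ?D" unfolding dyadic_lattice_def dyadic_gen_eq by blast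
  have TP: "square_integrable (\<T> P g)" if "P \<in> ?D" for P using sum g that unfolding L2_operator_sum_def by blast
  have Tg: "square_integrable (T g)" using sum g unfolding L2_operator_sum_def by blast
  have inc_block: "inc (\<T> P g) = (if P = ?Q then \<T> ?Q g x else 0)" if P: "P \<in> ?D" for P
  proof (cases "\<exists>i z. P = cube_at t (gam i) z")
    case True
    then obtain i z where Pz: "P = cube_at t (gam i) z" by blast
    have "inc (\<T> P g) = (if P = ?Q then \<T> P g x else 0)"
      unfolding inc_def Pz by (rule block_fun_increment[of gam, OF gam blk[of i z]])
    then show ?thesis by auto
  next
    case False
    then have "AE x in lebesgue. \<T> P g x = 0" using off[OF P] by blast
    then have "AE x in lebesgue. indicat_real R x *\<^sub>R \<T> P g x = 0" for R by eventually_elim simp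
    then have "average (\<T> P g) R = 0" for R
      unfolding average_def set_lebesgue_integral_def by (subst integral_eq_zero_AE) simp_all
    then show ?thesis using False unfolding inc_def by auto
  qed
  have inc_sum: "inc (\<lambda>y. (\<Sum>P\<in>F. \<T> P g y) - T g y) = (if ?Q \<in> F then \<T> ?Q g x else 0) - inc (T g)"
    if F: "finite F" "F \<subseteq> ?D" for F
  proof -
    have sF: "square_integrable (\<lambda>y. \<Sum>P\<in>F. \<T> P g y)" using TP F by (intro square_integrable_sum) blast
    have avF: "average (\<lambda>y. \<Sum>P\<in>F. \<T> P g y) (cube_at t c x) = (\<Sum>P\<in>F. average (\<T> P g) (cube_at t c x))" for c
      using F
    proof (induction F rule: finite_induct)
      case empty
      then show ?case by (simp add: average_def)
    next
      case (insert P F)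
      have "square_integrable (\<lambda>y. \<Sum>P\<in>F. \<T> P g y)" using TP insert.prems by (intro square_integrable_sum) blast
      moreover have "square_integrable (\<T> P g)" using TP insert.prems by blast
      ultimately show ?case using insert by (simp add: average_add si)
    qed
    have "inc (\<lambda>y. (\<Sum>P\<in>F. \<T> P g y) - T g y) = inc (\<lambda>y. \<Sum>P\<in>F. \<T> P g y) - inc (T g)"
      unfolding inc_def using si[OF sF] si[OF Tg] by (simp add: average_diff)
    also have "inc (\<lambda>y. \<Sum>P\<in>F. \<T> P g y) = (\<Sum>P\<in>F. inc (\<T> P g))"
      unfolding inc_def avF by (simp add: sum_subtractf)
    also have "\<dots> = (\<Sum>P\<in>F. if P = ?Q then \<T> ?Q g x else 0)"
    proof (rule sum.cong)
      fix P assume "P \<in> F"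
      then show "inc (\<T> P g) = (if P = ?Q then \<T> ?Q g x else 0)" using F(2) by (intro inc_block) blast
    qed simp
    also have "\<dots> = (if ?Q \<in> F then \<T> ?Q g x else 0)" using F(1) by (simp add: sum.delta)
    finally show ?thesis .
  qed
  define c where "c = 1 / sqrt (measure lebesgue ?S) + 1 / sqrt (measure lebesgue ?Q)"
  have inc_le: "\<bar>inc u\<bar> \<le> c * L2_norm_fun u" if "square_integrable u" for u
    using abs_average_le_L2_norm[OF that, of t "gam (j + 1)" x] abs_average_le_L2_norm[OF that, of t "gam j" x]
    unfolding inc_def c_def by (simp add: algebra_simps)
  let ?G = "finite_subsets_at_top ?D"
  have lim: "((\<lambda>F. c * L2_norm_fun (\<lambda>x. (\<Sum>Q\<in>F. \<T> Q g x) - T g x)) \<longlongrightarrow> c * 0) ?G"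
    using sum g unfolding L2_operator_sum_def by (intro tendsto_mult_left) blast
  have ev: "\<forall>\<^sub>F F in ?G. norm (\<T> ?Q g x - inc (T g)) \<le> c * L2_norm_fun (\<lambda>x. (\<Sum>Q\<in>F. \<T> Q g x) - T g x)"
    unfolding eventually_finite_subsets_at_top
  proof (intro exI[of _ "{?Q}"] conjI allI impI)
    fix F assume F: "finite F \<and> {?Q} \<subseteq> F \<and> F \<subseteq> ?D"
    then have fF: "finite F" "F \<subseteq> ?D" "?Q \<in> F" by blast+
    have "square_integrable (\<lambda>y. (\<Sum>P\<in>F. \<T> P g y) - T g y)"
      using TP fF by (intro square_integrable_diff square_integrable_sum Tg) blast
    from inc_le[OF this] show "norm (\<T> ?Q g x - inc (T g)) \<le> c * L2_norm_fun (\<lambda>x. (\<Sum>Q\<in>F. \<T> Q g x) - T g x)"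
      unfolding inc_sum[OF fF(1,2)] using fF(3) by simp
  qed (use QD in auto)
  have "((\<lambda>F. \<T> ?Q g x - inc (T g)) \<longlongrightarrow> 0) ?G"
    by (rule Lim_null_comparison[OF ev]) (use lim in simp)
  then have "\<T> ?Q g x - inc (T g) = 0"
    using tendsto_unique[OF finite_subsets_at_top_neq_bot tendsto_const] by blast
  then show ?thesis unfolding inc_def by simp
qed

section \<open>Martingale differences and orthogonality\<close>

text \<open>The martingale difference of \<open>g\<close> between the generations \<open>c\<close> and \<open>c'\<close>, restricted to a cube of generation \<open>a\<close>.
With \<open>c = a\<close> it is the difference that a Haar block sees, with \<open>c + 1 = c'\<close> the sum of \<open>\<Delta>\<^sub>R g\<close> over the
descendants \<open>R\<close> of generation \<open>c\<close>.\<close>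

definition local_increment :: "real^'n \<Rightarrow> int \<Rightarrow> int \<Rightarrow> int \<Rightarrow> real^'n \<Rightarrow> (real^'n \<Rightarrow> real) \<Rightarrow> real^'n \<Rightarrow> real" where
  "local_increment t a c c' z g y = indicator (cube_at t a z) y * (average g (cube_at t c' y) - average g (cube_at t c y))"

lemma average_restrict:
  fixes g :: "real^'n \<Rightarrow> real"
  assumes "a \<le> c"
  shows "average (\<lambda>y. indicator (cube_at t a z) y * g y) (cube_at t c x)
    = indicator (cube_at t a z) x * average g (cube_at t c x)"
proof (cases "x \<in> cube_at t a z")
  case True
  then have "cube_at t c x \<subseteq> cube_at t a z" using cube_at_antimono[OF assms, of t x] cube_at_eq by blast
  then have "average (\<lambda>y. indicator (cube_at t a z) y * g y) (cube_at t c x) = average g (cube_at t c x)"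
    by (intro average_cong) auto
  then show ?thesis using True by simp
next
  case False
  have "indicator (cube_at t a z) y * g y = 0" if "y \<in> cube_at t c x" for y
  proof -
    have "y \<notin> cube_at t a z"
    proof
      assume "y \<in> cube_at t a z"
      moreover have "y \<in> cube_at t a x" using that cube_at_antimono[OF assms] by blast
      ultimately show False using False by (simp add: mem_cube_at)
    qed
    then show ?thesis by simp
  qed
  then have "average (\<lambda>y. indicator (cube_at t a z) y * g y) (cube_at t c x) = 0" by (rule average_zero)
  then show ?thesis using False by simp
qed

lemma local_increment_cond_avg:
  assumes "a \<le> c" "c \<le> c'"
  shows "local_increment t a c c' z g y = cond_avg t (\<lambda>_. c') (\<lambda>y. indicator (cube_at t a z) y * g y) y
     - cond_avg t (\<lambda>_. c) (\<lambda>y. indicator (cube_at t a z) y * g y) y"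
  unfolding local_increment_def cond_avg_def average_restrict[OF assms(1)] average_restrict[OF order_trans[OF assms]]
  by (rule right_diff_distrib)

lemma bounded_supported_square_integrable:
  assumes m: "u \<in> borel_measurable lebesgue" and supp: "\<And>y. u y \<noteq> 0 \<Longrightarrow> y \<in> cube_at t a z" and b: "\<And>y. \<bar>u y\<bar> \<le> B"
  shows "square_integrable u"
  unfolding square_integrable_def
proof
  show "u \<in> borel_measurable lebesgue" by (rule m)
  show "integrable lebesgue (\<lambda>x. (u x)\<^sup>2)"
  proof (rule Bochner_Integration.integrable_bound)
    show "integrable lebesgue (\<lambda>x. B\<^sup>2 * indicat_real (cube_at t a z) x)"
      using fmeasurable_cube_at[of t a z] by (intro integrable_mult_right) (simp add: lmeasurable_iff_integrable)
    show "(\<lambda>x. (u x)\<^sup>2) \<in> borel_measurable lebesgue" using m by (rule borel_measurable_power)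
    have "(u x)\<^sup>2 \<le> B\<^sup>2 * indicat_real (cube_at t a z) x" for x
    proof (cases "u x = 0")
      case False
      have "(u x)\<^sup>2 \<le> B\<^sup>2" using b[of x] by (metis abs_ge_zero power_mono power2_abs)
      then show ?thesis using supp[OF False] by simp
    qed simp
    then show "AE x in lebesgue. norm ((u x)\<^sup>2) \<le> norm (B\<^sup>2 * indicat_real (cube_at t a z) x)" by (intro AE_I2) simp
  qed
qed

lemma local_increment_block_fun:
  fixes g :: "real^'n \<Rightarrow> real"
  assumes c: "a \<le> c" "c \<le> c'" and g: "set_integrable lebesgue (cube_at t a z) g"
  shows "block_fun t a c' z (local_increment t a c c' z g)"
proof -
  let ?P = "cube_at t a z"
  let ?g = "\<lambda>y. indicat_real ?P y * g y"
  let ?u = "local_increment t a c c' z g"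
  have gi: "integrable lebesgue ?g" using g by (simp add: set_integrable_def)
  have const: "?u y' = ?u y" if y: "y' \<in> cube_at t c' y" for y y'
  proof -
    have "y' \<in> cube_at t c y" using y cube_at_antimono[OF c(2)] by blast
    then have eqs: "cube_at t c' y' = cube_at t c' y" "cube_at t c y' = cube_at t c y" using cube_at_eq y by blast+
    have "y' \<in> cube_at t a y" using y cube_at_antimono[OF order_trans[OF c]] by blast
    then have "y' \<in> ?P \<longleftrightarrow> y \<in> ?P" by (simp add: mem_cube_at)
    then show ?thesis unfolding local_increment_def eqs by (simp add: indicator_def)
  qed
  have supp: "y \<in> ?P" if "?u y \<noteq> 0" for y
    using that unfolding local_increment_def by (cases "y \<in> ?P") auto
  let ?G = "LINT x|lebesgue. \<bar>?g x\<bar>"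
  have bound: "\<bar>?u y\<bar> \<le> ?G * (2 powi c') ^ CARD('n) + ?G * (2 powi c) ^ CARD('n)" for y
  proof -
    have "\<bar>cond_avg t (\<lambda>_. k) ?g y\<bar> \<le> ?G * (2 powi k) ^ CARD('n)" for k
      using cond_avg_abs_le[of t "\<lambda>_. k" ?g y] average_abs_le_norm1[OF gi, of t k y] unfolding cond_avg_def by linarith
    from this[of c'] this[of c] show ?thesis unfolding local_increment_cond_avg[OF c] by linarith
  qed
  have m: "?u \<in> borel_measurable lebesgue" by (rule cube_const_measurable[OF const])
  have sq: "square_integrable ?u" by (rule bounded_supported_square_integrable[OF m supp bound])
  have "(LINT y|lebesgue. ?u y) = 0"
    unfolding local_increment_cond_avg[OF c]
    using cond_avg_integral[OF stopping_gen_const gi] by simp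
  then show ?thesis unfolding block_fun_def using sq supp const by blast
qed

text \<open>The function over the larger cube is constant on the smaller one, where the other has mean zero.\<close>

lemma block_fun_orthogonal_finer:
  assumes u: "block_fun t a b z u" and v: "block_fun t a' b' z' v" and b: "b \<le> a'"
  shows "(LINT y|lebesgue. u y * v y) = 0"
proof (cases "\<exists>w. u w * v w \<noteq> 0")
  case False
  then have "(\<lambda>y. u y * v y) = (\<lambda>_. 0)" by blast
  then show ?thesis by simp
next
  case True
  then obtain w where "v w \<noteq> 0" by auto
  then have w: "w \<in> cube_at t a' z'" using v unfolding block_fun_def by blast
  have "u y * v y = u w * v y" for y
  proof (cases "v y = 0")
    case False
    then have "y \<in> cube_at t a' z'" using v unfolding block_fun_def by blast
    then have "y \<in> cube_at t a' w" using w by (simp add: mem_cube_at)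
    then have "y \<in> cube_at t b w" using cube_at_antimono[OF b] by blast
    then have "u y = u w" using u unfolding block_fun_def by blast
    then show ?thesis by simp
  qed simp
  then have "(\<lambda>y. u y * v y) = (\<lambda>y. u w * v y)" by (rule ext)
  then have "(LINT y|lebesgue. u y * v y) = u w * (LINT y|lebesgue. v y)" by simp
  then show ?thesis using v unfolding block_fun_def by simp
qed

lemma block_fun_orthogonal:
  fixes gam :: "int \<Rightarrow> int"
  assumes gam: "\<And>i j. i < j \<Longrightarrow> gam i < gam j"
    and u: "block_fun t (gam i) (gam (i + 1)) z u" and v: "block_fun t (gam j) (gam (j + 1)) z' v"
    and ne: "cube_at t (gam i) z \<noteq> cube_at t (gam j) z'"
  shows "(LINT y|lebesgue. u y * v y) = 0"
proof -
  have gle: "gam k \<le> gam l" if "k \<le> l" for k l using gam[of k l] that by (cases "k = l") auto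
  consider "i < j" | "j < i" | "i = j" by linarith
  then show ?thesis
  proof cases
    case 1
    then show ?thesis using gle[of "i + 1" j] by (intro block_fun_orthogonal_finer[OF u v]) auto
  next
    case 2
    then have "(LINT y|lebesgue. v y * u y) = 0" using gle[of "j + 1" i] by (intro block_fun_orthogonal_finer[OF v u]) auto
    then show ?thesis by (simp add: mult.commute)
  next
    case 3
    have "u y * v y = 0" for y
    proof (rule ccontr)
      assume "u y * v y \<noteq> 0"
      then have "y \<in> cube_at t (gam i) z" "y \<in> cube_at t (gam j) z'" using u v unfolding block_fun_def by auto
      then have "cube_at t (gam i) z = cube_at t (gam j) z'" unfolding 3 using cube_at_eq by blast
      then show False using ne by blast
    qed
    then have "(\<lambda>y. u y * v y) = (\<lambda>_. 0)" by (rule ext)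
    then show ?thesis by simp
  qed
qed

lemma integral_square_sum_orthogonal:
  assumes fin: "finite I" and u: "\<And>i. i \<in> I \<Longrightarrow> square_integrable (u i)"
    and orth: "\<And>i j. i \<in> I \<Longrightarrow> j \<in> I \<Longrightarrow> i \<noteq> j \<Longrightarrow> (LINT y|lebesgue. u i y * u j y) = 0"
  shows "(LINT y|lebesgue. (\<Sum>i\<in>I. u i y)\<^sup>2) = (\<Sum>i\<in>I. LINT y|lebesgue. (u i y)\<^sup>2)"
proof -
  have "(LINT y|lebesgue. (\<Sum>i\<in>I. u i y)\<^sup>2) = (LINT y|lebesgue. (\<Sum>i\<in>I. \<Sum>j\<in>I. u i y * u j y))"
    by (simp add: power2_eq_square sum_product)
  also have "\<dots> = (\<Sum>i\<in>I. \<Sum>j\<in>I. LINT y|lebesgue. u i y * u j y)"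
  proof -
    have "(LINT y|lebesgue. (\<Sum>i\<in>I. \<Sum>j\<in>I. u i y * u j y)) = (\<Sum>i\<in>I. LINT y|lebesgue. (\<Sum>j\<in>I. u i y * u j y))"
      by (intro Bochner_Integration.integral_sum Bochner_Integration.integrable_sum square_integrable_mult u)
    also have "\<dots> = (\<Sum>i\<in>I. \<Sum>j\<in>I. LINT y|lebesgue. u i y * u j y)"
      by (rule sum.cong[OF refl], intro Bochner_Integration.integral_sum square_integrable_mult u)
    finally show ?thesis .
  qed
  also have "\<dots> = (\<Sum>i\<in>I. LINT y|lebesgue. (u i y)\<^sup>2)"
  proof (rule sum.cong)
    fix i assume i: "i \<in> I"
    have "(\<Sum>j\<in>I. LINT y|lebesgue. u i y * u j y) = (\<Sum>j\<in>I. if j = i then (LINT y|lebesgue. (u i y)\<^sup>2) else 0)"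
    proof (rule sum.cong)
      fix j assume "j \<in> I"
      then show "(LINT y|lebesgue. u i y * u j y) = (if j = i then (LINT y|lebesgue. (u i y)\<^sup>2) else 0)"
        using orth[OF i, of j] by (cases "j = i") (auto simp: power2_eq_square)
    qed simp
    then show "(\<Sum>j\<in>I. LINT y|lebesgue. u i y * u j y) = (LINT y|lebesgue. (u i y)\<^sup>2)"
      using fin i by (simp add: sum.delta)
  qed simp
  finally show ?thesis .
qed

lemma bessel_inequality:
  assumes fin: "finite I" and g: "square_integrable g" and u: "\<And>i. i \<in> I \<Longrightarrow> square_integrable (u i)"
    and orth: "\<And>i j. i \<in> I \<Longrightarrow> j \<in> I \<Longrightarrow> i \<noteq> j \<Longrightarrow> (LINT y|lebesgue. u i y * u j y) = 0"
    and proj: "\<And>i. i \<in> I \<Longrightarrow> (LINT y|lebesgue. g y * u i y) = (LINT y|lebesgue. (u i y)\<^sup>2)"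
  shows "(\<Sum>i\<in>I. LINT y|lebesgue. (u i y)\<^sup>2) \<le> (LINT y|lebesgue. (g y)\<^sup>2)"
proof -
  define s where "s y = (\<Sum>i\<in>I. u i y)" for y
  have s: "square_integrable s" unfolding s_def using u by (rule square_integrable_sum)
  have s2: "(LINT y|lebesgue. (s y)\<^sup>2) = (\<Sum>i\<in>I. LINT y|lebesgue. (u i y)\<^sup>2)"
    unfolding s_def by (rule integral_square_sum_orthogonal[OF fin u orth])
  have "(LINT y|lebesgue. g y * s y) = (\<Sum>i\<in>I. LINT y|lebesgue. g y * u i y)"
    unfolding s_def sum_distrib_left using square_integrable_mult[OF g u] by (intro Bochner_Integration.integral_sum)
  then have gs: "(LINT y|lebesgue. g y * s y) = (LINT y|lebesgue. (s y)\<^sup>2)" using proj s2 by simp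
  have i1: "integrable lebesgue (\<lambda>y. (g y)\<^sup>2)" "integrable lebesgue (\<lambda>y. (s y)\<^sup>2)"
    using g s by (simp_all add: square_integrable_def)
  have i2: "integrable lebesgue (\<lambda>y. g y * s y)" by (rule square_integrable_mult[OF g s])
  have "0 \<le> (LINT y|lebesgue. (g y - s y)\<^sup>2)" by simp
  also have "\<dots> = (LINT y|lebesgue. ((g y)\<^sup>2 + (s y)\<^sup>2) - 2 * (g y * s y))"
    by (simp add: power2_diff mult.assoc)
  also have "\<dots> = (LINT y|lebesgue. (g y)\<^sup>2) + (LINT y|lebesgue. (s y)\<^sup>2) - 2 * (LINT y|lebesgue. g y * s y)"
    using i1 i2 by simp
  finally show ?thesis using gs s2 by simp
qed

text \<open>A function that is constant on the cubes of generation \<open>b\<close> and has mean zero on the cube does not distinguish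
\<open>g\<close> from its martingale difference.\<close>

lemma local_increment_projection:
  fixes t z :: "real^'n" and g :: "real^'n \<Rightarrow> real"
  assumes ab: "a \<le> b" and g: "square_integrable g"
  defines "D \<equiv> local_increment t a a b z g"
  shows "(LINT y|lebesgue. g y * D y) = (LINT y|lebesgue. (D y)\<^sup>2)"
    "\<And>h. square_integrable h \<Longrightarrow> (\<And>y. h y \<noteq> 0 \<Longrightarrow> y \<in> cube_at t a z) \<Longrightarrow>
       (\<And>y y'. y' \<in> cube_at t b y \<Longrightarrow> h y' = h y) \<Longrightarrow> (LINT y|lebesgue. h y) = 0 \<Longrightarrow>
       (LINT y|lebesgue. h y * g y) = (LINT y|lebesgue. h y * D y)"
proof -
  let ?P = "cube_at t a z"
  let ?g = "\<lambda>y. indicat_real ?P y * g y"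
  have sg: "set_integrable lebesgue ?P g" by (rule square_integrable_set_integrable[OF g]) simp
  then have gi: "integrable lebesgue ?g" by (simp add: set_integrable_def)
  have D: "block_fun t a b z D" unfolding D_def by (rule local_increment_block_fun[OF order_refl ab sg])
  then have Ds: "square_integrable D" unfolding block_fun_def by blast
  show main: "(LINT y|lebesgue. h y * g y) = (LINT y|lebesgue. h y * D y)"
    if h: "square_integrable h" "\<And>y. h y \<noteq> 0 \<Longrightarrow> y \<in> ?P" "\<And>y y'. y' \<in> cube_at t b y \<Longrightarrow> h y' = h y"
      "(LINT y|lebesgue. h y) = 0" for h
  proof -
    have hg: "h y * ?g y = h y * g y" for y using h(2)[of y] by (cases "h y = 0") auto
    have hgi: "integrable lebesgue (\<lambda>y. h y * ?g y)" unfolding hg by (rule square_integrable_mult[OF h(1) g])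
    have hi: "integrable lebesgue h"
      using h by (intro block_fun_integrable[of t a b z]) (auto simp: block_fun_def)
    have "(LINT y|lebesgue. h y * g y) = (LINT y|lebesgue. h y * cond_avg t (\<lambda>_. b) ?g y)"
      using integral_mult_cond_avg(2)[OF stopping_gen_const gi hgi h(3)] unfolding hg by simp
    also have "\<dots> = (LINT y|lebesgue. h y * D y + average g ?P * h y)"
    proof (rule Bochner_Integration.integral_cong)
      fix y
      show "h y * cond_avg t (\<lambda>_. b) ?g y = h y * D y + average g ?P * h y"
      proof (cases "h y = 0")
        case False
        then have y: "y \<in> ?P" by (rule h(2))
        have "cond_avg t (\<lambda>_. b) ?g y = D y + average g ?P"
          unfolding cond_avg_def average_restrict[OF ab] D_def local_increment_def using y cube_at_eq[OF y] by simp
        then show ?thesis by (simp add: algebra_simps)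
      qed simp
    qed simp
    also have "\<dots> = (LINT y|lebesgue. h y * D y)"
      using hi h(4) square_integrable_mult[OF h(1) Ds] by simp
    finally show ?thesis .
  qed
  show "(LINT y|lebesgue. g y * D y) = (LINT y|lebesgue. (D y)\<^sup>2)"
    using main[of D] D unfolding block_fun_def by (simp add: power2_eq_square mult.commute)
qed

lemma finite_dyadic_index_cube:
  assumes "a \<le> b"
  shows "finite (dyadic_index t b ` cube_at t a z)"
proof -
  obtain s where s: "a = b - int s" using assms zle_iff_zadd[of a b] by auto
  define S where "S i = {dyadic_index t a z $ i * 2 ^ s .. dyadic_index t a z $ i * 2 ^ s + 2 ^ s}" for i
  have "finite {f :: 'a \<Rightarrow> int. \<forall>i. f i \<in> S i}"
  proof -
    have "{f :: 'a \<Rightarrow> int. \<forall>i. f i \<in> S i} = PiE UNIV S" by (auto simp: PiE_def extensional_def Pi_def)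
    moreover have "finite (PiE UNIV S)" by (intro finite_PiE) (simp_all add: S_def)
    ultimately show ?thesis by (simp only:)
  qed
  then have "finite (vec_nth -` {f :: 'a \<Rightarrow> int. \<forall>i. f i \<in> S i})"
    by (rule finite_vimageI) (simp add: inj_def vec_nth_inject)
  moreover have "dyadic_index t b ` cube_at t a z \<subseteq> vec_nth -` {f. \<forall>i. f i \<in> S i}"
  proof
    fix m assume "m \<in> dyadic_index t b ` cube_at t a z"
    then obtain y where y: "dyadic_index t a y = dyadic_index t a z" "m = dyadic_index t b y" by (auto simp: mem_cube_at)
    have "m $ i \<in> S i" for i
    proof -
      have "dyadic_index t a z $ i = m $ i div 2 ^ s"
        using dyadic_index_div[of t b s y i] y s by simp
      then have "m $ i = dyadic_index t a z $ i * 2 ^ s + m $ i mod 2 ^ s" by (simp add: mult.commute)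
      moreover have "0 \<le> m $ i mod 2 ^ s" "m $ i mod 2 ^ s < 2 ^ s" by simp_all
      ultimately show ?thesis unfolding S_def atLeastAtMost_iff by linarith
    qed
    then show "m \<in> vec_nth -` {f. \<forall>i. f i \<in> S i}" by simp
  qed
  ultimately show ?thesis by (rule finite_subset[rotated])
qed

text \<open>Written as a finite sum, the integral over one variable of a kernel can be exchanged with the integral over
the other one by linearity.\<close>

lemma integral_by_children:
  fixes u :: "real^'n \<Rightarrow> real"
  assumes ab: "a \<le> b" and supp: "\<And>y. u y \<noteq> 0 \<Longrightarrow> y \<in> cube_at t a z"
    and const: "\<And>y y'. y' \<in> cube_at t b y \<Longrightarrow> u y' = u y"
  defines "rep \<equiv> \<lambda>m. SOME y. y \<in> cube_at t a z \<and> dyadic_index t b y = m"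
  shows "(LINT y|lebesgue. u y) = (\<Sum>m\<in>dyadic_index t b ` cube_at t a z. measure lebesgue (cube_at t b z) * u (rep m))"
proof -
  let ?I = "dyadic_index t b ` cube_at t a z"
  have fin: "finite ?I" by (rule finite_dyadic_index_cube[OF ab])
  have rep: "rep m \<in> cube_at t a z" "dyadic_index t b (rep m) = m" if "m \<in> ?I" for m
  proof -
    have "\<exists>y. y \<in> cube_at t a z \<and> dyadic_index t b y = m" using that by blast
    then have "rep m \<in> cube_at t a z \<and> dyadic_index t b (rep m) = m" unfolding rep_def by (rule someI_ex)
    then show "rep m \<in> cube_at t a z" "dyadic_index t b (rep m) = m" by blast+
  qed
  have eq: "u y = (\<Sum>m\<in>?I. u (rep m) * indicator (cube_at t b (rep m)) y)" for y
  proof (cases "y \<in> cube_at t a z")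
    case True
    then have mI: "dyadic_index t b y \<in> ?I" by blast
    have "(\<Sum>m\<in>?I. u (rep m) * indicator (cube_at t b (rep m)) y) = (\<Sum>m\<in>?I. if m = dyadic_index t b y then u (rep m) else 0)"
      using rep(2) by (intro sum.cong) (auto simp: mem_cube_at indicator_def)
    also have "\<dots> = u (rep (dyadic_index t b y))" using fin mI by (simp add: sum.delta)
    also have "\<dots> = u y" using rep(2)[OF mI] by (intro const) (simp add: mem_cube_at)
    finally show ?thesis by simp
  next
    case False
    have "indicator (cube_at t b (rep m)) y = (0::real)" if "m \<in> ?I" for m
    proof -
      have "y \<notin> cube_at t b (rep m)"
      proof
        assume "y \<in> cube_at t b (rep m)"
        then have "y \<in> cube_at t a (rep m)" using cube_at_antimono[OF ab] by blast
        then show False using False rep(1)[OF that] by (simp add: mem_cube_at)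
      qed
      then show ?thesis by simp
    qed
    then have "(\<Sum>m\<in>?I. u (rep m) * indicator (cube_at t b (rep m)) y) = 0" by (intro sum.neutral) simp
    moreover have "u y = 0" using False supp by blast
    ultimately show ?thesis by simp
  qed
  have int: "integrable lebesgue (\<lambda>y. u (rep m) * indicat_real (cube_at t b (rep m)) y)" for m
    using fmeasurable_cube_at[of t b "rep m"] by (intro integrable_mult_right) (simp add: lmeasurable_iff_integrable)
  have "(LINT y|lebesgue. u y) = (LINT y|lebesgue. (\<Sum>m\<in>?I. u (rep m) * indicat_real (cube_at t b (rep m)) y))"
    by (rule Bochner_Integration.integral_cong[OF refl eq])
  also have "\<dots> = (\<Sum>m\<in>?I. LINT y|lebesgue. u (rep m) * indicat_real (cube_at t b (rep m)) y)"
    using int by (intro Bochner_Integration.integral_sum)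
  also have "\<dots> = (\<Sum>m\<in>?I. measure lebesgue (cube_at t b z) * u (rep m))"
    by (intro sum.cong) (simp_all add: measure_cube_at)
  finally show ?thesis .
qed

section \<open>Paraproduct blocks and cancelling kernels\<close>

lemma dyadic_desc_cube:
  fixes t :: "real^'n"
  shows "dyadic_desc t s (cube_at t a z) = cube_at t (a + int s) ` cube_at t a z"
proof (intro set_eqI iffI)
  fix R assume "R \<in> dyadic_desc t s (cube_at t a z)"
  then obtain j where j: "cube_at t a z \<in> dyadic_gen t j" "R \<in> dyadic_gen t (j + int s)" "R \<subseteq> cube_at t a z"
    unfolding dyadic_desc_def by blast
  have ja: "a = j" using j(1) cube_at_inj_gen unfolding dyadic_gen_eq by blast
  obtain y where y: "R = cube_at t (j + int s) y" using j(2) unfolding dyadic_gen_eq by blast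
  have "y \<in> cube_at t a z" using j(3) self_in_cube_at[of y t "j + int s"] unfolding y by blast
  then show "R \<in> cube_at t (a + int s) ` cube_at t a z" unfolding y ja by blast
next
  fix R assume "R \<in> cube_at t (a + int s) ` cube_at t a z"
  then obtain y where y: "R = cube_at t (a + int s) y" "y \<in> cube_at t a z" by blast
  have "R \<subseteq> cube_at t a z" using cube_at_antimono[of a "a + int s" t y] cube_at_eq[OF y(2)] unfolding y(1) by simp
  then show "R \<in> dyadic_desc t s (cube_at t a z)"
    unfolding dyadic_desc_def dyadic_gen_eq using y(1) by blast
qed

lemma finite_dyadic_desc: "finite (dyadic_desc t s (cube_at t a z))"
proof -
  have "dyadic_desc t s (cube_at t a z) = (\<lambda>m. {y. dyadic_index t (a + int s) y = m}) ` dyadic_index t (a + int s) ` cube_at t a z"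
    by (simp only: dyadic_desc_cube image_image) (simp add: cube_at_def)
  then show ?thesis using finite_dyadic_index_cube[of a "a + int s" t z] by simp
qed

lemma sum_dyadic_desc:
  fixes h :: "(real^'n) set \<Rightarrow> real"
  shows "(\<Sum>R\<in>dyadic_desc t s (cube_at t a z). h R * indicator R x)
    = indicator (cube_at t a z) x * h (cube_at t (a + int s) x)"
proof (cases "x \<in> cube_at t a z")
  case True
  let ?R = "cube_at t (a + int s) x"
  have R: "?R \<in> dyadic_desc t s (cube_at t a z)" unfolding dyadic_desc_cube using True by blast
  have "(\<Sum>R\<in>dyadic_desc t s (cube_at t a z). h R * indicator R x) = (\<Sum>R\<in>dyadic_desc t s (cube_at t a z). if R = ?R then h ?R else 0)"
  proof (rule sum.cong[OF refl])
    fix R assume "R \<in> dyadic_desc t s (cube_at t a z)"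
    then obtain y where y: "R = cube_at t (a + int s) y" unfolding dyadic_desc_cube by blast
    show "h R * indicator R x = (if R = ?R then h ?R else 0)"
    proof (cases "x \<in> R")
      case True
      then have "R = ?R" using cube_at_eq unfolding y by blast
      then show ?thesis by simp
    next
      case False
      then have "R \<noteq> ?R" by (metis self_in_cube_at)
      then show ?thesis using False by simp
    qed
  qed
  also have "\<dots> = h ?R" using R finite_dyadic_desc[of t s a z] by (simp add: sum.delta)
  finally show ?thesis using True by simp
next
  case False
  have "x \<notin> R" if "R \<in> dyadic_desc t s (cube_at t a z)" for R
    using that False unfolding dyadic_desc_def by blast
  then show ?thesis using False by (simp add: sum.neutral)
qed

lemma martingale_diff_cube:
  "martingale_diff t b (cube_at t c y) x
    = (average b (cube_at t (c + 1) x) - average b (cube_at t c x)) * indicator (cube_at t c y) x"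
proof -
  have e: "average b (cube_at t c y) * indicator (cube_at t c y) x = average b (cube_at t c x) * indicator (cube_at t c y) x"
    using cube_at_eq[of x t c y] by (cases "x \<in> cube_at t c y") auto
  have s: "(\<Sum>S\<in>dyadic_desc t 1 (cube_at t c y). average b S * indicator S x)
      = indicator (cube_at t c y) x * average b (cube_at t (c + 1) x)"
    using sum_dyadic_desc[of "average b" x t 1 c y] by simp
  show ?thesis
    unfolding martingale_diff_def s e by (simp add: algebra_simps)
qed

lemma paraproduct_block_cube:
  "paraproduct_block t r b (cube_at t a z) f x
    = average f (cube_at t a z) * local_increment t a (a + int r) (a + int r + 1) z b x"
proof -
  let ?c = "a + int r"
  have "(\<Sum>R\<in>dyadic_desc t r (cube_at t a z). martingale_diff t b R x)
      = (\<Sum>R\<in>dyadic_desc t r (cube_at t a z). (average b (cube_at t (?c + 1) x) - average b (cube_at t ?c x)) * indicator R x)"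
  proof (rule sum.cong[OF refl])
    fix R assume "R \<in> dyadic_desc t r (cube_at t a z)"
    then obtain y where "R = cube_at t ?c y" unfolding dyadic_desc_cube by blast
    then show "martingale_diff t b R x = (average b (cube_at t (?c + 1) x) - average b (cube_at t ?c x)) * indicator R x"
      by (simp only: martingale_diff_cube)
  qed
  also have "\<dots> = local_increment t a ?c (?c + 1) z b x"
    unfolding local_increment_def by (rule sum_dyadic_desc[of "\<lambda>R. average b (cube_at t (?c + 1) x) - average b (cube_at t ?c x)"])
  finally show ?thesis unfolding paraproduct_block_def by simp
qed

lemma block_fun_cmult:
  assumes "block_fun t a b z u"
  shows "block_fun t a b z (\<lambda>x. c * u x)"
  using assms unfolding block_fun_def by (simp add: square_integrable_cmult)

lemma AE_zero_cube_const:
  fixes \<phi> :: "real^'n \<Rightarrow> real"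
  assumes ae: "AE x in lebesgue. \<phi> x = 0" and const: "\<And>x y. y \<in> cube_at t b x \<Longrightarrow> \<phi> y = \<phi> x"
  shows "\<phi> x = 0"
proof (rule ccontr)
  assume "\<phi> x \<noteq> 0"
  then have sub: "cube_at t b x \<subseteq> {x\<in>space lebesgue. \<phi> x \<noteq> 0}" using const by auto
  obtain N where N: "{x\<in>space lebesgue. \<phi> x \<noteq> 0} \<subseteq> N" "emeasure lebesgue N = 0" "N \<in> sets lebesgue"
    using AE_E[OF ae] by blast
  have "emeasure lebesgue (cube_at t b x) \<le> emeasure lebesgue N" using sub N by (intro emeasure_mono) auto
  then have "emeasure lebesgue (cube_at t b x) = 0" using N(2) by simp
  then show False using measure_cube_at_pos[of t b x] by (simp add: measure_def)
qed

text \<open>The kernel of one block of a big Haar shift, with both cancellation conditions stated for every point; they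
hold everywhere once they hold almost everywhere, since the kernel is constant on cubes.\<close>

locale cancelling_kernel =
  fixes t z :: "real^'n" and a b :: int and K :: "real^'n \<Rightarrow> real^'n \<Rightarrow> real"
  assumes ab: "a \<le> b"
    and support: "\<And>x y. K x y \<noteq> 0 \<Longrightarrow> x \<in> cube_at t a z \<and> y \<in> cube_at t a z"
    and const: "\<And>x y x' y'. x' \<in> cube_at t b x \<Longrightarrow> y' \<in> cube_at t b y \<Longrightarrow> K x' y' = K x y"
    and bound: "\<And>x y. \<bar>K x y\<bar> \<le> 1 / measure lebesgue (cube_at t a z)"
    and cancel_right: "\<And>x. (LINT y|lebesgue. K x y) = 0"
    and cancel_left: "\<And>y. (LINT x|lebesgue. K x y) = 0"
begin

lemma row_square_integrable: "square_integrable (K x)"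
proof (rule bounded_supported_square_integrable)
  show "K x \<in> borel_measurable lebesgue"
    by (rule cube_const_measurable[where t=t and j=b]) (rule const[OF self_in_cube_at])
  show "K x y \<noteq> 0 \<Longrightarrow> y \<in> cube_at t a z" for y using support by blast
qed (rule bound)

lemma operator_const:
  assumes "x' \<in> cube_at t b x"
  shows "integral_operator K g x' = integral_operator K g x"
proof -
  have "K x' = K x" by (rule ext, rule const[OF assms self_in_cube_at])
  then show ?thesis unfolding integral_operator_def by simp
qed

lemma operator_support: "integral_operator K g x \<noteq> 0 \<Longrightarrow> x \<in> cube_at t a z"
proof (rule ccontr)
  assume x: "x \<notin> cube_at t a z" and n: "integral_operator K g x \<noteq> 0"
  have "K x = (\<lambda>_. 0)" using support x by blast
  then show False using n unfolding integral_operator_def by simp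
qed

lemma operator_block_fun:
  assumes g: "square_integrable g" and u: "square_integrable (integral_operator K g)"
  shows "block_fun t a b z (integral_operator K g)"
proof -
  let ?I = "dyadic_index t b ` cube_at t a z"
  define rep where "rep m = (SOME y. y \<in> cube_at t a z \<and> dyadic_index t b y = m)" for m
  let ?V = "measure lebesgue (cube_at t b z)"
  have "(LINT x|lebesgue. integral_operator K g x) = (\<Sum>m\<in>?I. ?V * integral_operator K g (rep m))"
    unfolding rep_def by (rule integral_by_children[OF ab operator_support operator_const])
  also have "\<dots> = (\<Sum>m\<in>?I. LINT y|lebesgue. ?V * (K (rep m) y * g y))"
    unfolding integral_operator_def by simp
  also have "\<dots> = (LINT y|lebesgue. (\<Sum>m\<in>?I. ?V * (K (rep m) y * g y)))"
    using square_integrable_mult[OF row_square_integrable g]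
    by (intro Bochner_Integration.integral_sum[symmetric] integrable_mult_right)
  also have "\<dots> = (LINT y|(lebesgue :: (real^'n) measure). 0)"
  proof (rule Bochner_Integration.integral_cong[OF refl])
    fix y
    have "(\<Sum>m\<in>?I. ?V * K (rep m) y) = (LINT x|lebesgue. K x y)"
      unfolding rep_def
      by (rule integral_by_children[symmetric, OF ab, where u="\<lambda>x. K x y"])
        (use support in blast, rule const[OF _ self_in_cube_at])
    then have "(\<Sum>m\<in>?I. ?V * K (rep m) y) * g y = 0" using cancel_left by simp
    then show "(\<Sum>m\<in>?I. ?V * (K (rep m) y * g y)) = 0" by (simp add: sum_distrib_right mult.assoc)
  qed
  finally have "(LINT x|lebesgue. integral_operator K g x) = 0" by simp
  then show ?thesis unfolding block_fun_def using u operator_support operator_const by blast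
qed

text \<open>By \<open>local_increment_projection\<close> the block applied to \<open>g\<close> equals the block applied to the martingale
difference; its values are bounded by an average of that difference, and Jensen's inequality applies.\<close>

lemma operator_norm_le_increment:
  assumes g: "square_integrable g" and u: "square_integrable (integral_operator K g)"
  defines "D \<equiv> local_increment t a a b z g"
  shows "(LINT x|lebesgue. (integral_operator K g x)\<^sup>2) \<le> (LINT x|lebesgue. (D x)\<^sup>2)"
proof -
  let ?P = "cube_at t a z"
  have mpos: "measure lebesgue ?P > 0" by (rule measure_cube_at_pos)
  have Db: "block_fun t a b z D"
    unfolding D_def by (intro local_increment_block_fun order_refl ab square_integrable_set_integrable[OF g]) simp
  have Ds: "square_integrable D" and Dsupp: "\<And>y. D y \<noteq> 0 \<Longrightarrow> y \<in> ?P" using Db unfolding block_fun_def by blast+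
  have Dabs: "square_integrable (\<lambda>y. \<bar>D y\<bar>)" using Ds unfolding square_integrable_def by auto
  have D2: "integrable lebesgue (\<lambda>y. (D y)\<^sup>2)" using Ds unfolding square_integrable_def by blast
  have point: "(integral_operator K g x)\<^sup>2 \<le> indicat_real ?P x * ((LINT y|lebesgue. (D y)\<^sup>2) / measure lebesgue ?P)" for x
  proof (cases "x \<in> ?P")
    case False
    then have "integral_operator K g x = 0" using operator_support by blast
    then show ?thesis using False by simp
  next
    case True
    have "integral_operator K g x = (LINT y|lebesgue. K x y * D y)"
      unfolding integral_operator_def D_def
    proof (rule local_increment_projection(2)[OF ab g row_square_integrable])
      show "K x y \<noteq> 0 \<Longrightarrow> y \<in> ?P" for y using support by blast
      show "y' \<in> cube_at t b y \<Longrightarrow> K x y' = K x y" for y y' by (rule const[OF self_in_cube_at])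
    qed (rule cancel_right)
    then have "\<bar>integral_operator K g x\<bar> \<le> (LINT y|lebesgue. \<bar>K x y * D y\<bar>)" by (simp add: integral_abs_bound)
    also have "\<dots> \<le> (LINT y|lebesgue. (1 / measure lebesgue ?P) * \<bar>D y\<bar>)"
    proof (rule integral_mono)
      show "integrable lebesgue (\<lambda>y. \<bar>K x y * D y\<bar>)" using square_integrable_mult[OF row_square_integrable Ds] by simp
      show "integrable lebesgue (\<lambda>y. (1 / measure lebesgue ?P) * \<bar>D y\<bar>)" using block_fun_integrable[OF Db] by simp
      show "\<bar>K x y * D y\<bar> \<le> (1 / measure lebesgue ?P) * \<bar>D y\<bar>" for y
        unfolding abs_mult using bound by (intro mult_right_mono) auto
    qed
    also have "\<dots> = average (\<lambda>y. \<bar>D y\<bar>) ?P" using Dsupp by (subst average_eq_integral) auto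
    finally have "\<bar>integral_operator K g x\<bar> \<le> average (\<lambda>y. \<bar>D y\<bar>) ?P" .
    then have "(integral_operator K g x)\<^sup>2 \<le> (average (\<lambda>y. \<bar>D y\<bar>) ?P)\<^sup>2"
      by (metis abs_ge_zero power2_abs power_mono)
    also have "\<dots> \<le> average (\<lambda>y. \<bar>D y\<bar>\<^sup>2) ?P" by (rule average_square_le[OF Dabs])
    also have "\<dots> = (LINT y|lebesgue. (D y)\<^sup>2) / measure lebesgue ?P" using Dsupp by (subst average_eq_integral) auto
    finally show ?thesis using True by simp
  qed
  have "(LINT x|lebesgue. (integral_operator K g x)\<^sup>2) \<le> (LINT x|lebesgue. indicat_real ?P x * ((LINT y|lebesgue. (D y)\<^sup>2) / measure lebesgue ?P))"
  proof (rule integral_mono)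
    show "integrable lebesgue (\<lambda>x. (integral_operator K g x)\<^sup>2)" using u unfolding square_integrable_def by blast
    show "integrable lebesgue (\<lambda>x. indicat_real ?P x * ((LINT y|lebesgue. (D y)\<^sup>2) / measure lebesgue ?P))"
      using fmeasurable_cube_at[of t a z] by (intro integrable_mult_left) (simp add: lmeasurable_iff_integrable)
  qed (rule point)
  also have "\<dots> = (LINT y|lebesgue. (D y)\<^sup>2)" using mpos by simp
  finally show ?thesis .
qed

end

text \<open>The blocks applied to \<open>g\<close> are orthogonal, each is dominated by a martingale difference of \<open>g\<close>, and the
martingale differences are orthogonal as well, so Bessel's inequality bounds all finite sums by \<open>g\<close>. The
bound passes to the limit in \<open>L\<^sup>2\<close>.\<close>

theorem L2_contraction:
  fixes t :: "real^'n" and \<T> :: "(real^'n) set \<Rightarrow> 'n operator" and gam :: "int \<Rightarrow> int"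
  assumes gam: "\<And>i j. i < j \<Longrightarrow> gam i < gam j"
    and sum: "L2_operator_sum (dyadic_lattice t) \<T> T" and g: "square_integrable g"
    and off: "\<And>P. P \<in> dyadic_lattice t \<Longrightarrow> (\<And>i z. P \<noteq> cube_at t (gam i) z) \<Longrightarrow> AE x in lebesgue. \<T> P g x = 0"
    and blk: "\<And>i z. block_fun t (gam i) (gam (i + 1)) z (\<T> (cube_at t (gam i) z) g)"
    and le: "\<And>i z. (LINT x|lebesgue. (\<T> (cube_at t (gam i) z) g x)\<^sup>2)
      \<le> (LINT x|lebesgue. (local_increment t (gam i) (gam i) (gam (i + 1)) z g x)\<^sup>2)"
  shows "(LINT x|lebesgue. (T g x)\<^sup>2) \<le> (LINT x|lebesgue. (g x)\<^sup>2)"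
proof -
  let ?D = "dyadic_lattice t"
  let ?lev = "\<lambda>P. \<exists>i z. P = cube_at t (gam i) z"
  let ?h = "\<lambda>F x. \<Sum>P\<in>F. \<T> P g x"
  let ?G = "LINT x|lebesgue. (g x)\<^sup>2"
  have G0: "0 \<le> ?G" by simp
  have TP: "square_integrable (\<T> P g)" if "P \<in> ?D" for P using sum g that unfolding L2_operator_sum_def by blast
  have Tg: "square_integrable (T g)" using sum g unfolding L2_operator_sum_def by blast
  have "\<forall>P. \<exists>iz. ?lev P \<longrightarrow> P = cube_at t (gam (fst iz)) (snd iz)" by auto
  then obtain iz where iz: "\<And>P. ?lev P \<Longrightarrow> P = cube_at t (gam (fst (iz P))) (snd (iz P))" by metis
  have fin_le: "(LINT x|lebesgue. (?h F x)\<^sup>2) \<le> ?G" if F: "finite F" "F \<subseteq> ?D" for F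
  proof -
    define F1 where "F1 = {P\<in>F. ?lev P}"
    have F1: "finite F1" "F1 \<subseteq> F" "\<And>P. P \<in> F1 \<Longrightarrow> ?lev P" unfolding F1_def using F by auto
    define i z where "i P = fst (iz P)" and "z P = snd (iz P)" for P
    have Pz: "P = cube_at t (gam (i P)) (z P)" if "P \<in> F1" for P
      unfolding i_def z_def by (rule iz[OF F1(3)[OF that]])
    define D where "D P = local_increment t (gam (i P)) (gam (i P)) (gam (i P + 1)) (z P) g" for P
    have ale: "gam k \<le> gam (k + 1)" for k using gam[of k "k + 1"] by simp
    have Db: "block_fun t (gam (i P)) (gam (i P + 1)) (z P) (D P)" for P
      unfolding D_def by (intro local_increment_block_fun order_refl ale square_integrable_set_integrable[OF g]) simp
    have ub: "block_fun t (gam (i P)) (gam (i P + 1)) (z P) (\<T> P g)" if "P \<in> F1" for P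
      using blk[of "i P" "z P"] Pz[OF that] by simp
    have neq: "cube_at t (gam (i P)) (z P) \<noteq> cube_at t (gam (i R)) (z R)" if "P \<in> F1" "R \<in> F1" "P \<noteq> R" for P R
      using that Pz by metis
    have "AE x in lebesgue. \<forall>P\<in>F - F1. \<T> P g x = 0"
    proof (rule AE_finite_allI)
      show "finite (F - F1)" using F by simp
      fix P assume P: "P \<in> F - F1"
      then have "\<And>i z. P \<noteq> cube_at t (gam i) z" unfolding F1_def by blast
      then show "AE x in lebesgue. \<T> P g x = 0" using P F by (intro off) auto
    qed
    then have ae: "AE x in lebesgue. (?h F x)\<^sup>2 = (?h F1 x)\<^sup>2"
    proof eventually_elim
      case (elim x)
      have "?h F x = ?h F1 x" using elim F(1) F1(2) by (intro sum.mono_neutral_right) auto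
      then show ?case by simp
    qed
    have sF: "square_integrable (?h F)" using TP F by (intro square_integrable_sum) blast
    have sF1: "square_integrable (?h F1)" using TP F F1(2) by (intro square_integrable_sum) blast
    have "(LINT x|lebesgue. (?h F x)\<^sup>2) = (LINT x|lebesgue. (?h F1 x)\<^sup>2)"
      using sF sF1 by (intro integral_cong_AE ae borel_measurable_power) (simp_all add: square_integrable_def)
    also have "\<dots> = (\<Sum>P\<in>F1. LINT x|lebesgue. (\<T> P g x)\<^sup>2)"
    proof (rule integral_square_sum_orthogonal[OF F1(1)])
      show "square_integrable (\<T> P g)" if "P \<in> F1" for P using TP F F1(2) that by blast
      show "(LINT y|lebesgue. \<T> P g y * \<T> R g y) = 0" if "P \<in> F1" "R \<in> F1" "P \<noteq> R" for P R
        by (rule block_fun_orthogonal[of gam, OF gam ub[OF that(1)] ub[OF that(2)] neq[OF that]])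
    qed
    also have "\<dots> \<le> (\<Sum>P\<in>F1. LINT x|lebesgue. (D P x)\<^sup>2)"
    proof (rule sum_mono)
      fix P assume "P \<in> F1"
      then show "(LINT x|lebesgue. (\<T> P g x)\<^sup>2) \<le> (LINT x|lebesgue. (D P x)\<^sup>2)"
        using le[of "i P" "z P"] Pz unfolding D_def by simp
    qed
    also have "\<dots> \<le> ?G"
    proof (rule bessel_inequality[OF F1(1) g])
      show "square_integrable (D P)" for P using Db unfolding block_fun_def by blast
      show "(LINT y|lebesgue. D P y * D R y) = 0" if "P \<in> F1" "R \<in> F1" "P \<noteq> R" for P R
        by (rule block_fun_orthogonal[of gam, OF gam Db Db neq[OF that]])
      show "(LINT y|lebesgue. g y * D P y) = (LINT y|lebesgue. (D P y)\<^sup>2)" for P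
        unfolding D_def by (rule local_increment_projection(1)[OF ale g])
    qed
    finally show ?thesis .
  qed
  let ?top = "finite_subsets_at_top ?D"
  let ?e = "\<lambda>F. L2_norm_fun (\<lambda>x. ?h F x - T g x)"
  have lim: "(?e \<longlongrightarrow> 0) ?top" using sum g unfolding L2_operator_sum_def by blast
  have step: "(LINT x|lebesgue. (T g x)\<^sup>2) \<le> (1 + \<delta>) * ?G" if \<delta>: "0 < \<delta>" for \<delta>
  proof -
    have "\<forall>\<^sub>F F in ?top. (LINT x|lebesgue. (T g x)\<^sup>2) \<le> (1 + \<delta>) * ?G + (1 + 1 / \<delta>) * (?e F)\<^sup>2"
      unfolding eventually_finite_subsets_at_top
    proof (intro exI[of _ "{}"] conjI allI impI)
      fix F assume "finite F \<and> {} \<subseteq> F \<and> F \<subseteq> ?D"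
      then have F: "finite F" "F \<subseteq> ?D" by blast+
      have h: "square_integrable (?h F)" using TP F by (intro square_integrable_sum) blast
      have d: "square_integrable (\<lambda>x. ?h F x - T g x)" by (rule square_integrable_diff[OF h Tg])
      have pt: "(T g x)\<^sup>2 \<le> (1 + \<delta>) * (?h F x)\<^sup>2 + (1 + 1 / \<delta>) * (?h F x - T g x)\<^sup>2" for x
      proof -
        define p q where "p = ?h F x" and "q = ?h F x - T g x"
        have "0 \<le> (\<delta> * p + q)\<^sup>2 / \<delta>" using \<delta> by simp
        also have "\<dots> = \<delta> * p\<^sup>2 + 2 * p * q + q\<^sup>2 / \<delta>" using \<delta> by (simp add: field_simps power2_eq_square)
        \<comment> \<open>a substitute for the triangle inequality in \<open>L\<^sup>2\<close>\<close>
        finally have "(p - q)\<^sup>2 \<le> (1 + \<delta>) * p\<^sup>2 + (1 + 1 / \<delta>) * q\<^sup>2" by (simp add: power2_diff algebra_simps)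
        then show ?thesis by (simp add: p_def q_def)
      qed
      have "(LINT x|lebesgue. (T g x)\<^sup>2) \<le> (LINT x|lebesgue. (1 + \<delta>) * (?h F x)\<^sup>2 + (1 + 1 / \<delta>) * (?h F x - T g x)\<^sup>2)"
        using h d Tg by (intro integral_mono pt) (auto simp: square_integrable_def)
      also have "\<dots> = (1 + \<delta>) * (LINT x|lebesgue. (?h F x)\<^sup>2) + (1 + 1 / \<delta>) * (LINT x|lebesgue. (?h F x - T g x)\<^sup>2)"
        using h d by (simp add: square_integrable_def)
      also have "\<dots> \<le> (1 + \<delta>) * ?G + (1 + 1 / \<delta>) * (?e F)\<^sup>2"
        using fin_le[OF F] \<delta> by (intro add_mono mult_left_mono) (auto simp: L2_norm_fun_def)
      finally show "(LINT x|lebesgue. (T g x)\<^sup>2) \<le> (1 + \<delta>) * ?G + (1 + 1 / \<delta>) * (?e F)\<^sup>2" .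
    qed auto
    moreover have "((\<lambda>F. (1 + \<delta>) * ?G + (1 + 1 / \<delta>) * (?e F)\<^sup>2) \<longlongrightarrow> (1 + \<delta>) * ?G + (1 + 1 / \<delta>) * 0\<^sup>2) ?top"
      by (intro tendsto_intros lim)
    ultimately have "(LINT x|lebesgue. (T g x)\<^sup>2) \<le> (1 + \<delta>) * ?G + (1 + 1 / \<delta>) * 0\<^sup>2"
      by (intro tendsto_lowerbound) auto
    then show ?thesis by simp
  qed
  show ?thesis
  proof (rule field_le_epsilon)
    fix e :: real assume e: "0 < e"
    have G1: "0 < ?G + 1" using G0 by (rule add_nonneg_pos) simp
    have "(LINT x|lebesgue. (T g x)\<^sup>2) \<le> (1 + e / (?G + 1)) * ?G" by (intro step divide_pos_pos e G1)
    also have "\<dots> = ?G + e * (?G / (?G + 1))" by (simp add: distrib_right)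
    also have "\<dots> \<le> ?G + e * 1" using e G1 by (intro add_left_mono mult_left_mono) (simp_all add: divide_le_eq_1)
    finally show "(LINT x|lebesgue. (T g x)\<^sup>2) \<le> ?G + e" by simp
  qed
qed

section \<open>Haar shifts and paraproducts satisfy the hypotheses\<close>

definition gen_level :: "nat \<Rightarrow> nat \<Rightarrow> int \<Rightarrow> int" where
  "gen_level r k j = int k + (int r + 1) * j"

lemma gen_level_Suc: "gen_level r k (j + 1) = gen_level r k j + int r + 1"
  by (simp add: gen_level_def algebra_simps)

lemma gen_level_less: "i < j \<Longrightarrow> gen_level r k i < gen_level r k j"
  by (simp add: gen_level_def)

lemma dyadic_lattice_cube: "cube_at t a z \<in> dyadic_lattice t"
  unfolding dyadic_lattice_def dyadic_gen_eq by blast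

lemma separated_off_level:
  assumes sep: "\<forall>Q\<in>dyadic_lattice t. \<not> L2_zero_operator (\<T> Q) \<longrightarrow>
        Q \<in> (\<Union>j::int. dyadic_gen t (int k + (int r + 1) * j))"
    and P: "P \<in> dyadic_lattice t" "\<And>i z. P \<noteq> cube_at t (gen_level r k i) z" and g: "square_integrable g"
  shows "AE x in lebesgue. \<T> P g x = 0"
proof -
  have "P \<notin> (\<Union>j::int. dyadic_gen t (int k + (int r + 1) * j))"
    using P(2) unfolding dyadic_gen_eq gen_level_def by blast
  then have "L2_zero_operator (\<T> P)" using sep P(1) by blast
  then show ?thesis using g unfolding L2_zero_operator_def by blast
qed

lemma haar_kernel_const:
  assumes K: "haar_kernel t r (cube_at t a z) K"
    and x: "x' \<in> cube_at t (a + int r + 1) x" and y: "y' \<in> cube_at t (a + int r + 1) y"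
  shows "K x' y' = K x y"
proof -
  let ?Q = "cube_at t a z"
  let ?b = "a + int r + 1"
  have supp: "K x y \<noteq> 0 \<Longrightarrow> x \<in> ?Q \<and> y \<in> ?Q" for x y using K unfolding haar_kernel_def by blast
  have same: "w' \<in> ?Q \<longleftrightarrow> w \<in> ?Q" if "w' \<in> cube_at t ?b w" for w w'
  proof -
    have "w' \<in> cube_at t a w" using that cube_at_antimono[of a ?b t w] by auto
    then show ?thesis by (simp add: mem_cube_at)
  qed
  show ?thesis
  proof (cases "x \<in> ?Q \<and> y \<in> ?Q")
    case True
    have d: "cube_at t ?b w \<in> dyadic_desc t (r + 1) ?Q" if "w \<in> ?Q" for w
    proof -
      have "a + int (r + 1) = ?b" by simp
      then show ?thesis unfolding dyadic_desc_cube using that by (simp only: image_eqI)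
    qed
    have "\<forall>R\<in>dyadic_desc t (r + 1) ?Q. \<forall>S\<in>dyadic_desc t (r + 1) ?Q. \<exists>c. \<forall>x\<in>R. \<forall>y\<in>S. K x y = c"
      using K unfolding haar_kernel_def by (elim conjE)
    from bspec[OF bspec[OF this d[OF conjunct1[OF True]]] d[OF conjunct2[OF True]]]
    obtain c where "\<forall>u\<in>cube_at t ?b x. \<forall>v\<in>cube_at t ?b y. K u v = c" by (rule exE)
    then have "K x' y' = c" "K x y = c" using x y self_in_cube_at by blast+
    then show ?thesis by simp
  next
    case False
    then have "K x y = 0" "K x' y' = 0" using supp same[OF x] same[OF y] by blast+
    then show ?thesis by simp
  qed
qed

text \<open>The kernel bound holds with the constant 1, and \<open>2\<^sup>N + 1\<close> is used only to have one constant for both kinds of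
operator.\<close>

lemma big_haar_dyadic_shift:
  fixes t :: "real^'n" and \<T> :: "(real^'n) set \<Rightarrow> 'n operator"
  assumes shift: "big_haar_shift t r \<T> T"
    and sep: "\<forall>Q\<in>dyadic_lattice t. \<not> L2_zero_operator (\<T> Q) \<longrightarrow>
        Q \<in> (\<Union>j::int. dyadic_gen t (int k + (int r + 1) * j))"
  shows "\<exists>kap. dyadic_shift t (gen_level r k) kap (2 ^ CARD('n) + 1) T"
proof -
  let ?D = "dyadic_lattice t" and ?gam = "gen_level r k"
  obtain K where gen: "generalized_big_haar_shift t r K \<T> T"
    and canc: "\<forall>Q\<in>?D. (AE x in lebesgue. \<T> Q (indicator Q) x = 0) \<and>
           (AE x in lebesgue. integral_operator (\<lambda>x y. K Q y x) (indicator Q) x = 0)"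
    using shift unfolding big_haar_shift_def by blast
  have hk: "haar_kernel t r (cube_at t a z) (K (cube_at t a z))" and TK: "\<T> (cube_at t a z) = integral_operator (K (cube_at t a z))" for a z
    using gen dyadic_lattice_cube unfolding generalized_big_haar_shift_def by blast+
  have sum: "L2_operator_sum ?D \<T> T" using gen unfolding generalized_big_haar_shift_def by blast
  have supp: "K (cube_at t a z) x y \<noteq> 0 \<Longrightarrow> x \<in> cube_at t a z \<and> y \<in> cube_at t a z" for a z x y
    using hk[of a z] unfolding haar_kernel_def by blast
  have const: "K (cube_at t a z) x' y' = K (cube_at t a z) x y"
    if "x' \<in> cube_at t (a + int r + 1) x" "y' \<in> cube_at t (a + int r + 1) y" for a z x y x' y'
    by (rule haar_kernel_const[OF hk that])
  have bound: "\<bar>K (cube_at t a z) x y\<bar> \<le> 1 / measure lebesgue (cube_at t a z)" for a z x y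
    using hk[of a z] unfolding haar_kernel_def by blast
  have right: "(LINT y|lebesgue. K (cube_at t a z) x y) = 0" for a z x
  proof (rule AE_zero_cube_const[where \<phi>="\<lambda>x. LINT y|lebesgue. K (cube_at t a z) x y" and t=t and b="a + int r + 1"])
    have "integral_operator (K (cube_at t a z)) (indicator (cube_at t a z)) x = (LINT y|lebesgue. K (cube_at t a z) x y)" for x
      unfolding integral_operator_def
      by (rule Bochner_Integration.integral_cong[OF refl]) (use supp[of a z x] in \<open>auto simp: indicator_def\<close>)
    then show "AE x in lebesgue. (LINT y|lebesgue. K (cube_at t a z) x y) = 0"
      using canc dyadic_lattice_cube[of t a z] TK[of a z] by auto
    fix x y assume "y \<in> cube_at t (a + int r + 1) x"
    then have "K (cube_at t a z) y = K (cube_at t a z) x" by (intro ext const) simp_all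
    then show "(LINT w|lebesgue. K (cube_at t a z) y w) = (LINT w|lebesgue. K (cube_at t a z) x w)" by simp
  qed
  have left: "(LINT x|lebesgue. K (cube_at t a z) x y) = 0" for a z y
  proof (rule AE_zero_cube_const[where \<phi>="\<lambda>y. LINT x|lebesgue. K (cube_at t a z) x y" and t=t and b="a + int r + 1"])
    have "integral_operator (\<lambda>x y. K (cube_at t a z) y x) (indicator (cube_at t a z)) y = (LINT x|lebesgue. K (cube_at t a z) x y)" for y
      unfolding integral_operator_def
      by (rule Bochner_Integration.integral_cong[OF refl]) (use supp[of a z _ y] in \<open>auto simp: indicator_def\<close>)
    then show "AE y in lebesgue. (LINT x|lebesgue. K (cube_at t a z) x y) = 0"
      using canc dyadic_lattice_cube[of t a z] by auto
    fix x y assume "y \<in> cube_at t (a + int r + 1) x"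
    then have "(\<lambda>w. K (cube_at t a z) w y) = (\<lambda>w. K (cube_at t a z) w x)" by (intro ext const) simp_all
    then show "(LINT w|lebesgue. K (cube_at t a z) w y) = (LINT w|lebesgue. K (cube_at t a z) w x)" by simp
  qed
  have ck: "cancelling_kernel t z (?gam i) (?gam (i + 1)) (K (cube_at t (?gam i) z))" for i z
    unfolding gen_level_Suc by unfold_locales (simp, rule supp, assumption, rule const, assumption+, rule bound, rule right, rule left)
  have Ts: "square_integrable (\<T> P g)" if "square_integrable g" "P \<in> ?D" for P g
    using sum that unfolding L2_operator_sum_def by blast
  have us: "square_integrable (integral_operator (K (cube_at t a z)) g)" if "square_integrable g" for a z g
    using Ts[OF that dyadic_lattice_cube[of t a z]] unfolding TK .
  have blk: "block_fun t (?gam i) (?gam (i + 1)) z (\<T> (cube_at t (?gam i) z) g)" if g: "square_integrable g" for g i z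
    unfolding TK by (rule cancelling_kernel.operator_block_fun[OF ck g us[OF g]])
  have "dyadic_shift t ?gam (\<lambda>j x. K (cube_at t (?gam j) x) x) (2 ^ CARD('n) + 1) T"
  proof
    show "?gam i < ?gam j" if "i < j" for i j using that by (rule gen_level_less)
    show "(1::real) \<le> 2 ^ CARD('n) + 1" by simp
    show "y \<in> cube_at t (?gam j) x" if "K (cube_at t (?gam j) x) x y \<noteq> 0" for j x y using supp[OF that] by blast
    show "K (cube_at t (?gam j) x') x' y' = K (cube_at t (?gam j) x) x y"
      if "x' \<in> cube_at t (?gam (j + 1)) x" "y' \<in> cube_at t (?gam (j + 1)) y" for j x y x' y'
    proof -
      have "x' \<in> cube_at t (?gam j) x" using that(1) cube_at_antimono[of "?gam j" "?gam (j + 1)" t x] gen_level_less[of j "j + 1" r k] by auto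
      then have "cube_at t (?gam j) x' = cube_at t (?gam j) x" by (rule cube_at_eq)
      then show ?thesis using const that unfolding gen_level_Suc by simp
    qed
    show "\<bar>K (cube_at t (?gam j) x) x y\<bar> \<le> (2 ^ CARD('n) + 1) / measure lebesgue (cube_at t (?gam j) x)" for j x y
    proof -
      have "1 / measure lebesgue (cube_at t (?gam j) x) \<le> (2 ^ CARD('n) + 1) / measure lebesgue (cube_at t (?gam j) x)"
        by (intro divide_right_mono) auto
      then show ?thesis using bound[of "?gam j" x x y] by linarith
    qed
    show "square_integrable (T g)" if "square_integrable g" for g using sum that unfolding L2_operator_sum_def by blast
    show "(LINT x|lebesgue. (T g x)\<^sup>2) \<le> (LINT x|lebesgue. (g x)\<^sup>2)" if g: "square_integrable g" for g
    proof (rule L2_contraction[where gam="?gam", OF gen_level_less sum g separated_off_level[OF sep _ _ g] blk[OF g]])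
      fix i z
      show "(LINT x|lebesgue. (\<T> (cube_at t (?gam i) z) g x)\<^sup>2) \<le> (LINT x|lebesgue. (local_increment t (?gam i) (?gam i) (?gam (i + 1)) z g x)\<^sup>2)"
        unfolding TK by (rule cancelling_kernel.operator_norm_le_increment[OF ck g us[OF g]])
    qed
    show "average (T g) (cube_at t (?gam (j + 1)) x) - average (T g) (cube_at t (?gam j) x) = (LINT y|lebesgue. K (cube_at t (?gam j) x) x y * g y)"
      if g: "square_integrable g" for g j x
      using L2_operator_sum_increment[where gam="?gam", OF gen_level_less sum g separated_off_level[OF sep _ _ g] blk[OF g]]
      unfolding TK integral_operator_def .
  qed
  then show ?thesis by blast
qed

lemma locally_integrable_cube:
  fixes b :: "real^'n \<Rightarrow> real"
  assumes "locally_integrable b"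
  shows "set_integrable lebesgue (cube_at t a z) b"
proof (rule set_integrable_subset)
  show "cube_at t a z \<subseteq> cbox (\<chi> i. t $ i + of_int (dyadic_index t a z $ i) * 2 powi (- a)) (\<chi> i. t $ i + (of_int (dyadic_index t a z $ i) + 1) * 2 powi (- a))"
    by (rule cube_at_sandwich(2))
qed (use assms in \<open>auto simp: locally_integrable_def\<close>)

text \<open>The point is the bound on the jumps of \<open>b\<close>. Testing on the indicator of a level \<open>j\<close> cube \<open>Q\<close>, the jump is an
increment of averages of \<open>T 1\<^sub>Q\<close>. By the Cauchy-Schwarz inequality and the bound on the norm of \<open>T\<close>, the average
over a cube of level \<open>j + 1\<close> has square at most \<open>2\<^sup>-\<^sup>N\<^sup>r |Q| / |S| = 2\<^sup>N\<close>; this is where the factor \<open>2\<^sup>-\<^sup>N\<^sup>r\<^sup>/\<^sup>2\<close> in the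
hypothesis compensates the \<open>r + 1\<close> generations between \<open>Q\<close> and its child \<open>S\<close>.\<close>

lemma paraproduct_dyadic_shift:
  fixes t :: "real^'n" and \<T> :: "(real^'n) set \<Rightarrow> 'n operator"
  assumes para: "paraproduct t r b \<T> T"
    and norm: "L2_bounded_by (2 powr (- (real CARD('n) * real r / 2))) T"
    and sep: "\<forall>Q\<in>dyadic_lattice t. \<not> L2_zero_operator (\<T> Q) \<longrightarrow>
        Q \<in> (\<Union>j::int. dyadic_gen t (int k + (int r + 1) * j))"
  shows "\<exists>kap. dyadic_shift t (gen_level r k) kap (2 ^ CARD('n) + 1) T"
proof -
  let ?D = "dyadic_lattice t" and ?gam = "gen_level r k" and ?N = "CARD('n)"
  define c where "c = (2::real) powr (- (real ?N * real r / 2))"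
  have c0: "0 < c" unfolding c_def by simp
  have c1: "c \<le> 1" unfolding c_def using powr_mono[of "- (real ?N * real r / 2)" 0 "2::real"] by simp
  have c2: "c\<^sup>2 * (2 ^ r) ^ ?N = 1"
  proof -
    have "c\<^sup>2 = 2 powr (- (real ?N * real r / 2) + - (real ?N * real r / 2))"
      unfolding c_def power2_eq_square by (rule powr_add[symmetric])
    also have "- (real ?N * real r / 2) + - (real ?N * real r / 2) = - real (r * ?N)" by (simp add: mult.commute)
    also have "(2::real) powr (- real (r * ?N)) = 1 / (2 powr real (r * ?N))" by (rule powr_minus_divide)
    also have "(2::real) powr real (r * ?N) = (2 ^ r) ^ ?N" by (subst powr_realpow) (simp_all only: power_mult zero_less_numeral)
    finally show ?thesis by simp
  qed
  have b: "locally_integrable b" and sum: "L2_operator_sum ?D \<T> T"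
    and TP: "\<T> (cube_at t a z) = paraproduct_block t r b (cube_at t a z)" for a z
    using para dyadic_lattice_cube unfolding paraproduct_def by blast+
  define inc where "inc j z = local_increment t (?gam j) (?gam j + int r) (?gam (j + 1)) z b" for j z
  have Tinc: "\<T> (cube_at t (?gam j) z) g = (\<lambda>x. average g (cube_at t (?gam j) z) * inc j z x)" for j z g
    unfolding TP inc_def gen_level_Suc by (rule ext) (rule paraproduct_block_cube)
  have incb: "block_fun t (?gam j) (?gam (j + 1)) z (inc j z)" for j z
    unfolding inc_def gen_level_Suc by (rule local_increment_block_fun[OF _ _ locally_integrable_cube[OF b]]) auto
  have blk: "block_fun t (?gam i) (?gam (i + 1)) z (\<T> (cube_at t (?gam i) z) g)" for g i z
    unfolding Tinc by (rule block_fun_cmult[OF incb])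
  have mart: "average (T g) (cube_at t (?gam (j + 1)) x) - average (T g) (cube_at t (?gam j) x) = average g (cube_at t (?gam j) x) * inc j x x"
    if g: "square_integrable g" for g j x
    using L2_operator_sum_increment[where gam="?gam", OF gen_level_less sum g separated_off_level[OF sep _ _ g] blk]
    unfolding Tinc .
  have Ts: "square_integrable (T g)" and Tn: "L2_norm_fun (T g) \<le> c * L2_norm_fun g" if "square_integrable g" for g
    using norm that unfolding L2_bounded_by_def c_def by blast+
  have inc_cong: "inc j x' y' = inc j x y" if x: "x' \<in> cube_at t (?gam j) x" and y: "y' \<in> cube_at t (?gam (j + 1)) y" for j x x' y y'
  proof -
    have "inc j x' = inc j x" unfolding inc_def local_increment_def using cube_at_eq[OF x] by simp
    then show ?thesis using incb[of j x] y unfolding block_fun_def by metis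
  qed
  have inc_bound: "\<bar>inc j x x\<bar> \<le> 2 ^ ?N + 1" for j x
  proof -
    let ?Q = "cube_at t (?gam j) x" and ?S = "cube_at t (?gam (j + 1)) x"
    let ?g = "indicat_real ?Q"
    have mQ: "measure lebesgue ?Q > 0" and mS: "measure lebesgue ?S > 0" by (rule measure_cube_at_pos)+
    have g: "square_integrable ?g"
      by (rule bounded_supported_square_integrable[where t=t and a="?gam j" and z=x and B=1]) (auto simp: indicator_def split: if_splits)
    have gn: "L2_norm_fun ?g = sqrt (measure lebesgue ?Q)"
    proof -
      have "(\<lambda>y. (?g y)\<^sup>2) = ?g" by (rule ext) (auto simp: indicator_def)
      then show ?thesis unfolding L2_norm_fun_def by simp
    qed
    have ga: "average ?g ?Q = 1" by (rule average_of_const) simp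
    have gen: "\<bar>average (T ?g) R\<bar> \<le> c * sqrt (measure lebesgue ?Q / measure lebesgue R)" if R: "R = cube_at t m x" for R m
    proof -
      have "\<bar>average (T ?g) R\<bar> \<le> L2_norm_fun (T ?g) / sqrt (measure lebesgue R)"
        unfolding R by (rule abs_average_le_L2_norm[OF Ts[OF g]])
      also have "\<dots> \<le> c * sqrt (measure lebesgue ?Q) / sqrt (measure lebesgue R)"
        using Tn[OF g] unfolding gn by (intro divide_right_mono) auto
      finally show ?thesis by (simp add: real_sqrt_divide)
    qed
    have aQ: "\<bar>average (T ?g) ?Q\<bar> \<le> 1" using gen[OF refl, of "?gam j"] c1 mQ by simp
    have ratio: "measure lebesgue ?Q / measure lebesgue ?S = (2 ^ r) ^ ?N * 2 ^ ?N"
    proof -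
      have "(2::real) powi (- ?gam j) = (2 ^ r * 2) * 2 powi (- ?gam (j + 1))"
      proof -
        have "(2::real) powi (- ?gam j) = 2 powi int (r + 1) * 2 powi (- ?gam (j + 1))"
          using power_int_add[of "2::real" "int (r + 1)" "- ?gam (j + 1)"] by (simp add: gen_level_Suc)
        then show ?thesis by (simp only: power_int_of_nat) simp
      qed
      then have "measure lebesgue ?Q = ((2 ^ r) ^ ?N * 2 ^ ?N) * measure lebesgue ?S"
        by (simp only: measure_cube_at power_mult_distrib)
      then show ?thesis using mS by simp
    qed
    have "(c * sqrt (measure lebesgue ?Q / measure lebesgue ?S))\<^sup>2 = 2 ^ ?N"
      unfolding ratio power_mult_distrib using c2 by simp
    also have "(2::real) ^ ?N \<le> (2 ^ ?N)\<^sup>2" by (simp add: power2_eq_square)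
    finally have "c * sqrt (measure lebesgue ?Q / measure lebesgue ?S) \<le> 2 ^ ?N" by (rule power2_le_imp_le) simp
    then have aS: "\<bar>average (T ?g) ?S\<bar> \<le> 2 ^ ?N" using gen[OF refl, of "?gam (j + 1)"] by linarith
    show ?thesis using mart[OF g, of j x] aQ aS unfolding ga by linarith
  qed
  define kap where "kap j x y = indicator (cube_at t (?gam j) x) y / measure lebesgue (cube_at t (?gam j) x) * inc j x x" for j x y
  have "dyadic_shift t ?gam kap (2 ^ ?N + 1) T"
  proof
    show "?gam i < ?gam j" if "i < j" for i j using that by (rule gen_level_less)
    show "(1::real) \<le> 2 ^ ?N + 1" by simp
    show "y \<in> cube_at t (?gam j) x" if "kap j x y \<noteq> 0" for j x y
      using that unfolding kap_def by (cases "y \<in> cube_at t (?gam j) x") auto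
    show "kap j x' y' = kap j x y"
      if x: "x' \<in> cube_at t (?gam (j + 1)) x" and y: "y' \<in> cube_at t (?gam (j + 1)) y" for j x y x' y'
    proof -
      have le: "?gam j \<le> ?gam (j + 1)" using gen_level_less[of j "j + 1" r k] by simp
      have xj: "x' \<in> cube_at t (?gam j) x" and yj: "y' \<in> cube_at t (?gam j) y" using x y cube_at_antimono[OF le] by blast+
      have "cube_at t (?gam j) x' = cube_at t (?gam j) x" by (rule cube_at_eq[OF xj])
      moreover have "y' \<in> cube_at t (?gam j) x \<longleftrightarrow> y \<in> cube_at t (?gam j) x" using yj by (simp add: mem_cube_at)
      ultimately show ?thesis unfolding kap_def using inc_cong[OF xj x] by (simp add: indicator_def)
    qed
    show "\<bar>kap j x y\<bar> \<le> (2 ^ ?N + 1) / measure lebesgue (cube_at t (?gam j) x)" for j x y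
    proof -
      have "\<bar>kap j x y\<bar> = indicator (cube_at t (?gam j) x) y * \<bar>inc j x x\<bar> / measure lebesgue (cube_at t (?gam j) x)"
        unfolding kap_def by (simp add: abs_mult)
      also have "\<dots> \<le> 1 * (2 ^ ?N + 1) / measure lebesgue (cube_at t (?gam j) x)"
        using inc_bound[of j x] by (intro divide_right_mono mult_mono) (auto simp: indicator_def)
      finally show ?thesis by simp
    qed
    show "square_integrable (T g)" if "square_integrable g" for g by (rule Ts[OF that])
    show "(LINT x|lebesgue. (T g x)\<^sup>2) \<le> (LINT x|lebesgue. (g x)\<^sup>2)" if g: "square_integrable g" for g
    proof -
      have "0 \<le> L2_norm_fun g" unfolding L2_norm_fun_def by simp
      then have "c * L2_norm_fun g \<le> 1 * L2_norm_fun g" using c1 by (intro mult_right_mono)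
      then have "L2_norm_fun (T g) \<le> L2_norm_fun g" using Tn[OF g] by linarith
      then show ?thesis unfolding L2_norm_fun_def by simp
    qed
    show "average (T g) (cube_at t (?gam (j + 1)) x) - average (T g) (cube_at t (?gam j) x) = (LINT y|lebesgue. kap j x y * g y)"
      if g: "square_integrable g" for g j x
    proof -
      let ?Q = "cube_at t (?gam j) x"
      have "(\<lambda>y. kap j x y * g y) = (\<lambda>y. (inc j x x / measure lebesgue ?Q) * (indicator ?Q y *\<^sub>R g y))"
        unfolding kap_def by auto
      then have "(LINT y|lebesgue. kap j x y * g y) = average g ?Q * inc j x x"
        by (simp add: average_def set_lebesgue_integral_def divide_inverse)
      then show ?thesis using mart[OF g] by simp
    qed
  qed
  then show ?thesis by blast
qed

theorem theorem3p7:
  fixes \<epsilon> :: real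
  assumes "0 < \<epsilon>" and "\<epsilon> < 1"
  shows "\<exists>C>0. \<forall>(t :: real^'n) (r :: nat) (\<T> :: (real^'n) set \<Rightarrow> 'n operator) (T :: 'n operator).
           (big_haar_shift t r \<T> T \<or>
            (\<exists>b. paraproduct t r b \<T> T \<and>
                 L2_bounded_by (2 powr (- (real CARD('n) * real r / 2))) T)) \<longrightarrow>
           r_separated t r \<T> \<longrightarrow>
           (\<forall>f :: real^'n \<Rightarrow> real^'d.
              integrable lebesgue f \<and> ae_compactly_supported f \<longrightarrow>
              (\<exists>\<S>\<subseteq>dyadic_lattice t. sparse_family \<epsilon> \<S> \<and>
                 (AE x in lebesgue.
                    L1_extension_vec T f x \<in> (\<lambda>v. C *\<^sub>R v) ` sparse_operator \<S> f x)))"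
proof -
  obtain M where M: "(1/2) ^ M < \<epsilon>" using real_arch_pow_inv[OF assms(1), of "1/2"] by auto
  define A :: real where "A = 2 ^ CARD('n) + 1"
  define C where "C = domination_const A CARD('n) CARD('d) \<epsilon> M"
  have A1: "1 \<le> A" unfolding A_def by simp
  have B: "1 \<le> basis_const CARD('d)" by (rule basis_const_ge_1)
  have w: "0 < weak_const A CARD('n) + 1" unfolding weak_const_def using A1 by (simp add: add_pos_pos)
  have "0 < stop_threshold A CARD('n) CARD('d) \<epsilon>"
    unfolding stop_threshold_def using w B assms(1) by (intro divide_pos_pos mult_pos_pos) auto
  then have "0 < C"
    unfolding C_def domination_const_def using A1 B by (intro add_pos_pos mult_pos_pos) auto
  moreover have "\<exists>\<S>\<subseteq>dyadic_lattice t. sparse_family \<epsilon> \<S> \<and>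
                 (AE x in lebesgue. L1_extension_vec T f x \<in> (\<lambda>v. C *\<^sub>R v) ` sparse_operator \<S> f x)"
    if T: "big_haar_shift t r \<T> T \<or> (\<exists>b. paraproduct t r b \<T> T \<and>
                 L2_bounded_by (2 powr (- (real CARD('n) * real r / 2))) T)"
      and sep: "r_separated t r \<T>" and f: "integrable lebesgue f" "ae_compactly_supported f"
    for t :: "real^'n" and r :: nat and \<T> T and f :: "real^'n \<Rightarrow> real^'d"
  proof -
    obtain k where k: "\<forall>Q\<in>dyadic_lattice t. \<not> L2_zero_operator (\<T> Q) \<longrightarrow>
        Q \<in> (\<Union>j::int. dyadic_gen t (int k + (int r + 1) * j))"
      using sep unfolding r_separated_def by blast
    obtain kap where "dyadic_shift t (gen_level r k) kap A T"
      using T big_haar_dyadic_shift[OF _ k] paraproduct_dyadic_shift[OF _ _ k] unfolding A_def by blast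
    then interpret dyadic_shift t "gen_level r k" kap A T .
    show ?thesis unfolding C_def by (rule sparse_domination[OF f assms less_imp_le[OF M]])
  qed
  ultimately show ?thesis by blast
qed

end
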